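(* Let $q\in\mathbb{C}$ with $0<|q|<1$, let $\mathcal{A}_q=\mathcal{O}(U_q(2))$, and for $l\in\frac12\mathbb{N}$, $m\in\mathbb{Z}$ let $T_l^RD^m$ be the corepresentation of $\mathcal{A}_q$ with matrix coefficients $t^l_{ij}D^m$, $i,j\in I_l=\{-l,-l+1,\dots,l\}$. For a corepresentation $T$ of $\mathcal{A}_q$ let $\mathcal{C}(T)$ denote the vector subspace of $\mathcal{A}_q$ generated by the matrix coefficients of $T$. Then: (i) $\mathcal{A}_q=\bigoplus_{l\in\frac12\mathbb{N},\,m\in\mathbb{Z}}\mathcal{C}(T_l^RD^m)$. (ii) For all $l,l'\in\frac12\mathbb{N}$, $i,j\in I_l$, $i',j'\in I_{l'}$, $m,m'\in\mathbb{Z}$, $$\langle t^l_{ij}D^m,\,t^{l'}_{i'j'}D^{m'}\rangle_R=|q|^{-2j}\,|2l+1|_{|q|}^{-1}\,\delta_{ll'}\delta_{ii'}\delta_{jj'}\delta_{mm'},$$ $$\langle t^l_{ij}D^m,\,t^{l'}_{i'j'}D^{m'}\rangle_L=|q|^{2i}\,|2l+1|_{|q|}^{-1}\,\delta_{ll'}\delta_{ii'}\delta_{jj'}\delta_{mm'}.$$ (iii) The set $\{T_l^RD^m: l\in\frac12\mathbb{N},\,m\in\mathbb{Z}\}$ is a complete list of irreducible mutually inequivalent corepresentations of $\mathcal{A}_q$. (iv) The set $\{|q|^{-i}|2l+1|_{|q|}^{1/2}\,t^l_{ij}D^m: l\in\frac12\mathbb{N},\ i,j\in I_l,\ m\in\mathbb{Z}\}$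 is an orthonormal basis of $L^2(h)$.
   Context: $\mathbb{N}=\{0,1,2,\dots\}$. For $q\in\mathbb{C}\setminus\{0\}$, $C(U_q(2))$ is the universal unital $C^*$-algebra generated by $a,b,D$ subject to $$ba=qab,\quad a^*b=qba^*,\quad bb^*=b^*b,\quad aa^*+bb^*=1,\quad aD=Da,\quad bD=q^2|q|^{-2}Db,\quad DD^*=D^*D=1,\quad a^*a+|q|^2b^*b=1,$$ with comultiplication $\Delta(a)=a\otimes a-\bar q\,b\otimes Db^*$, $\Delta(b)=a\otimes b+b\otimes Da^*$, $\Delta(D)=D\otimes D$. $\mathcal{A}_q=\mathcal{O}(U_q(2))$ is the $*$-subalgebra generated by $a,b,D$; it is a Hopf $*$-algebra with antipode $S(a)=a^*$, $S(b)=-qbD^*$, $S(D)=D^*$, $S(a^* )=a$, $S(b^* )=-\bar q^{-1}b^*D$ and counit $\epsilon(a)=1,\epsilon(b)=0,\epsilon(D)=1$. $h$ is the Haar state of $C(U_q(2))$ (the unique state that is left and right invariant under $\Delta$). On $\mathcal{A}_q$ put $\langle x,y\rangle_L=h(x^*y)$ and $\langle x,y\rangle_R=\overline{h(xy^* )}$; $L^2(h)$ is the GNS Hilbert space, i.e. the completion of $\mathcal{A}_q$ for $\langle\cdot,\cdot\rangle_L$. Put $(\alpha,s)_n=\prod_{r=0}^{n-1}(1-\alpha s^r)$, $\binom{n}{m}_{s}=\frac{(s,s)_n}{(s,s)_m(s,s)_{n-m}}$, and $|m+1|_{|q|}=\sum_{k=0}^m|q|^{m-2k}$. For $l\in\frac12\mathbb{N}$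 and $j\in I_l$ let $f^l_j=\binom{2l}{l+j}_{|q|^2}^{1/2}a^{l-j}b^{l+j}$ and $V_l^R=\bigoplus_{j\in I_l}\mathbb{C}f^l_j\subset\mathcal{A}_q$. The comultiplication restricts to a right corepresentation $T_l^R=\Delta|_{V_l^R}:V_l^R\to V_l^R\otimes\mathcal{A}_q$, and $t^l_{ij}\in\mathcal{A}_q$ are its matrix coefficients: $\Delta(f^l_j)=\sum_{i\in I_l}f^l_i\otimes t^l_{ij}$. For $m\in\mathbb{Z}$, $T_l^RD^m$ is the corepresentation on $V_l^RD^m=\bigoplus_i\mathbb{C}f^l_iD^m$ given by $f^l_iD^m\mapsto\sum_{j\in I_l}f^l_jD^m\otimes t^l_{ji}D^m$. *)

theory Defs
  imports "HOL-Analysis.Analysis" "HOL-Library.Poly_Mapping"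
begin

hide_const (open) Poly_Mapping.map Poly_Mapping.range Poly_Mapping.nth Poly_Mapping.update
  Poly_Mapping.degree

section \<open>Complex vector spaces, unital C*-algebras, Hilbert spaces\<close>

class complex_vector = real_vector +
  fixes scaleC :: "complex \<Rightarrow> 'a \<Rightarrow> 'a"  (infixr \<open>*\<^sub>C\<close> 75)
  assumes scaleC_add_right: "c *\<^sub>C (x + y) = c *\<^sub>C x + c *\<^sub>C y"
    and scaleC_add_left: "(c + d) *\<^sub>C x = c *\<^sub>C x + d *\<^sub>C x"
    and scaleC_scaleC: "c *\<^sub>C d *\<^sub>C x = (c * d) *\<^sub>C x"
    and scaleC_one: "1 *\<^sub>C x = x"
    and scaleR_scaleC: "r *\<^sub>R x = complex_of_real r *\<^sub>C x"

global_interpretation cvec: vector_space scaleC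
  by unfold_locales (simp_all add: scaleC_add_right scaleC_add_left scaleC_scaleC scaleC_one)

abbreviation cspan :: "'a::complex_vector set \<Rightarrow> 'a set"
  where "cspan \<equiv> cvec.span"

abbreviation csubspace :: "'a::complex_vector set \<Rightarrow> bool"
  where "csubspace \<equiv> cvec.subspace"

instantiation complex :: complex_vector
begin

definition scaleC_complex :: "complex \<Rightarrow> complex \<Rightarrow> complex"
  where "scaleC_complex c x = c * x"

instance
  by standard (simp_all add: scaleC_complex_def algebra_simps scaleR_conv_of_real)

end

text \<open>A unital C*-algebra. The superclass forces \<^term>\<open>norm 1 = 1\<close>, so the algebra is nonzero.\<close>

class cstar_algebra = complex_vector + real_normed_algebra_1 + banach +
  fixes star :: "'a \<Rightarrow> 'a"
  assumes mult_scaleC_left: "(c *\<^sub>C x) * y = c *\<^sub>C (x * y)"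
    and mult_scaleC_right: "x * (c *\<^sub>C y) = c *\<^sub>C (x * y)"
    and norm_scaleC: "norm (c *\<^sub>C x) = cmod c * norm x"
    and star_star: "star (star x) = x"
    and star_add: "star (x + y) = star x + star y"
    and star_scaleC: "star (c *\<^sub>C x) = cnj c *\<^sub>C star x"
    and star_mult: "star (x * y) = star y * star x"
    and cstar_identity: "norm (star x * x) = norm x ^ 2"

text \<open>A complex Hilbert space; the inner product is conjugate linear in the first argument.\<close>

class complex_hilbert = complex_vector + real_normed_vector + banach +
  fixes cinner :: "'a \<Rightarrow> 'a \<Rightarrow> complex"
  assumes cinner_commute: "cinner x y = cnj (cinner y x)"
    and cinner_add_right: "cinner x (y + z) = cinner x y + cinner x z"
    and cinner_scaleC_right: "cinner x (c *\<^sub>C y) = c * cinner x y"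
    and cinner_norm: "cinner x x = complex_of_real (norm x ^ 2)"

definition linear_on :: "'a::complex_vector set \<Rightarrow> ('a \<Rightarrow> 'b::complex_vector) \<Rightarrow> bool"
  where "linear_on V f \<longleftrightarrow>
    (\<forall>x\<in>V. \<forall>y\<in>V. f (x + y) = f x + f y) \<and> (\<forall>c. \<forall>x\<in>V. f (c *\<^sub>C x) = c *\<^sub>C f x)"

definition star_subalgebra :: "'a::cstar_algebra set \<Rightarrow> bool"
  where "star_subalgebra S \<longleftrightarrow>
    csubspace S \<and> 1 \<in> S \<and> (\<forall>x\<in>S. \<forall>y\<in>S. x * y \<in> S) \<and> (\<forall>x\<in>S. star x \<in> S)"

text \<open>\<open>U\<close> is the direct sum of the subspaces \<open>W p\<close>, \<open>p \<in> P\<close>.\<close>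

definition direct_sum :: "'a::complex_vector set \<Rightarrow> 'p set \<Rightarrow> ('p \<Rightarrow> 'a set) \<Rightarrow> bool"
  where "direct_sum U P W \<longleftrightarrow>
    (\<forall>p\<in>P. csubspace (W p)) \<and>
    U = cspan (\<Union>p\<in>P. W p) \<and>
    (\<forall>F w. finite F \<and> F \<subseteq> P \<and> (\<forall>p\<in>F. w p \<in> W p) \<and> (\<Sum>p\<in>F. w p) = 0 \<longrightarrow> (\<forall>p\<in>F. w p = 0))"

definition orthonormal_basis :: "'h::complex_hilbert set \<Rightarrow> bool"
  where "orthonormal_basis S \<longleftrightarrow>
    (\<forall>x\<in>S. \<forall>y\<in>S. cinner x y = (if x = y then 1 else 0)) \<and> closure (cspan S) = UNIV"


section \<open>Universal C*-algebras given by generators and relations\<close>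

text \<open>
  Words in the letters \<open>(g, False)\<close>, standing for the generator \<open>g\<close>, and \<open>(g, True)\<close>, standing for
  its adjoint. With concatenation as addition, \<open>'g word \<Rightarrow>\<^sub>0 complex\<close> with the convolution product of
  \<^theory>\<open>HOL-Library.Poly_Mapping\<close> is the free unital *-algebra on \<open>'g\<close>.
\<close>

datatype 'g word = Word (letters: "('g \<times> bool) list")

instantiation word :: (type) monoid_add
begin

definition zero_word :: "'g word" where "zero_word = Word []"

definition plus_word :: "'g word \<Rightarrow> 'g word \<Rightarrow> 'g word"
  where "plus_word u v = Word (letters u @ letters v)"

instance
  by standard (simp_all add: zero_word_def plus_word_def)

end

type_synonym 'g free_alg = "'g word \<Rightarrow>\<^sub>0 complex"

definition fa_const :: "complex \<Rightarrow> 'g free_alg"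
  where "fa_const c = Poly_Mapping.single 0 c"

definition fa_gen :: "'g \<Rightarrow> 'g free_alg"
  where "fa_gen g = Poly_Mapping.single (Word [(g, False)]) 1"

definition word_star :: "'g word \<Rightarrow> 'g word"
  where "word_star w = Word (rev (map (\<lambda>(g, s). (g, \<not> s)) (letters w)))"

definition fa_star :: "'g free_alg \<Rightarrow> 'g free_alg"
  where "fa_star x =
    (\<Sum>w\<in>Poly_Mapping.keys x. Poly_Mapping.single (word_star w) (cnj (Poly_Mapping.lookup x w)))"

definition fa_eval :: "('g \<Rightarrow> 'a::cstar_algebra) \<Rightarrow> 'g free_alg \<Rightarrow> 'a"
  where "fa_eval \<gamma> x =
    (\<Sum>w\<in>Poly_Mapping.keys x. Poly_Mapping.lookup x w *\<^sub>C
       prod_list (map (\<lambda>(g, s). if s then star (\<gamma> g) else \<gamma> g) (letters w)))"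

definition cstar_seminorm :: "('g free_alg \<Rightarrow> real) \<Rightarrow> bool"
  where "cstar_seminorm p \<longleftrightarrow>
    (\<forall>x y. p (x + y) \<le> p x + p y) \<and>
    (\<forall>c x. p (fa_const c * x) = cmod c * p x) \<and>
    (\<forall>x y. p (x * y) \<le> p x * p y) \<and>
    (\<forall>x. p (fa_star x * x) = p x ^ 2)"

text \<open>
  The universal C*-algebra for the relations \<open>r = 0\<close>, \<open>r \<in> R\<close>, is the Hausdorff completion of the
  free *-algebra for the largest C*-seminorm that vanishes on \<open>R\<close>. The predicate says that the
  C*-algebra \<open>'a\<close> with the generators \<open>\<gamma>\<close> is (isomorphic to) this completion. The usual universal
  property is derived below in \<open>universal_cstar_property\<close>.
\<close>

definition universal_cstar :: "'g free_alg set \<Rightarrow> ('g \<Rightarrow> 'a::cstar_algebra) \<Rightarrow> bool"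
  where "universal_cstar R \<gamma> \<longleftrightarrow>
    (\<forall>r\<in>R. fa_eval \<gamma> r = 0) \<and>
    closure (star_subalgebra hull (range \<gamma>)) = UNIV \<and>
    (\<forall>p. cstar_seminorm p \<and> (\<forall>r\<in>R. p r = 0) \<longrightarrow> (\<forall>x. p x \<le> norm (fa_eval \<gamma> x)))"


lemma poly_mapping_sum_single:
  "x = (\<Sum>k\<in>Poly_Mapping.keys x. Poly_Mapping.single k (Poly_Mapping.lookup x k))"
  by (rule poly_mapping_eqI) (simp add: lookup_sum lookup_single when_def in_keys_iff)

lemma fa_eval_add: "fa_eval \<gamma> (x + y) = fa_eval \<gamma> x + fa_eval \<gamma> y"
  unfolding fa_eval_def by (rule setsum_keys_plus_distrib) (simp_all add: scaleC_add_left)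

lemma fa_eval_zero: "fa_eval \<gamma> 0 = 0"
  by (simp add: fa_eval_def)

lemma fa_eval_sum: "fa_eval \<gamma> (sum f A) = (\<Sum>i\<in>A. fa_eval \<gamma> (f i))"
  by (induction A rule: infinite_finite_induct) (simp_all add: fa_eval_zero fa_eval_add)

lemma fa_eval_single: "fa_eval \<gamma> (Poly_Mapping.single w c) =
    c *\<^sub>C prod_list (map (\<lambda>(g, s). if s then star (\<gamma> g) else \<gamma> g) (letters w))"
  by (cases "c = 0") (simp_all add: fa_eval_def)

lemma fa_eval_mult: "fa_eval \<gamma> (x * y) = fa_eval \<gamma> x * fa_eval \<gamma> y"
proof -
  have *: "fa_eval \<gamma> (Poly_Mapping.single u c * Poly_Mapping.single v d) =
      fa_eval \<gamma> (Poly_Mapping.single u c) * fa_eval \<gamma> (Poly_Mapping.single v d)" for u v c d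
    by (simp add: mult_single fa_eval_single plus_word_def mult_scaleC_left mult_scaleC_right
        scaleC_scaleC)
  define P Q where "P = (\<lambda>k. Poly_Mapping.single k (Poly_Mapping.lookup x k))"
    and "Q = (\<lambda>k. Poly_Mapping.single k (Poly_Mapping.lookup y k))"
  have x: "x = sum P (Poly_Mapping.keys x)" and y: "y = sum Q (Poly_Mapping.keys y)"
    unfolding P_def Q_def by (rule poly_mapping_sum_single)+
  have "fa_eval \<gamma> (sum P I * sum Q J) = fa_eval \<gamma> (sum P I) * fa_eval \<gamma> (sum Q J)" for I J
    by (simp add: sum_product fa_eval_sum * P_def Q_def)
  then show ?thesis
    using x y by metis
qed

lemma fa_eval_const: "fa_eval \<gamma> (fa_const c) = c *\<^sub>C 1"
  by (simp add: fa_const_def fa_eval_single zero_word_def)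

lemma fa_eval_gen: "fa_eval \<gamma> (fa_gen g) = \<gamma> g"
  by (simp add: fa_gen_def fa_eval_single scaleC_one)

lemma star_zero: "star (0 :: 'a::cstar_algebra) = 0"
  by (metis add_cancel_right_right star_add)

lemma star_minus: "star (- x) = - star (x :: 'a::cstar_algebra)"
  by (metis add_eq_0_iff star_add star_zero)

lemma star_sum: "star (sum f A) = (\<Sum>i\<in>A. star (f i :: 'a::cstar_algebra))"
  by (induction A rule: infinite_finite_induct) (simp_all add: star_zero star_add)

lemma star_one: "star (1 :: 'a::cstar_algebra) = 1"
  by (metis mult.right_neutral star_mult star_star)

lemma norm_star: "norm (star x) = norm (x :: 'a::cstar_algebra)"
proof -
  have "norm x \<le> norm (star x)" for x :: 'a
  proof (cases "x = 0")
    case False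
    have "norm x * norm x \<le> norm (star x) * norm x"
      using norm_mult_ineq[of "star x" x] by (simp add: cstar_identity power2_eq_square)
    with False show ?thesis by simp
  qed simp
  from this[of x] this[of "star x"] show ?thesis by (simp add: star_star)
qed

lemma fa_eval_star: "fa_eval \<gamma> (fa_star x) = star (fa_eval \<gamma> x)"
proof -
  have *: "prod_list (map (\<lambda>(g, s). if s then star (\<gamma> g) else \<gamma> g)
        (rev (map (\<lambda>(g, s). (g, \<not> s)) ws))) =
      star (prod_list (map (\<lambda>(g, s). if s then star (\<gamma> g) else \<gamma> g) ws))" for ws
    by (induction ws) (auto simp: star_one star_mult star_star)
  show ?thesis
    unfolding fa_star_def fa_eval_sum
    by (simp add: fa_eval_single word_star_def * star_sum star_scaleC fa_eval_def[of \<gamma> x])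
qed

lemma cstar_seminorm_fa_eval: "cstar_seminorm (\<lambda>x. norm (fa_eval \<gamma> x))"
  unfolding cstar_seminorm_def
  by (simp add: fa_eval_add fa_eval_mult fa_eval_const fa_eval_star norm_triangle_ineq
      norm_mult_ineq cstar_identity mult_scaleC_left norm_scaleC)

lemma star_hull_eq_range:
  fixes \<gamma> :: "'g \<Rightarrow> 'a::cstar_algebra"
  shows "star_subalgebra hull (range \<gamma>) = range (fa_eval \<gamma>)"
proof (rule hull_unique)
  show "range \<gamma> \<subseteq> range (fa_eval \<gamma>)"
    by (metis fa_eval_gen image_subsetI rangeI)
  show "star_subalgebra (range (fa_eval \<gamma>))"
    unfolding star_subalgebra_def
  proof (intro conjI ballI)
    show "csubspace (range (fa_eval \<gamma>))"
      unfolding cvec.subspace_def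
    proof (intro conjI ballI allI)
      show "0 \<in> range (fa_eval \<gamma>)" by (rule range_eqI[of _ _ 0]) (simp add: fa_eval_zero)
    next
      fix x y assume "x \<in> range (fa_eval \<gamma>)" "y \<in> range (fa_eval \<gamma>)"
      then obtain u v where "x = fa_eval \<gamma> u" "y = fa_eval \<gamma> v" by blast
      then show "x + y \<in> range (fa_eval \<gamma>)"
        by (intro range_eqI[of _ _ "u + v"]) (simp add: fa_eval_add)
    next
      fix c x assume "x \<in> range (fa_eval \<gamma>)"
      then obtain z where "x = fa_eval \<gamma> z" by blast
      then have "c *\<^sub>C x = fa_eval \<gamma> (fa_const c * z)"
        by (simp add: fa_eval_mult fa_eval_const mult_scaleC_left)
      then show "c *\<^sub>C x \<in> range (fa_eval \<gamma>)" by blast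
    qed
    have "1 = fa_eval \<gamma> (fa_const 1)" by (simp add: fa_eval_const scaleC_one)
    then show "1 \<in> range (fa_eval \<gamma>)" by blast
  next
    fix x y assume "x \<in> range (fa_eval \<gamma>)" "y \<in> range (fa_eval \<gamma>)"
    then obtain u v where "x = fa_eval \<gamma> u" "y = fa_eval \<gamma> v" by blast
    then show "x * y \<in> range (fa_eval \<gamma>)"
      by (intro range_eqI[of _ _ "u * v"]) (simp add: fa_eval_mult)
  next
    fix x assume "x \<in> range (fa_eval \<gamma>)"
    then obtain u where "x = fa_eval \<gamma> u" by blast
    then show "star x \<in> range (fa_eval \<gamma>)"
      by (intro range_eqI[of _ _ "fa_star u"]) (simp add: fa_eval_star)
  qed
next
  fix S assume S: "range \<gamma> \<subseteq> S" "star_subalgebra S"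
  have "prod_list (map (\<lambda>(g, s). if s then star (\<gamma> g) else \<gamma> g) ws) \<in> S" for ws
    using S by (induction ws) (auto simp: star_subalgebra_def image_subset_iff)
  then show "range (fa_eval \<gamma>) \<subseteq> S"
    using S(2) unfolding star_subalgebra_def fa_eval_def
    by (auto intro!: cvec.subspace_sum cvec.subspace_scale)
qed

theorem universal_cstar_property:
  fixes \<gamma> :: "'g \<Rightarrow> 'a::cstar_algebra" and \<delta> :: "'g \<Rightarrow> 'b::cstar_algebra"
  assumes univ: "universal_cstar R \<gamma>" and rel: "\<forall>r\<in>R. fa_eval \<delta> r = 0"
  shows "\<exists>!\<phi>. continuous_on UNIV \<phi> \<and> linear_on UNIV \<phi> \<and> \<phi> 1 = 1 \<and>
    (\<forall>x y. \<phi> (x * y) = \<phi> x * \<phi> y) \<and> (\<forall>x. \<phi> (star x) = star (\<phi> x)) \<and> (\<forall>g. \<phi> (\<gamma> g) = \<delta> g)"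
proof -
  let ?X = "range (fa_eval \<gamma>)"
  have dense: "closure ?X = UNIV"
    using univ by (simp add: universal_cstar_def star_hull_eq_range)
  have le: "norm (fa_eval \<delta> x) \<le> norm (fa_eval \<gamma> x)" for x
  proof -
    have "cstar_seminorm p \<Longrightarrow> (\<forall>r\<in>R. p r = 0) \<Longrightarrow> p x \<le> norm (fa_eval \<gamma> x)" for p
      using univ by (simp add: universal_cstar_def)
    from this[OF cstar_seminorm_fa_eval[of \<delta>]] show ?thesis
      using rel by simp
  qed
  have diff: "fa_eval \<eta> (x - y) = fa_eval \<eta> x - fa_eval \<eta> y" for x y and \<eta> :: "'g \<Rightarrow> 'c::cstar_algebra"
    by (metis diff_add_cancel eq_diff_eq fa_eval_add)
  define f where "f z = fa_eval \<delta> (SOME x. fa_eval \<gamma> x = z)" for z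
  have f: "f (fa_eval \<gamma> x) = fa_eval \<delta> x" for x
  proof -
    have "fa_eval \<gamma> (SOME x'. fa_eval \<gamma> x' = fa_eval \<gamma> x) = fa_eval \<gamma> x"
      by (rule someI[of _ x]) simp
    then show ?thesis
      using le[of "(SOME x'. fa_eval \<gamma> x' = fa_eval \<gamma> x) - x"] by (simp add: f_def diff)
  qed
  have "dist (f x) (f y) \<le> dist x y" if "x \<in> ?X" "y \<in> ?X" for x y
    using that le by (auto simp: f dist_norm simp flip: diff)
  then have "uniformly_continuous_on ?X f"
    unfolding uniformly_continuous_on_def by (metis (no_types, lifting) le_less_trans)
  then obtain \<phi> where "uniformly_continuous_on (closure ?X) \<phi>" and \<phi>': "\<And>x. x \<in> ?X \<Longrightarrow> f x = \<phi> x"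
    by (rule uniformly_continuous_on_extension_on_closure) blast
  then have cont: "continuous_on UNIV \<phi>"
    by (simp add: dense uniformly_continuous_imp_continuous)
  have \<phi>: "\<phi> (fa_eval \<gamma> x) = fa_eval \<delta> x" for x
    using \<phi>' f by (metis rangeI)
  have lim: "(\<lambda>n. \<phi> (s n)) \<longlonglongrightarrow> \<phi> x" if "s \<longlonglongrightarrow> x" for s x
    using cont that by (rule continuous_on_tendsto_compose) simp_all
  have approx: "\<exists>s. (\<lambda>n. fa_eval \<gamma> (s n)) \<longlonglongrightarrow> x" for x
  proof -
    obtain s where "\<forall>n. s n \<in> ?X" "s \<longlonglongrightarrow> x"
      using dense closure_sequential[of x ?X] by auto
    moreover from this(1) have "\<forall>n. \<exists>u. s n = fa_eval \<gamma> u" by blast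
    then obtain u where "s = (\<lambda>n. fa_eval \<gamma> (u n))" by metis
    ultimately show ?thesis by auto
  qed
  have bs: "bounded_linear (star :: 'c \<Rightarrow> 'c::cstar_algebra)"
    by (rule bounded_linear_intro[where K = 1])
       (simp_all add: star_add scaleR_scaleC star_scaleC norm_star)
  have add: "\<phi> (x + y) = \<phi> x + \<phi> y" for x y
  proof -
    obtain s t where st: "(\<lambda>n. fa_eval \<gamma> (s n)) \<longlonglongrightarrow> x" "(\<lambda>n. fa_eval \<gamma> (t n)) \<longlonglongrightarrow> y"
      using approx by metis
    show ?thesis
      using lim[OF tendsto_add[OF st]] tendsto_add[OF lim[OF st(1)] lim[OF st(2)]]
      unfolding fa_eval_add[symmetric] \<phi> unfolding fa_eval_add by (rule LIMSEQ_unique)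
  qed
  have mult: "\<phi> (x * y) = \<phi> x * \<phi> y" for x y
  proof -
    obtain s t where st: "(\<lambda>n. fa_eval \<gamma> (s n)) \<longlonglongrightarrow> x" "(\<lambda>n. fa_eval \<gamma> (t n)) \<longlonglongrightarrow> y"
      using approx by metis
    show ?thesis
      using lim[OF tendsto_mult[OF st]] tendsto_mult[OF lim[OF st(1)] lim[OF st(2)]]
      unfolding fa_eval_mult[symmetric] \<phi> unfolding fa_eval_mult by (rule LIMSEQ_unique)
  qed
  have star: "\<phi> (star x) = star (\<phi> x)" for x
  proof -
    obtain s where s: "(\<lambda>n. fa_eval \<gamma> (s n)) \<longlonglongrightarrow> x" using approx by metis
    show ?thesis
      using lim[OF bounded_linear.tendsto[OF bs s]] bounded_linear.tendsto[OF bs lim[OF s]]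
      unfolding fa_eval_star[symmetric] \<phi> unfolding fa_eval_star by (rule LIMSEQ_unique)
  qed
  have const: "\<phi> (c *\<^sub>C 1) = c *\<^sub>C 1" for c
    by (metis \<phi> fa_eval_const)
  have one: "\<phi> 1 = 1" using const[of 1] by (simp add: scaleC_one)
  have scale: "\<phi> (c *\<^sub>C x) = c *\<^sub>C \<phi> x" for c x
    using mult[of "c *\<^sub>C 1" x] by (simp add: const mult_scaleC_left)
  have gen: "\<phi> (\<gamma> g) = \<delta> g" for g
    by (metis \<phi> fa_eval_gen)
  show ?thesis
  proof (rule ex1I[of _ \<phi>])
    show "continuous_on UNIV \<phi> \<and> linear_on UNIV \<phi> \<and> \<phi> 1 = 1 \<and>
        (\<forall>x y. \<phi> (x * y) = \<phi> x * \<phi> y) \<and> (\<forall>x. \<phi> (star x) = star (\<phi> x)) \<and> (\<forall>g. \<phi> (\<gamma> g) = \<delta> g)"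
      using cont add scale one mult star gen by (simp add: linear_on_def)
  next
    fix \<psi>
    assume \<psi>: "continuous_on UNIV \<psi> \<and> linear_on UNIV \<psi> \<and> \<psi> 1 = 1 \<and>
        (\<forall>x y. \<psi> (x * y) = \<psi> x * \<psi> y) \<and> (\<forall>x. \<psi> (star x) = star (\<psi> x)) \<and> (\<forall>g. \<psi> (\<gamma> g) = \<delta> g)"
    have zero: "\<psi> 0 = 0"
      using \<psi> unfolding linear_on_def by (metis UNIV_I cvec.scale_zero_left)
    have sum: "\<psi> (sum g A) = (\<Sum>i\<in>A. \<psi> (g i))" for g :: "'g word \<Rightarrow> 'a" and A
      using \<psi> by (induction A rule: infinite_finite_induct) (simp_all add: zero linear_on_def)
    have prod: "\<psi> (prod_list (map (\<lambda>(g, s). if s then star (\<gamma> g) else \<gamma> g) ws)) =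
        prod_list (map (\<lambda>(g, s). if s then star (\<delta> g) else \<delta> g) ws)" for ws
      using \<psi> by (induction ws) auto
    have "\<psi> (fa_eval \<gamma> x) = fa_eval \<delta> x" for x
      using \<psi> by (simp add: fa_eval_def sum linear_on_def prod)
    then have eq: "\<psi> (fa_eval \<gamma> x) = \<phi> (fa_eval \<gamma> x)" for x by (simp add: \<phi>)
    show "\<psi> = \<phi>"
    proof
      fix x
      obtain s where s: "(\<lambda>n. fa_eval \<gamma> (s n)) \<longlonglongrightarrow> x" using approx by metis
      have "(\<lambda>n. \<psi> (fa_eval \<gamma> (s n))) \<longlonglongrightarrow> \<psi> x"
        by (rule continuous_on_tendsto_compose[OF conjunct1[OF \<psi>] s]) simp_all
      with lim[OF s] show "\<psi> x = \<phi> x" by (simp add: eq LIMSEQ_unique)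
    qed
  qed
qed


section \<open>Algebraic tensor products over the complex numbers\<close>

text \<open>
  The quotient of the free vector space on \<open>'a \<times> 'b\<close> by the subspace spanned by the bilinearity
  relators. The relators carry an arbitrary coefficient, so the additive subgroup they generate is
  already a subspace.
\<close>

inductive_set tensor_null :: "('a::complex_vector \<times> 'b::complex_vector \<Rightarrow>\<^sub>0 complex) set" where
  zero: "0 \<in> tensor_null"
| diff: "s \<in> tensor_null \<Longrightarrow> t \<in> tensor_null \<Longrightarrow> s - t \<in> tensor_null"
| add_left: "Poly_Mapping.single (x + x', y) d - Poly_Mapping.single (x, y) d
    - Poly_Mapping.single (x', y) d \<in> tensor_null"
| add_right: "Poly_Mapping.single (x, y + y') d - Poly_Mapping.single (x, y) d
    - Poly_Mapping.single (x, y') d \<in> tensor_null"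
| scale_left: "Poly_Mapping.single (c *\<^sub>C x, y) d - Poly_Mapping.single (x, y) (c * d) \<in> tensor_null"
| scale_right: "Poly_Mapping.single (x, c *\<^sub>C y) d - Poly_Mapping.single (x, y) (c * d) \<in> tensor_null"

lemma tensor_null_uminus: "s \<in> tensor_null \<Longrightarrow> - s \<in> tensor_null"
  using tensor_null.diff[OF tensor_null.zero] by simp

lemma tensor_null_add: "s \<in> tensor_null \<Longrightarrow> t \<in> tensor_null \<Longrightarrow> s + t \<in> tensor_null"
  using tensor_null.diff[OF _ tensor_null_uminus] by simp

lemma lookup_map_times: "Poly_Mapping.lookup (Poly_Mapping.map ((*) c) x) k = c * Poly_Mapping.lookup x k"
  for c :: complex
  by (simp add: Poly_Mapping.map.rep_eq when_def)

lemma map_times_diff: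
  "Poly_Mapping.map ((*) c) (x - y) = Poly_Mapping.map ((*) c) x - Poly_Mapping.map ((*) c) y"
  for c :: complex
  by (rule poly_mapping_eqI) (simp add: lookup_map_times lookup_minus algebra_simps)

lemma map_times_add:
  "Poly_Mapping.map ((*) c) (x + y) = Poly_Mapping.map ((*) c) x + Poly_Mapping.map ((*) c) y"
  for c :: complex
  by (rule poly_mapping_eqI) (simp add: lookup_map_times lookup_add algebra_simps)

lemma map_times_single:
  "Poly_Mapping.map ((*) c) (Poly_Mapping.single k d) = Poly_Mapping.single k (c * d)"
  for c :: complex
  by (rule poly_mapping_eqI) (simp add: lookup_map_times lookup_single when_def)

lemma tensor_null_scale: "s \<in> tensor_null \<Longrightarrow> Poly_Mapping.map ((*) c) s \<in> tensor_null"
proof (induction rule: tensor_null.induct)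
  case zero
  have "Poly_Mapping.map ((*) c) 0 = 0" by (rule poly_mapping_eqI) (simp add: lookup_map_times)
  then show ?case by (metis tensor_null.zero)
next
  case (diff s t)
  then show ?case by (simp only: map_times_diff) (rule tensor_null.diff)
next
  case (add_left x x' y d)
  show ?case by (simp only: map_times_diff map_times_single) (rule tensor_null.add_left)
next
  case (add_right x y y' d)
  show ?case by (simp only: map_times_diff map_times_single) (rule tensor_null.add_right)
next
  case (scale_left c' x y d)
  show ?case
    by (simp only: map_times_diff map_times_single mult.left_commute[of c c']) (rule tensor_null.scale_left)
next
  case (scale_right x c' y d)
  show ?case
    by (simp only: map_times_diff map_times_single mult.left_commute[of c c']) (rule tensor_null.scale_right)
qed

quotient_type (overloaded) ('a, 'b) tensor =
  "('a::complex_vector \<times> 'b::complex_vector) \<Rightarrow>\<^sub>0 complex" / "\<lambda>s t. s - t \<in> tensor_null"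
proof (rule equivpI)
  show "reflp (\<lambda>s t :: 'a \<times> 'b \<Rightarrow>\<^sub>0 complex. s - t \<in> tensor_null)"
    by (auto intro!: reflpI tensor_null.zero)
  show "symp (\<lambda>s t :: 'a \<times> 'b \<Rightarrow>\<^sub>0 complex. s - t \<in> tensor_null)"
    by (rule sympI) (metis tensor_null_uminus minus_diff_eq)
  show "transp (\<lambda>s t :: 'a \<times> 'b \<Rightarrow>\<^sub>0 complex. s - t \<in> tensor_null)"
  proof (rule transpI)
    fix r s t :: "'a \<times> 'b \<Rightarrow>\<^sub>0 complex"
    assume "r - s \<in> tensor_null" "s - t \<in> tensor_null"
    then have "(r - s) + (s - t) \<in> tensor_null" by (rule tensor_null_add)
    then show "r - t \<in> tensor_null" by simp
  qed
qed

instantiation tensor :: (complex_vector, complex_vector) complex_vector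
begin

lift_definition zero_tensor :: "('a, 'b) tensor" is 0 .

lift_definition plus_tensor :: "('a, 'b) tensor \<Rightarrow> ('a, 'b) tensor \<Rightarrow> ('a, 'b) tensor" is "(+)"
  using tensor_null_add by (fastforce simp: algebra_simps)

lift_definition minus_tensor :: "('a, 'b) tensor \<Rightarrow> ('a, 'b) tensor \<Rightarrow> ('a, 'b) tensor" is "(-)"
  using tensor_null.diff by (fastforce simp: algebra_simps)

lift_definition uminus_tensor :: "('a, 'b) tensor \<Rightarrow> ('a, 'b) tensor" is uminus
  using tensor_null_uminus by fastforce

lift_definition scaleC_tensor :: "complex \<Rightarrow> ('a, 'b) tensor \<Rightarrow> ('a, 'b) tensor"
  is "\<lambda>c. Poly_Mapping.map ((*) c)"
  by (simp add: map_times_diff[symmetric] tensor_null_scale)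

definition scaleR_tensor :: "real \<Rightarrow> ('a, 'b) tensor \<Rightarrow> ('a, 'b) tensor"
  where "scaleR_tensor r t = complex_of_real r *\<^sub>C t"

instance
proof
  fix s t u :: "('a, 'b) tensor" and c d :: complex and r r' :: real
  show "s + t + u = s + (t + u)"
    by transfer (simp add: tensor_null.zero algebra_simps)
  show "s + t = t + s"
    by transfer (simp add: tensor_null.zero algebra_simps)
  show "0 + s = s"
    by transfer (simp add: tensor_null.zero)
  show "- s + s = 0"
    by transfer (simp add: tensor_null.zero)
  show "s - t = s + - t"
    by transfer (simp add: tensor_null.zero)
  show 1: "c *\<^sub>C (s + t) = c *\<^sub>C s + c *\<^sub>C t" for c
    by transfer (simp add: tensor_null.zero map_times_add)
  show 2: "(c + d) *\<^sub>C s = c *\<^sub>C s + d *\<^sub>C s" for c d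
  proof transfer
    fix c d :: complex and s :: "'a \<times> 'b \<Rightarrow>\<^sub>0 complex"
    have "Poly_Mapping.map ((*) (c + d)) s
        = Poly_Mapping.map ((*) c) s + Poly_Mapping.map ((*) d) s"
      by (rule poly_mapping_eqI) (simp add: lookup_map_times lookup_add algebra_simps)
    then show "Poly_Mapping.map ((*) (c + d)) s
        - (Poly_Mapping.map ((*) c) s + Poly_Mapping.map ((*) d) s) \<in> tensor_null"
      by (simp add: tensor_null.zero)
  qed
  show 3: "c *\<^sub>C d *\<^sub>C s = (c * d) *\<^sub>C s" for c d
  proof transfer
    fix c d :: complex and s :: "'a \<times> 'b \<Rightarrow>\<^sub>0 complex"
    have "Poly_Mapping.map ((*) c) (Poly_Mapping.map ((*) d) s) = Poly_Mapping.map ((*) (c * d)) s"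
      by (rule poly_mapping_eqI) (simp add: lookup_map_times)
    then show "Poly_Mapping.map ((*) c) (Poly_Mapping.map ((*) d) s)
        - Poly_Mapping.map ((*) (c * d)) s \<in> tensor_null"
      by (simp add: tensor_null.zero)
  qed
  show 4: "1 *\<^sub>C s = s"
  proof transfer
    fix s :: "'a \<times> 'b \<Rightarrow>\<^sub>0 complex"
    have "Poly_Mapping.map ((*) 1) s = s"
      by (rule poly_mapping_eqI) (simp add: lookup_map_times)
    then show "Poly_Mapping.map ((*) 1) s - s \<in> tensor_null"
      by (simp add: tensor_null.zero)
  qed
  show 5: "r *\<^sub>R s = complex_of_real r *\<^sub>C s" for r and s :: "('a, 'b) tensor"
    by (simp add: scaleR_tensor_def)
  show "r *\<^sub>R (s + t) = r *\<^sub>R s + r *\<^sub>R t"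
    by (simp add: 1 5)
  show "(r + r') *\<^sub>R s = r *\<^sub>R s + r' *\<^sub>R s"
    by (simp add: 2 5)
  show "r *\<^sub>R r' *\<^sub>R s = (r * r') *\<^sub>R s"
    by (simp add: 3 5)
  show "1 *\<^sub>R s = s"
    by (simp add: 4 5)
qed

end

lift_definition tensor_elem ::
  "'a::complex_vector \<Rightarrow> 'b::complex_vector \<Rightarrow> ('a, 'b) tensor"  (infixr \<open>\<otimes>\<close> 72)
  is "\<lambda>x y. Poly_Mapping.single (x, y) 1" .

definition tensor_sub ::
  "'a::complex_vector set \<Rightarrow> 'b::complex_vector set \<Rightarrow> ('a, 'b) tensor set"
  where "tensor_sub V W = cspan {x \<otimes> y |x y. x \<in> V \<and> y \<in> W}"

text \<open>
  The additive map on \<open>tensor_sub V W\<close> with \<open>x \<otimes> y \<mapsto> \<beta> x y\<close>, for \<open>\<beta>\<close> bilinear on \<open>V \<times> W\<close> (or, as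
  needed for the involution, conjugate linear in both variables). See \<open>tensor_lift_eq\<close> for the proof
  that it is well defined.
\<close>

definition tensor_lift :: "'a::complex_vector set \<Rightarrow> 'b::complex_vector set \<Rightarrow>
    ('a \<Rightarrow> 'b \<Rightarrow> 'c::ab_group_add) \<Rightarrow> ('a, 'b) tensor \<Rightarrow> 'c"
  where "tensor_lift V W \<beta> t = (THE z. \<exists>ps. set ps \<subseteq> V \<times> W \<and>
    t = (\<Sum>(x, y)\<leftarrow>ps. x \<otimes> y) \<and> z = (\<Sum>(x, y)\<leftarrow>ps. \<beta> x y))"

text \<open>A balanced biadditive map factors through the tensor product.\<close>

lemma tensor_elem_universal:
  fixes \<beta> :: "'a::complex_vector \<Rightarrow> 'b::complex_vector \<Rightarrow> 'c::ab_group_add"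
  assumes add_left: "\<And>x x' y. \<beta> (x + x') y = \<beta> x y + \<beta> x' y"
    and add_right: "\<And>x y y'. \<beta> x (y + y') = \<beta> x y + \<beta> x y'"
    and balanced: "\<And>c x y. \<beta> (c *\<^sub>C x) y = \<beta> x (c *\<^sub>C y)"
    and eq: "(\<Sum>(x, y)\<leftarrow>ps. x \<otimes> y) = (\<Sum>(x, y)\<leftarrow>qs. x \<otimes> y)"
  shows "(\<Sum>(x, y)\<leftarrow>ps. \<beta> x y) = (\<Sum>(x, y)\<leftarrow>qs. \<beta> x y)"
proof -
  define G where "G s = (\<Sum>k\<in>Poly_Mapping.keys s. \<beta> (Poly_Mapping.lookup s k *\<^sub>C fst k) (snd k))" for s
  have \<beta>0: "\<beta> 0 y = 0" for y
    using add_left[of 0 0 y] by simp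
  have G_add: "G (s + t) = G s + G t" for s t
    unfolding G_def by (rule setsum_keys_plus_distrib) (simp_all add: \<beta>0 scaleC_add_left add_left)
  have G_diff: "G (s - t) = G s - G t" for s t
    by (metis G_add diff_add_cancel eq_diff_eq)
  have G_single: "G (Poly_Mapping.single (x, y) d) = \<beta> (d *\<^sub>C x) y" for x y d
    by (cases "d = 0") (simp_all add: G_def \<beta>0)
  have G_null: "G s = 0" if "s \<in> tensor_null" for s
    using that
    by (induction rule: tensor_null.induct)
       (simp_all add: G_diff G_single scaleC_add_right add_left add_right scaleC_scaleC mult.commute
         balanced, simp add: G_def)
  define S where "S ps = (\<Sum>p\<leftarrow>ps. Poly_Mapping.single p (1::complex))" for ps :: "('a \<times> 'b) list"
  have abs: "(\<Sum>(x, y)\<leftarrow>ps. x \<otimes> y) = abs_tensor (S ps)" for ps :: "('a \<times> 'b) list"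
    by (induction ps) (auto simp: S_def zero_tensor.abs_eq tensor_elem.abs_eq plus_tensor.abs_eq)
  have G_S: "G (S ps) = (\<Sum>(x, y)\<leftarrow>ps. \<beta> x y)" for ps
    by (induction ps) (auto simp: S_def G_add G_single scaleC_one, simp add: G_def)
  from eq have "S ps - S qs \<in> tensor_null"
    by (simp add: abs tensor.abs_eq_iff)
  then have "G (S ps) = G (S qs)"
    using G_null G_diff by fastforce
  then show ?thesis by (simp add: G_S)
qed

lemma csubspace_projection:
  assumes "csubspace V"
  obtains P where "\<And>x y. P (x + y) = P x + P y" "\<And>c x. P (c *\<^sub>C x) = c *\<^sub>C P x"
    "\<And>x. P x \<in> V" "\<And>x. x \<in> V \<Longrightarrow> P x = x"
proof -
  interpret pair: vector_space_pair "scaleC :: complex \<Rightarrow> 'a \<Rightarrow> 'a" "scaleC :: complex \<Rightarrow> 'a \<Rightarrow> 'a" ..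
  have "Vector_Spaces.linear scaleC scaleC (id :: 'a \<Rightarrow> 'a)"
    by (rule cvec.linear_id)
  from pair.linear_exists_left_inverse_on[OF this assms]
  obtain P where P: "range P \<subseteq> V" "Vector_Spaces.linear scaleC scaleC P" "\<forall>v\<in>V. P v = v"
    by auto
  interpret P: Vector_Spaces.linear scaleC scaleC P by (fact P(2))
  show thesis
    using P by (intro that[of P]) (auto simp: P.add P.scale)
qed

lemma tensor_lift_eq:
  assumes V: "csubspace V" and W: "csubspace W"
    and add_left: "\<And>x x' y. x \<in> V \<Longrightarrow> x' \<in> V \<Longrightarrow> y \<in> W \<Longrightarrow> \<beta> (x + x') y = \<beta> x y + \<beta> x' y"
    and add_right: "\<And>x y y'. x \<in> V \<Longrightarrow> y \<in> W \<Longrightarrow> y' \<in> W \<Longrightarrow> \<beta> x (y + y') = \<beta> x y + \<beta> x y'"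
    and balanced: "\<And>c x y. x \<in> V \<Longrightarrow> y \<in> W \<Longrightarrow> \<beta> (c *\<^sub>C x) y = \<beta> x (c *\<^sub>C y)"
    and ps: "set ps \<subseteq> V \<times> W"
  shows "tensor_lift V W \<beta> (\<Sum>(x, y)\<leftarrow>ps. x \<otimes> y) = (\<Sum>(x, y)\<leftarrow>ps. \<beta> x y)"
proof -
  obtain P where P: "\<And>x y. P (x + y) = P x + P y" "\<And>c x. P (c *\<^sub>C x) = c *\<^sub>C P x"
    "\<And>x. P x \<in> V" "\<And>x. x \<in> V \<Longrightarrow> P x = x"
    using csubspace_projection[OF V] by metis
  obtain Q where Q: "\<And>x y. Q (x + y) = Q x + Q y" "\<And>c x. Q (c *\<^sub>C x) = c *\<^sub>C Q x"
    "\<And>x. Q x \<in> W" "\<And>x. x \<in> W \<Longrightarrow> Q x = x"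
    using csubspace_projection[OF W] by metis
  have PQ: "(\<Sum>(x, y)\<leftarrow>qs. \<beta> (P x) (Q y)) = (\<Sum>(x, y)\<leftarrow>qs. \<beta> x y)" if "set qs \<subseteq> V \<times> W" for qs
    using that by (intro arg_cong[of _ _ sum_list] map_cong) (auto simp: P(4) Q(4))
  show ?thesis
    unfolding tensor_lift_def
  proof (rule the_equality)
    show "\<exists>qs. set qs \<subseteq> V \<times> W \<and> (\<Sum>(x, y)\<leftarrow>ps. x \<otimes> y) = (\<Sum>(x, y)\<leftarrow>qs. x \<otimes> y) \<and>
        (\<Sum>(x, y)\<leftarrow>ps. \<beta> x y) = (\<Sum>(x, y)\<leftarrow>qs. \<beta> x y)"
      using ps by blast
  next
    fix z
    assume "\<exists>qs. set qs \<subseteq> V \<times> W \<and> (\<Sum>(x, y)\<leftarrow>ps. x \<otimes> y) = (\<Sum>(x, y)\<leftarrow>qs. x \<otimes> y) \<and>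
        z = (\<Sum>(x, y)\<leftarrow>qs. \<beta> x y)"
    then obtain qs where qs: "set qs \<subseteq> V \<times> W"
      "(\<Sum>(x, y)\<leftarrow>ps. x \<otimes> y) = (\<Sum>(x, y)\<leftarrow>qs. x \<otimes> y)" "z = (\<Sum>(x, y)\<leftarrow>qs. \<beta> x y)"
      by blast
    have "(\<Sum>(x, y)\<leftarrow>ps. \<beta> (P x) (Q y)) = (\<Sum>(x, y)\<leftarrow>qs. \<beta> (P x) (Q y))"
      by (rule tensor_elem_universal[where \<beta> = "\<lambda>x y. \<beta> (P x) (Q y)", OF _ _ _ qs(2)])
         (simp_all add: P Q add_left add_right balanced)
    then show "z = (\<Sum>(x, y)\<leftarrow>ps. \<beta> x y)"
      using ps qs by (simp add: PQ)
  qed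
qed

definition tensor_mult ::
  "('a::cstar_algebra, 'b::cstar_algebra) tensor \<Rightarrow> ('a, 'b) tensor \<Rightarrow> ('a, 'b) tensor"
  where "tensor_mult s t = tensor_lift UNIV UNIV
    (\<lambda>x y. tensor_lift UNIV UNIV (\<lambda>x' y'. (x * x') \<otimes> (y * y')) t) s"

definition tensor_star :: "('a::cstar_algebra, 'b::cstar_algebra) tensor \<Rightarrow> ('a, 'b) tensor"
  where "tensor_star = tensor_lift UNIV UNIV (\<lambda>x y. star x \<otimes> star y)"

definition tensor_assoc ::
  "(('a::complex_vector, 'b::complex_vector) tensor, 'c::complex_vector) tensor \<Rightarrow>
    ('a, ('b, 'c) tensor) tensor"
  where "tensor_assoc = tensor_lift UNIV UNIV
    (\<lambda>t z. tensor_lift UNIV UNIV (\<lambda>x y. x \<otimes> (y \<otimes> z)) t)"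


section \<open>Corepresentations\<close>

text \<open>
  \<open>A\<close> is a *-subalgebra of a C*-algebra, \<open>\<Delta>\<close> and \<open>\<epsilon>\<close> are its comultiplication and counit; only
  their values on \<open>A\<close> matter. A (right) corepresentation of \<open>A\<close> on the space \<open>V\<close> is a linear map
  \<open>T : V \<rightarrow> V \<otimes> A\<close> with \<open>(T \<otimes> id) T = (id \<otimes> \<Delta>) T\<close> and \<open>(id \<otimes> \<epsilon>) T = id\<close>.
\<close>

definition corep :: "'a::cstar_algebra set \<Rightarrow> ('a \<Rightarrow> ('a, 'a) tensor) \<Rightarrow> ('a \<Rightarrow> complex) \<Rightarrow>
    'v::complex_vector set \<Rightarrow> ('v \<Rightarrow> ('v, 'a) tensor) \<Rightarrow> bool"
  where "corep A \<Delta> \<epsilon> V T \<longleftrightarrow>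
    csubspace V \<and> linear_on V T \<and>
    (\<forall>v\<in>V. T v \<in> tensor_sub V A \<and>
      tensor_assoc (tensor_lift V A (\<lambda>w x. T w \<otimes> x) (T v)) = tensor_lift V A (\<lambda>w x. w \<otimes> \<Delta> x) (T v) \<and>
      tensor_lift V A (\<lambda>w x. \<epsilon> x *\<^sub>C w) (T v) = v)"

definition irreducible_corep :: "'a::cstar_algebra set \<Rightarrow> ('a \<Rightarrow> ('a, 'a) tensor) \<Rightarrow>
    ('a \<Rightarrow> complex) \<Rightarrow> 'v::complex_vector set \<Rightarrow> ('v \<Rightarrow> ('v, 'a) tensor) \<Rightarrow> bool"
  where "irreducible_corep A \<Delta> \<epsilon> V T \<longleftrightarrow>
    corep A \<Delta> \<epsilon> V T \<and> V \<noteq> {0} \<and>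
    (\<forall>W. csubspace W \<and> W \<subseteq> V \<and> (\<forall>w\<in>W. T w \<in> tensor_sub W A) \<longrightarrow> W = {0} \<or> W = V)"

definition equivalent_corep :: "'a::cstar_algebra set \<Rightarrow>
    'v::complex_vector set \<Rightarrow> ('v \<Rightarrow> ('v, 'a) tensor) \<Rightarrow>
    'w::complex_vector set \<Rightarrow> ('w \<Rightarrow> ('w, 'a) tensor) \<Rightarrow> bool"
  where "equivalent_corep A V T V' T' \<longleftrightarrow>
    (\<exists>F. linear_on V F \<and> bij_betw F V V' \<and>
      (\<forall>v\<in>V. T' (F v) = tensor_lift V A (\<lambda>w x. F w \<otimes> x) (T v)))"

text \<open>The matrix coefficients with respect to a basis \<open>(e i)\<close>, \<open>i \<in> I\<close>, of a finite-dimensional space.\<close>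

definition matrix_coeff :: "'a::cstar_algebra set \<Rightarrow> 'i set \<Rightarrow> ('i \<Rightarrow> 'v::complex_vector) \<Rightarrow>
    ('v \<Rightarrow> ('v, 'a) tensor) \<Rightarrow> 'i \<Rightarrow> 'i \<Rightarrow> 'a"
  where "matrix_coeff A I e T = (SOME t. \<forall>j\<in>I. T (e j) = (\<Sum>i\<in>I. e i \<otimes> t i j) \<and> (\<forall>i\<in>I. t i j \<in> A))"

text \<open>The span \<open>\<C>(T)\<close> of the matrix coefficients; it does not depend on the choice of the basis.\<close>

definition coeff_space :: "'a::cstar_algebra set \<Rightarrow> 'i set \<Rightarrow> ('i \<Rightarrow> 'v::complex_vector) \<Rightarrow>
    ('v \<Rightarrow> ('v, 'a) tensor) \<Rightarrow> 'a set"
  where "coeff_space A I e T = cspan {matrix_coeff A I e T i j |i j. i \<in> I \<and> j \<in> I}"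

definition linear_extension :: "'i set \<Rightarrow> ('i \<Rightarrow> 'a::complex_vector) \<Rightarrow> ('i \<Rightarrow> 'b::complex_vector) \<Rightarrow> 'a \<Rightarrow> 'b"
  where "linear_extension I e g x =
    (THE y. \<exists>c. x = (\<Sum>i\<in>I. c i *\<^sub>C e i) \<and> y = (\<Sum>i\<in>I. c i *\<^sub>C g i))"


section \<open>States\<close>

definition state :: "('a::cstar_algebra \<Rightarrow> complex) \<Rightarrow> bool"
  where "state h \<longleftrightarrow> linear_on UNIV h \<and> (\<forall>x. h (star x * x) \<in> \<real>\<^sub>\<ge>\<^sub>0) \<and> h 1 = 1"

text \<open>
  A state on the C*-algebra which is left and right invariant. Invariance is required on the
  dense *-subalgebra \<open>A\<close>, where \<open>\<Delta>\<close> takes values in the algebraic tensor product.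
\<close>

definition haar_state :: "'a::cstar_algebra set \<Rightarrow> ('a \<Rightarrow> ('a, 'a) tensor) \<Rightarrow> ('a \<Rightarrow> complex) \<Rightarrow> bool"
  where "haar_state A \<Delta> h \<longleftrightarrow> state h \<and>
    (\<forall>x\<in>A. tensor_lift A A (\<lambda>y z. h z *\<^sub>C y) (\<Delta> x) = h x *\<^sub>C 1 \<and>
           tensor_lift A A (\<lambda>y z. h y *\<^sub>C z) (\<Delta> x) = h x *\<^sub>C 1)"

definition inner_L :: "('a::cstar_algebra \<Rightarrow> complex) \<Rightarrow> 'a \<Rightarrow> 'a \<Rightarrow> complex"
  where "inner_L h x y = h (star x * y)"

definition inner_R :: "('a::cstar_algebra \<Rightarrow> complex) \<Rightarrow> 'a \<Rightarrow> 'a \<Rightarrow> complex"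
  where "inner_R h x y = cnj (h (x * star y))"

text \<open>The Hilbert space \<open>'h\<close> with the map \<open>\<Lambda> : A \<rightarrow> 'h\<close> is the completion of \<open>A\<close> for \<^const>\<open>inner_L\<close>.\<close>

definition gns_space :: "'a::cstar_algebra set \<Rightarrow> ('a \<Rightarrow> complex) \<Rightarrow> ('a \<Rightarrow> 'h::complex_hilbert) \<Rightarrow> bool"
  where "gns_space A h \<Lambda> \<longleftrightarrow> linear_on A \<Lambda> \<and>
    (\<forall>x\<in>A. \<forall>y\<in>A. cinner (\<Lambda> x) (\<Lambda> y) = inner_L h x y) \<and> closure (\<Lambda> ` A) = UNIV"


section \<open>The quantum group \<open>U\<^sub>q(2)\<close>\<close>

datatype Uq2_gen = Gen_a | Gen_b | Gen_D

definition Uq2_relators :: "complex \<Rightarrow> Uq2_gen free_alg set"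
  where "Uq2_relators q =
    (let a = fa_gen Gen_a; b = fa_gen Gen_b; D = fa_gen Gen_D;
         a' = fa_star a; b' = fa_star b; D' = fa_star D
     in {b * a - fa_const q * a * b,
         a' * b - fa_const q * b * a',
         b * b' - b' * b,
         a * a' + b * b' - 1,
         a * D - D * a,
         b * D - fa_const (q\<^sup>2 / complex_of_real ((cmod q)\<^sup>2)) * D * b,
         D * D' - 1,
         D' * D - 1,
         a' * a + fa_const (complex_of_real ((cmod q)\<^sup>2)) * b' * b - 1})"

definition Uq2_cstar :: "complex \<Rightarrow> 'a::cstar_algebra \<Rightarrow> 'a \<Rightarrow> 'a \<Rightarrow> bool"
  where "Uq2_cstar q a b D \<longleftrightarrow> universal_cstar (Uq2_relators q) (case_Uq2_gen a b D)"

definition Uq2_alg :: "'a::cstar_algebra \<Rightarrow> 'a \<Rightarrow> 'a \<Rightarrow> 'a set"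
  where "Uq2_alg a b D = star_subalgebra hull {a, b, D}"

text \<open>The comultiplication of the Hopf *-algebra \<open>\<O>(U\<^sub>q(2))\<close> (its values off \<^const>\<open>Uq2_alg\<close> are irrelevant).\<close>

definition Uq2_comult :: "complex \<Rightarrow> 'a::cstar_algebra \<Rightarrow> 'a \<Rightarrow> 'a \<Rightarrow> ('a \<Rightarrow> ('a, 'a) tensor) \<Rightarrow> bool"
  where "Uq2_comult q a b D \<Delta> \<longleftrightarrow>
    (let A = Uq2_alg a b D in
      linear_on A \<Delta> \<and> \<Delta> ` A \<subseteq> tensor_sub A A \<and> \<Delta> 1 = 1 \<otimes> 1 \<and>
      (\<forall>x\<in>A. \<forall>y\<in>A. \<Delta> (x * y) = tensor_mult (\<Delta> x) (\<Delta> y)) \<and>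
      (\<forall>x\<in>A. \<Delta> (star x) = tensor_star (\<Delta> x))) \<and>
    \<Delta> a = a \<otimes> a - cnj q *\<^sub>C (b \<otimes> (D * star b)) \<and>
    \<Delta> b = a \<otimes> b + b \<otimes> (D * star a) \<and>
    \<Delta> D = D \<otimes> D"

definition Uq2_counit :: "'a::cstar_algebra \<Rightarrow> 'a \<Rightarrow> 'a \<Rightarrow> ('a \<Rightarrow> complex) \<Rightarrow> bool"
  where "Uq2_counit a b D \<epsilon> \<longleftrightarrow>
    (let A = Uq2_alg a b D in
      linear_on A \<epsilon> \<and> \<epsilon> 1 = 1 \<and> (\<forall>x\<in>A. \<forall>y\<in>A. \<epsilon> (x * y) = \<epsilon> x * \<epsilon> y) \<and>
      (\<forall>x\<in>A. \<epsilon> (star x) = cnj (\<epsilon> x))) \<and>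
    \<epsilon> a = 1 \<and> \<epsilon> b = 0 \<and> \<epsilon> D = 1"

definition half_nats :: "real set"
  where "half_nats = {real n / 2 |n :: nat. True}"

definition spin_range :: "real \<Rightarrow> real set"  (\<open>I\<^sub>s\<close>)
  where "I\<^sub>s l = {- l + real k |k :: nat. real k \<le> 2 * l}"

definition q_poch :: "real \<Rightarrow> real \<Rightarrow> nat \<Rightarrow> real"
  where "q_poch \<alpha> s n = (\<Prod>r<n. 1 - \<alpha> * s ^ r)"

definition q_binom :: "real \<Rightarrow> nat \<Rightarrow> nat \<Rightarrow> real"
  where "q_binom s n m = q_poch s s n / (q_poch s s m * q_poch s s (n - m))"

text \<open>\<open>q_number r m\<close> is \<open>|m + 1|\<^sub>r\<close>.\<close>

definition q_number :: "real \<Rightarrow> nat \<Rightarrow> real"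
  where "q_number r m = (\<Sum>k\<le>m. r powi (int m - 2 * int k))"

text \<open>Integer powers of a unitary.\<close>

definition upow :: "'a::cstar_algebra \<Rightarrow> int \<Rightarrow> 'a"
  where "upow D m = (if 0 \<le> m then D ^ nat m else star D ^ nat (- m))"

definition Uq2_f :: "complex \<Rightarrow> 'a::cstar_algebra \<Rightarrow> 'a \<Rightarrow> real \<Rightarrow> real \<Rightarrow> 'a"
  where "Uq2_f q a b l j =
    complex_of_real (sqrt (q_binom ((cmod q)\<^sup>2) (nat \<lfloor>2 * l\<rfloor>) (nat \<lfloor>l + j\<rfloor>))) *\<^sub>C
      (a ^ nat \<lfloor>l - j\<rfloor> * b ^ nat \<lfloor>l + j\<rfloor>)"

text \<open>The matrix coefficients \<open>t l i j\<close> of the restriction of \<open>\<Delta>\<close> to the span of the \<open>f l j\<close>.\<close>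

definition Uq2_t :: "complex \<Rightarrow> 'a::cstar_algebra \<Rightarrow> 'a \<Rightarrow> 'a \<Rightarrow> ('a \<Rightarrow> ('a, 'a) tensor) \<Rightarrow>
    real \<Rightarrow> real \<Rightarrow> real \<Rightarrow> 'a"
  where "Uq2_t q a b D \<Delta> l = matrix_coeff (Uq2_alg a b D) (I\<^sub>s l) (Uq2_f q a b l) \<Delta>"

definition Uq2_fD :: "complex \<Rightarrow> 'a::cstar_algebra \<Rightarrow> 'a \<Rightarrow> 'a \<Rightarrow> real \<Rightarrow> int \<Rightarrow> real \<Rightarrow> 'a"
  where "Uq2_fD q a b D l m i = Uq2_f q a b l i * upow D m"

definition Uq2_tD :: "complex \<Rightarrow> 'a::cstar_algebra \<Rightarrow> 'a \<Rightarrow> 'a \<Rightarrow> ('a \<Rightarrow> ('a, 'a) tensor) \<Rightarrow>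
    real \<Rightarrow> int \<Rightarrow> real \<Rightarrow> real \<Rightarrow> 'a"
  where "Uq2_tD q a b D \<Delta> l m i j = Uq2_t q a b D \<Delta> l i j * upow D m"

definition Uq2_V :: "complex \<Rightarrow> 'a::cstar_algebra \<Rightarrow> 'a \<Rightarrow> 'a \<Rightarrow> real \<Rightarrow> int \<Rightarrow> 'a set"
  where "Uq2_V q a b D l m = cspan (Uq2_fD q a b D l m ` I\<^sub>s l)"

text \<open>The corepresentation \<open>T\<^sub>l\<^sup>RD\<^sup>m\<close> on the space \<^const>\<open>Uq2_V\<close>.\<close>

definition Uq2_T :: "complex \<Rightarrow> 'a::cstar_algebra \<Rightarrow> 'a \<Rightarrow> 'a \<Rightarrow> ('a \<Rightarrow> ('a, 'a) tensor) \<Rightarrow>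
    real \<Rightarrow> int \<Rightarrow> 'a \<Rightarrow> ('a, 'a) tensor"
  where "Uq2_T q a b D \<Delta> l m = linear_extension (I\<^sub>s l) (Uq2_fD q a b D l m)
    (\<lambda>i. \<Sum>j\<in>I\<^sub>s l. Uq2_fD q a b D l m j \<otimes> Uq2_tD q a b D \<Delta> l m j i)"

end

theory Submission
  imports Defs
begin

text \<open>
  The monomials \<open>a\<^sup>n\<^sup>-\<^sup>k b\<^sup>k\<close> span a comodule with an unnormalized coefficient matrix \<open>tau\<close> that satisfies a
  first order recursion in \<open>n\<close>, because \<open>\<Delta>\<close> is multiplicative. The first column of \<open>tau\<close> is
  proportional to \<open>a\<^sup>n\<^sup>-\<^sup>i c\<^sup>i\<close> with \<open>c = - cnj q D b\<^sup>*\<close>, and these elements span a left comodule; this gives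
  the transposed recursion. Together with the \<open>q\<close>-Pascal rule the two recursions show that the
  normalized matrix \<open>U\<close> is unitary, and together with the quantum determinant relation between the
  levels \<open>n\<close> and \<open>n - 1\<close> they express every product of a coefficient with a generator by
  coefficients, so that the coefficients span \<open>\<O>(U\<^sub>q(2))\<close>.

  By invariance of the Haar state, \<open>h (u\<^sup>* u')\<close> and \<open>h (u u'\<^sup>*)\<close> are intertwiners between unitary
  corepresentations. Such an intertwiner preserves the weights for the characters
  \<open>a \<mapsto> cis \<theta>\<close>, \<open>b \<mapsto> 0\<close>, \<open>D \<mapsto> cis \<phi>\<close>, and it is scalar or zero since the first row and column of
  \<open>U\<close> do not vanish. The constants follow by comparing \<open>a\<^sup>n\<^sup>-\<^sup>i b\<^sup>i\<close> with \<open>a\<^sup>n\<^sup>-\<^sup>i c\<^sup>i\<close> and from unitarity. The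
  universality of the C*-algebra enters through the characters and through a representation on
  finitely supported functions, which separates the monomials.
\<close>

section \<open>Tensor calculus\<close>

text \<open>The elements \<open>c\<close> and \<open>d\<close> complete the row (a, b) to a unitary
  2 by 2 corepresentation matrix. The unnormalized \<open>tau\<close> keeps both recursions free of
  square roots; these enter only in \<open>U\<close>. The obstacle to spanning is that a recursion
  controls a combination of two products such as \<open>tau n (Suc j) i * a\<close> and
  \<open>tau n j i * b\<close>, not each of them. The quantum determinant supplies a second
  combination, equal to a coefficient of level n - 1 times \<open>D\<close>. Eliminating one product
  leaves the other with the factor \<open>w (Suc n) (Suc j)\<close>, a positive q-binomial
  coefficient. For orthogonality, index i at level n with power m has weight (n - 2 i, i + m). For
  n' < n the extreme weight n is missing at level n', so a row of an intertwiner vanishes, and the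
  nonzero entries of \<open>U\<close> spread this to the whole matrix. The powers of |q| arise
  because \<open>c\<close> is a multiple of \<open>D * star b\<close> with \<open>b\<close> normal
  and \<open>D\<close> unitary: replacing \<open>b\<close> by \<open>c\<close> rescales the squares
  of the monomials by s ^ i.\<close>

lemma tensor_add_left: "(x + x') \<otimes> y = x \<otimes> y + x' \<otimes> y"
  by transfer (metis (no_types, lifting) diff_diff_add tensor_null.add_left)

lemma tensor_add_right: "x \<otimes> (y + y') = x \<otimes> y + x \<otimes> y'"
  by transfer (metis (no_types, lifting) diff_diff_add tensor_null.add_right)

lemma tensor_scale_left: "(c *\<^sub>C x) \<otimes> y = c *\<^sub>C (x \<otimes> y)"
  by transfer (simp add: map_times_single, metis mult.right_neutral tensor_null.scale_left)

lemma tensor_scale_right: "x \<otimes> (c *\<^sub>C y) = c *\<^sub>C (x \<otimes> y)"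
  by transfer (simp add: map_times_single, metis mult.right_neutral tensor_null.scale_right)

lemma tensor_zero_left: "0 \<otimes> y = 0"
  using tensor_add_left[of 0 0 y] by simp

lemma tensor_zero_right: "x \<otimes> 0 = 0"
  using tensor_add_right[of x 0 0] by simp

lemma tensor_minus_left: "(- x) \<otimes> y = - (x \<otimes> y)"
  by (metis add_eq_0_iff tensor_add_left tensor_zero_left)

lemma tensor_minus_right: "x \<otimes> (- y) = - (x \<otimes> y)"
  by (metis add_eq_0_iff tensor_add_right tensor_zero_right)

lemma tensor_diff_left: "(x - x') \<otimes> y = x \<otimes> y - x' \<otimes> y"
  by (metis add_uminus_conv_diff tensor_add_left tensor_minus_left)

lemma tensor_diff_right: "x \<otimes> (y - y') = x \<otimes> y - x \<otimes> y'"
  by (metis add_uminus_conv_diff tensor_add_right tensor_minus_right)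

lemma tensor_sum_left: "(\<Sum>i\<in>I. f i) \<otimes> y = (\<Sum>i\<in>I. f i \<otimes> y)"
  by (induction I rule: infinite_finite_induct) (simp_all add: tensor_zero_left tensor_add_left)

lemma tensor_sum_right: "x \<otimes> (\<Sum>i\<in>I. f i) = (\<Sum>i\<in>I. x \<otimes> f i)"
  by (induction I rule: infinite_finite_induct) (simp_all add: tensor_zero_right tensor_add_right)

lemma linear_onD:
  assumes "linear_on V f"
  shows "x \<in> V \<Longrightarrow> y \<in> V \<Longrightarrow> f (x + y) = f x + f y" "x \<in> V \<Longrightarrow> f (c *\<^sub>C x) = c *\<^sub>C f x"
  using assms by (auto simp: linear_on_def)

lemma linear_on_zero: "linear_on V f \<Longrightarrow> 0 \<in> V \<Longrightarrow> f 0 = 0"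
  using linear_onD(1)[of V f 0 0] by simp

lemma linear_on_sum:
  assumes "linear_on V f" "csubspace V" "\<And>i. i \<in> I \<Longrightarrow> x i \<in> V"
  shows "f (\<Sum>i\<in>I. x i) = (\<Sum>i\<in>I. f (x i))"
  using assms(3)
proof (induction I rule: infinite_finite_induct)
  case (insert i I)
  then have "(\<Sum>i\<in>I. x i) \<in> V" by (simp add: assms(2) cvec.subspace_sum)
  with insert assms(1) show ?case by (simp add: linear_onD(1))
qed (simp_all add: linear_on_zero[OF assms(1) cvec.subspace_0[OF assms(2)]])

lemma linear_on_minus:
  assumes "linear_on V f" "x \<in> V"
  shows "f (- x) = - f x"
  using linear_onD(2)[OF assms, of "-1"] by (simp add: cvec.scale_minus_left scaleC_one)

lemma linear_on_diff:
  assumes "linear_on V f" "csubspace V" "x \<in> V" "y \<in> V"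
  shows "f (x - y) = f x - f y"
  using linear_onD(1)[OF assms(1), of x "- y"] assms
  by (simp add: linear_on_minus cvec.subspace_neg)

lemma linear_on_subset: "linear_on V f \<Longrightarrow> W \<subseteq> V \<Longrightarrow> linear_on W f"
  unfolding linear_on_def by blast

lemma csubspace_UNIV [simp]: "csubspace UNIV"
  by (simp add: cvec.subspace_def)

text \<open>The hypotheses of \<open>tensor_lift_eq\<close> in one predicate. Asking for
  balancedness instead of complex linearity also admits conjugate linear maps such as the one behind
  \<open>tensor_star\<close>.\<close>

definition balanced :: "'a::complex_vector set \<Rightarrow> 'b::complex_vector set \<Rightarrow>
    ('a \<Rightarrow> 'b \<Rightarrow> 'c::ab_group_add) \<Rightarrow> bool"
  where "balanced V W \<beta> \<longleftrightarrow> csubspace V \<and> csubspace W \<and>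
    (\<forall>x\<in>V. \<forall>x'\<in>V. \<forall>y\<in>W. \<beta> (x + x') y = \<beta> x y + \<beta> x' y) \<and>
    (\<forall>x\<in>V. \<forall>y\<in>W. \<forall>y'\<in>W. \<beta> x (y + y') = \<beta> x y + \<beta> x y') \<and>
    (\<forall>c. \<forall>x\<in>V. \<forall>y\<in>W. \<beta> (c *\<^sub>C x) y = \<beta> x (c *\<^sub>C y))"

lemma tensor_lift_sum:
  assumes "balanced V W \<beta>" "finite I" "\<And>i. i \<in> I \<Longrightarrow> x i \<in> V" "\<And>i. i \<in> I \<Longrightarrow> y i \<in> W"
  shows "tensor_lift V W \<beta> (\<Sum>i\<in>I. x i \<otimes> y i) = (\<Sum>i\<in>I. \<beta> (x i) (y i))"
proof -
  obtain js where is': "distinct js" "set js = I"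
    using finite_distinct_list[OF assms(2)] by blast
  have *: "(\<Sum>i\<in>I. g i) = (\<Sum>(u, v)\<leftarrow>map (\<lambda>i. (x i, y i)) js. G u v)"
    if "\<And>i. i \<in> I \<Longrightarrow> g i = G (x i) (y i)" for g and G :: "'a \<Rightarrow> 'b \<Rightarrow> 'z::ab_group_add"
    using is' that by (simp add: comp_def sum_list_distinct_conv_sum_set)
  have "tensor_lift V W \<beta> (\<Sum>(u, v)\<leftarrow>map (\<lambda>i. (x i, y i)) js. u \<otimes> v)
      = (\<Sum>(u, v)\<leftarrow>map (\<lambda>i. (x i, y i)) js. \<beta> u v)"
    using assms is' by (intro tensor_lift_eq) (auto simp: balanced_def)
  then show ?thesis
    using *[of "\<lambda>i. x i \<otimes> y i" "(\<otimes>)"] *[of "\<lambda>i. \<beta> (x i) (y i)" \<beta>] by simp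
qed

text \<open>The coefficients of the linear combination are absorbed into the left factors; this is
  where closure of \<open>V\<close> under scaling enters.\<close>

lemma tensor_subE:
  assumes "t \<in> tensor_sub V W" "csubspace V"
  obtains n x y where "t = (\<Sum>i<n::nat. x i \<otimes> y i)" "\<And>i. i < n \<Longrightarrow> x i \<in> V" "\<And>i. i < n \<Longrightarrow> y i \<in> W"
proof -
  from assms(1) obtain F r where F: "finite F" "F \<subseteq> {x \<otimes> y |x y. x \<in> V \<and> y \<in> W}"
      "t = (\<Sum>v\<in>F. r v *\<^sub>C v)"
    unfolding tensor_sub_def cvec.span_explicit by blast
  from F(2) have "\<forall>v\<in>F. \<exists>x y. v = x \<otimes> y \<and> x \<in> V \<and> y \<in> W" by blast
  then obtain X Y where XY: "\<And>v. v \<in> F \<Longrightarrow> v = X v \<otimes> Y v \<and> X v \<in> V \<and> Y v \<in> W" by metis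
  obtain n :: nat and g where g: "bij_betw g {..<n} F"
    using finite_imp_nat_seg_image_inj_on[OF F(1)] by (metis bij_betw_def lessThan_def)
  have gF: "i < n \<Longrightarrow> g i \<in> F" for i using g by (auto simp: bij_betw_def)
  have "t = (\<Sum>i<n. r (g i) *\<^sub>C g i)"
    unfolding F(3) by (rule sum.reindex_bij_betw[OF g, symmetric])
  also have "\<dots> = (\<Sum>i<n. (r (g i) *\<^sub>C X (g i)) \<otimes> Y (g i))"
    using XY[OF gF] by (intro sum.cong) (auto simp: tensor_scale_left)
  finally show thesis
    using XY[OF gF] assms(2)
    by (intro that[where n = n and x = "\<lambda>i. r (g i) *\<^sub>C X (g i)" and y = "\<lambda>i. Y (g i)"]) (auto intro: cvec.subspace_scale)
qed

lemma tensor_elem_in_sub: "x \<in> V \<Longrightarrow> y \<in> W \<Longrightarrow> x \<otimes> y \<in> tensor_sub V W"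
  unfolding tensor_sub_def by (rule cvec.span_base) blast

lemma csubspace_tensor_sub: "csubspace (tensor_sub V W)"
  unfolding tensor_sub_def by (rule cvec.subspace_span)

lemma tensor_sum_in_sub:
  "(\<And>i. i \<in> I \<Longrightarrow> x i \<in> V) \<Longrightarrow> (\<And>i. i \<in> I \<Longrightarrow> y i \<in> W) \<Longrightarrow> (\<Sum>i\<in>I. x i \<otimes> y i) \<in> tensor_sub V W"
  by (rule cvec.subspace_sum[OF csubspace_tensor_sub]) (rule tensor_elem_in_sub)

text \<open>A representative in the free vector space is a finite combination of basis vectors, and
  their classes are multiples of elementary tensors. Hence lifts over \<open>UNIV\<close> can be
  evaluated on arbitrary tensors.\<close>

lemma tensor_sub_UNIV: "t \<in> tensor_sub UNIV UNIV"
proof -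
  have "abs_tensor S \<in> tensor_sub UNIV UNIV" for S :: "('a \<times> 'b) \<Rightarrow>\<^sub>0 complex"
  proof -
    have 1: "abs_tensor (Poly_Mapping.single p c) \<in> tensor_sub UNIV UNIV" for p :: "'a \<times> 'b" and c
    proof -
      obtain x y where p: "p = (x, y)" by (cases p)
      have "abs_tensor (Poly_Mapping.single p c) = c *\<^sub>C (x \<otimes> y)"
        by (simp add: tensor_elem.abs_eq scaleC_tensor.abs_eq map_times_single p)
      then show ?thesis
        by (simp add: tensor_elem_in_sub csubspace_tensor_sub cvec.subspace_scale)
    qed
    have "abs_tensor (\<Sum>k\<in>K. Poly_Mapping.single k (f k)) \<in> tensor_sub UNIV UNIV"
      if "finite K" for K :: "('a \<times> 'b) set" and f
      using that
    proof (induction K)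
      case empty
      have "0 \<in> tensor_sub (UNIV :: 'a set) (UNIV :: 'b set)"
        by (simp add: csubspace_tensor_sub cvec.subspace_0)
      then show ?case by (simp add: zero_tensor.abs_eq)
    next
      case (insert k K)
      then show ?case
        using cvec.subspace_add[OF csubspace_tensor_sub 1 insert.IH]
        by (simp add: plus_tensor.abs_eq)
    qed
    from this[OF finite_keys] show ?thesis by (subst poly_mapping_sum_single)
  qed
  from this[of "rep_tensor t"] show ?thesis by (simp add: Quotient_abs_rep[OF Quotient_tensor])
qed

lemma tensor_lift_add:
  assumes "balanced V W \<beta>" "s \<in> tensor_sub V W" "t \<in> tensor_sub V W"
  shows "tensor_lift V W \<beta> (s + t) = tensor_lift V W \<beta> s + tensor_lift V W \<beta> t"
proof -
  have V: "csubspace V" using assms(1) by (simp add: balanced_def)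
  obtain n x y where s: "s = (\<Sum>i<n::nat. x i \<otimes> y i)" "\<And>i. i < n \<Longrightarrow> x i \<in> V" "\<And>i. i < n \<Longrightarrow> y i \<in> W"
    using tensor_subE[OF assms(2) V] by metis
  obtain m x' y' where t: "t = (\<Sum>i<m::nat. x' i \<otimes> y' i)" "\<And>i. i < m \<Longrightarrow> x' i \<in> V" "\<And>i. i < m \<Longrightarrow> y' i \<in> W"
    using tensor_subE[OF assms(3) V] by metis
  \<comment> \<open>The two finite sums are merged into one over the disjoint union of their index
    sets, since \<open>tensor_lift_sum\<close> evaluates a single sum.\<close>
  define X where "X = case_sum x x'"
  define Y where "Y = case_sum y y'"
  have *: "(\<Sum>i\<in>{..<n} <+> {..<m}. G (X i) (Y i)) = (\<Sum>i<n. G (x i) (y i)) + (\<Sum>i<m. G (x' i) (y' i))"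
    for G :: "'a \<Rightarrow> 'b \<Rightarrow> 'z::ab_group_add"
    by (simp add: sum.Plus X_def Y_def)
  have "tensor_lift V W \<beta> (\<Sum>i\<in>{..<n} <+> {..<m}. X i \<otimes> Y i) = (\<Sum>i\<in>{..<n} <+> {..<m}. \<beta> (X i) (Y i))"
    using s t by (intro tensor_lift_sum assms(1)) (auto simp: X_def Y_def)
  moreover have "tensor_lift V W \<beta> s = (\<Sum>i<n. \<beta> (x i) (y i))"
    unfolding s(1) by (rule tensor_lift_sum[OF assms(1)]) (use s in auto)
  moreover have "tensor_lift V W \<beta> t = (\<Sum>i<m. \<beta> (x' i) (y' i))"
    unfolding t(1) by (rule tensor_lift_sum[OF assms(1)]) (use t in auto)
  moreover have "(\<Sum>i\<in>{..<n} <+> {..<m}. X i \<otimes> Y i) = s + t"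
    unfolding s(1) t(1) by (rule *)
  ultimately show ?thesis using *[of \<beta>] by simp
qed

lemma tensor_lift_elem:
  "balanced V W \<beta> \<Longrightarrow> x \<in> V \<Longrightarrow> y \<in> W \<Longrightarrow> tensor_lift V W \<beta> (x \<otimes> y) = \<beta> x y"
  using tensor_lift_sum[of V W \<beta> "{0::nat}" "\<lambda>_. x" "\<lambda>_. y"] by simp

lemma tensor_lift_scale:
  assumes "balanced V W \<beta>" "\<And>c x y. x \<in> V \<Longrightarrow> y \<in> W \<Longrightarrow> \<beta> (c *\<^sub>C x) y = c *\<^sub>C \<beta> x y" "t \<in> tensor_sub V W"
  shows "tensor_lift V W \<beta> (c *\<^sub>C t) = c *\<^sub>C tensor_lift V W \<beta> t"
proof -
  have V: "csubspace V" using assms(1) by (simp add: balanced_def)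
  obtain n x y where s: "t = (\<Sum>i<n::nat. x i \<otimes> y i)" "\<And>i. i < n \<Longrightarrow> x i \<in> V" "\<And>i. i < n \<Longrightarrow> y i \<in> W"
    using tensor_subE[OF assms(3) V] by metis
  have "c *\<^sub>C t = (\<Sum>i<n. (c *\<^sub>C x i) \<otimes> y i)"
    by (simp add: s(1) cvec.scale_sum_right tensor_scale_left)
  moreover have "tensor_lift V W \<beta> (\<Sum>i<n. (c *\<^sub>C x i) \<otimes> y i) = (\<Sum>i<n. \<beta> (c *\<^sub>C x i) (y i))"
    by (rule tensor_lift_sum[OF assms(1)]) (use s V in \<open>auto intro: cvec.subspace_scale\<close>)
  moreover have "(\<Sum>i<n. \<beta> (c *\<^sub>C x i) (y i)) = (\<Sum>i<n. c *\<^sub>C \<beta> (x i) (y i))"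
    by (rule sum.cong) (use s assms(2) in auto)
  moreover have "tensor_lift V W \<beta> t = (\<Sum>i<n. \<beta> (x i) (y i))"
    unfolding s(1) by (rule tensor_lift_sum[OF assms(1)]) (use s in auto)
  ultimately show ?thesis by (simp add: cvec.scale_sum_right)
qed

lemma balanced_mult_inner:
  "balanced UNIV UNIV (\<lambda>x' y'. (x * x') \<otimes> (y * y' :: 'b::cstar_algebra))" for x :: "'a::cstar_algebra"
  by (simp add: balanced_def distrib_left tensor_add_left tensor_add_right mult_scaleC_right
      tensor_scale_left tensor_scale_right)

lemma balanced_mult_outer:
  fixes t :: "('a::cstar_algebra, 'b::cstar_algebra) tensor"
  shows "balanced UNIV UNIV (\<lambda>x y. tensor_lift UNIV UNIV (\<lambda>x' y'. (x * x') \<otimes> (y * y')) t)"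
proof -
  obtain n x y where t: "t = (\<Sum>i<n::nat. x i \<otimes> y i)"
    using tensor_subE[OF tensor_sub_UNIV[of t] csubspace_UNIV] by metis
  show ?thesis
    by (simp add: t tensor_lift_sum[OF balanced_mult_inner])
       (simp add: balanced_def distrib_right tensor_add_left tensor_add_right mult_scaleC_left
         tensor_scale_left tensor_scale_right sum.distrib)
qed

lemma tensor_mult_add_left: "tensor_mult (s + s') t = tensor_mult s t + tensor_mult s' t"
  unfolding tensor_mult_def by (rule tensor_lift_add[OF balanced_mult_outer tensor_sub_UNIV tensor_sub_UNIV])

lemma tensor_mult_elem: "tensor_mult (x \<otimes> y) t = tensor_lift UNIV UNIV (\<lambda>x' y'. (x * x') \<otimes> (y * y')) t"
  unfolding tensor_mult_def by (rule tensor_lift_elem[OF balanced_mult_outer]) simp_all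

lemma tensor_mult_elem_elem: "tensor_mult (x \<otimes> y) (x' \<otimes> y') = (x * x') \<otimes> (y * y')"
  unfolding tensor_mult_elem by (rule tensor_lift_elem[OF balanced_mult_inner]) simp_all

lemma tensor_mult_sum_left: "tensor_mult (\<Sum>i\<in>I. f i) t = (\<Sum>i\<in>I. tensor_mult (f i) t)"
proof (induction I rule: infinite_finite_induct)
  case empty
  show ?case using tensor_mult_add_left[of 0 0 t] by simp
qed (simp_all add: tensor_mult_add_left, use tensor_mult_add_left[of 0 0 t] in simp)

lemma tensor_mult_add_right: "tensor_mult s (t + t') = tensor_mult s t + tensor_mult s t'"
proof -
  obtain n x y where s: "s = (\<Sum>i<n::nat. x i \<otimes> y i)"
    using tensor_subE[OF tensor_sub_UNIV[of s] csubspace_UNIV] by metis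
  show ?thesis
    unfolding s tensor_mult_sum_left tensor_mult_elem
    by (simp add: tensor_lift_add[OF balanced_mult_inner tensor_sub_UNIV tensor_sub_UNIV] sum.distrib)
qed

lemma tensor_mult_sum_right: "tensor_mult t (\<Sum>i\<in>I. f i) = (\<Sum>i\<in>I. tensor_mult t (f i))"
proof (induction I rule: infinite_finite_induct)
  case empty
  show ?case using tensor_mult_add_right[of t 0 0] by simp
qed (simp_all add: tensor_mult_add_right, use tensor_mult_add_right[of t 0 0] in simp)

lemma tensor_star_sum:
  assumes "finite I"
  shows "tensor_star (\<Sum>i\<in>I. x i \<otimes> y i) = (\<Sum>i\<in>I. star (x i) \<otimes> star (y i))"
  unfolding tensor_star_def using assms
  by (intro tensor_lift_sum)
     (simp_all add: balanced_def star_add star_scaleC tensor_add_left tensor_add_right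
       tensor_scale_left tensor_scale_right)

lemma tensor_star_elem: "tensor_star (x \<otimes> y) = star x \<otimes> star y"
  using tensor_star_sum[of "{0::nat}" "\<lambda>_. x" "\<lambda>_. y"] by simp

lemma tensor_star_add: "tensor_star (s + t) = tensor_star s + tensor_star t"
  unfolding tensor_star_def
  by (rule tensor_lift_add[OF _ tensor_sub_UNIV tensor_sub_UNIV])
     (simp add: balanced_def star_add star_scaleC tensor_add_left tensor_add_right
       tensor_scale_left tensor_scale_right)

text \<open>Applying the dual functional to the left leg reads off one coefficient. This is the way
  coefficients of tensors are compared throughout.\<close>

lemma tensor_coeff_right:
  assumes "finite I" "i \<in> I" "linear_on UNIV \<phi>"
    and dual: "\<And>j. j \<in> I \<Longrightarrow> \<phi> (e j) = (if i = j then 1 else 0 :: complex)"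
    and eq: "(\<Sum>j\<in>I. e j \<otimes> x j) = (\<Sum>j\<in>I. e j \<otimes> y j)"
  shows "x i = y i"
proof -
  have b: "balanced UNIV UNIV (\<lambda>u v. \<phi> u *\<^sub>C v)"
    using assms(3) by (simp add: balanced_def linear_on_def scaleC_add_left scaleC_add_right
        scaleC_scaleC scaleC_complex_def mult.commute)
  have "tensor_lift UNIV UNIV (\<lambda>u v. \<phi> u *\<^sub>C v) (\<Sum>j\<in>I. e j \<otimes> z j) = z i" for z
    using assms(1,2)
    by (simp add: tensor_lift_sum[OF b] dual if_distrib[of "\<lambda>c. c *\<^sub>C _"] scaleC_one cong: if_cong)
  with eq show ?thesis by metis
qed

lemma tensor_coeff_left:
  assumes "finite I" "i \<in> I" "linear_on UNIV \<phi>"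
    and dual: "\<And>j. j \<in> I \<Longrightarrow> \<phi> (e j) = (if i = j then 1 else 0 :: complex)"
    and eq: "(\<Sum>j\<in>I. x j \<otimes> e j) = (\<Sum>j\<in>I. y j \<otimes> e j)"
  shows "x i = y i"
proof -
  have b: "balanced UNIV UNIV (\<lambda>v u. \<phi> u *\<^sub>C v)"
    using assms(3) by (simp add: balanced_def linear_on_def scaleC_add_left scaleC_add_right
        scaleC_scaleC scaleC_complex_def mult.commute)
  have "tensor_lift UNIV UNIV (\<lambda>v u. \<phi> u *\<^sub>C v) (\<Sum>j\<in>I. z j \<otimes> e j) = z i" for z
    using assms(1,2)
    by (simp add: tensor_lift_sum[OF b] dual if_distrib[of "\<lambda>c. c *\<^sub>C _"] scaleC_one cong: if_cong)
  with eq show ?thesis by metis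
qed

lemma dual_functionals:
  fixes e :: "'i \<Rightarrow> 'a::complex_vector"
  assumes "finite I" and indep: "\<And>c. (\<Sum>i\<in>I. c i *\<^sub>C e i) = 0 \<Longrightarrow> \<forall>i\<in>I. c i = 0"
  obtains \<phi> where "\<And>i. linear_on UNIV (\<phi> i)"
    "\<And>i j. i \<in> I \<Longrightarrow> j \<in> I \<Longrightarrow> \<phi> i (e j) = (if i = j then 1 else 0 :: complex)"
proof -
  interpret pair: vector_space_pair "scaleC :: complex \<Rightarrow> 'a \<Rightarrow> 'a" "scaleC :: complex \<Rightarrow> complex \<Rightarrow> complex" ..
  \<comment> \<open>An independent family has no repetitions; only then does independence of the
    image set say the same as independence of the family.\<close>
  have inj: "inj_on e I"
  proof (rule inj_onI, rule ccontr)
    fix i j assume ij: "i \<in> I" "j \<in> I" "e i = e j" "i \<noteq> j"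
    have "(\<Sum>k\<in>I. (if k = i then 1 else if k = j then - 1 else 0 :: complex) *\<^sub>C e k)
        = (\<Sum>k\<in>I. (if k = i then e i else 0) + (if k = j then - e j else 0))"
      using ij(4) by (intro sum.cong) (auto simp: cvec.scale_minus_left scaleC_one)
    also have "\<dots> = 0" using ij assms(1) by (simp add: sum.distrib)
    finally have "\<forall>k\<in>I. (if k = i then 1 else if k = j then - 1 else 0 :: complex) = 0"
      by (rule indep)
    then show False using ij by auto
  qed
  have ind: "cvec.independent (e ` I)"
  proof
    assume "cvec.dependent (e ` I)"
    then obtain u where u: "\<exists>v\<in>e ` I. u v \<noteq> 0" "(\<Sum>v\<in>e ` I. u v *\<^sub>C v) = 0"
      using assms(1) by (auto simp: cvec.dependent_finite)
    then have "(\<Sum>i\<in>I. u (e i) *\<^sub>C e i) = 0" by (simp add: sum.reindex[OF inj] comp_def)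
    then have "\<forall>i\<in>I. u (e i) = 0" by (rule indep)
    with u(1) show False by blast
  qed
  define \<phi> where "\<phi> i = pair.construct (e ` I) (\<lambda>v. if v = e i then 1 else 0 :: complex)" for i
  show thesis
  proof (rule that[of \<phi>])
    fix i
    have "Vector_Spaces.linear scaleC scaleC (\<phi> i)"
      unfolding \<phi>_def using ind by (rule pair.linear_construct)
    then interpret l: Vector_Spaces.linear scaleC scaleC "\<phi> i" .
    show "linear_on UNIV (\<phi> i)" by (simp add: linear_on_def l.add l.scale)
  next
    fix i j assume "i \<in> I" "j \<in> I"
    then show "\<phi> i (e j) = (if i = j then 1 else 0)"
      unfolding \<phi>_def using ind inj by (auto simp: pair.construct_basis inj_on_def)
  qed
qed

section \<open>The matrix coefficients of the spaces of homogeneous polynomials\<close>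

lemma fa_eval_diff: "fa_eval \<gamma> (x - y) = fa_eval \<gamma> x - fa_eval \<gamma> y"
  by (metis diff_add_cancel eq_diff_eq fa_eval_add)

lemma star_power: "star (x ^ n) = star (x :: 'a::cstar_algebra) ^ n"
  by (induction n) (simp_all add: star_one star_mult power_commutes)

lemmas scaleC_simps = mult_scaleC_left mult_scaleC_right scaleC_scaleC scaleC_one

locale uq2 =
  fixes q :: complex and a b D :: "'a::cstar_algebra" and \<Delta> :: "'a \<Rightarrow> ('a, 'a) tensor"
  assumes q_pos: "0 < cmod q" and q_less: "cmod q < 1"
    and cstar: "Uq2_cstar q a b D" and comult: "Uq2_comult q a b D \<Delta>"
begin

abbreviation A where "A \<equiv> Uq2_alg a b D"

definition s :: real where "s = (cmod q)\<^sup>2"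

text \<open>With \<open>d\<close> the second row of the fundamental matrix whose first row is
  \<open>a\<close>, \<open>b\<close>: the coproducts of all four entries then have the form of a
  matrix product.\<close>

definition c where "c = - cnj q *\<^sub>C (D * star b)"

definition d where "d = D * star a"

lemma q_nz [simp]: "q \<noteq> 0"
  using q_pos by auto

lemma s_pos: "0 < s" and s_less: "s < 1"
  using q_pos q_less by (simp_all add: s_def power_less_one_iff)

lemma s_eq: "complex_of_real s = q * cnj q"
  unfolding s_def by (rule complex_norm_square)

lemma twist_eq: "q\<^sup>2 / complex_of_real ((cmod q)\<^sup>2) = q / cnj q"
  unfolding complex_norm_square by (simp add: power2_eq_square)

lemma relators: "r \<in> Uq2_relators q \<Longrightarrow> fa_eval (case_Uq2_gen a b D) r = 0"
  using cstar by (simp add: Uq2_cstar_def universal_cstar_def)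

lemma fa_eval_one: "fa_eval \<gamma> 1 = 1"
  using fa_eval_const[of \<gamma> 1] by (simp add: fa_const_def scaleC_one)

section \<open>The defining relations and their consequences as rewrite rules\<close>

lemma rel_ba: "b * a = q *\<^sub>C (a * b)"
  and rel_a'b: "star a * b = q *\<^sub>C (b * star a)"
  and rel_bb': "b * star b = star b * b"
  and rel_aa': "a * star a + b * star b = 1"
  and rel_aD: "a * D = D * a"
  and rel_bD: "b * D = (q / cnj q) *\<^sub>C (D * b)"
  and rel_DD': "D * star D = 1"
  and rel_D'D: "star D * D = 1"
  and rel_a'a: "star a * a + s *\<^sub>C (star b * b) = 1"
proof -
  have "\<forall>r\<in>Uq2_relators q. fa_eval (case_Uq2_gen a b D) r = 0"
    using relators by blast
  note r = this[unfolded Uq2_relators_def Let_def twist_eq, folded s_def, simplified fa_eval_diff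
      fa_eval_add fa_eval_mult fa_eval_const fa_eval_star fa_eval_one fa_eval_gen scaleC_simps
      mult_1_left ball_simps Uq2_gen.case right_minus_eq]
  show "b * a = q *\<^sub>C (a * b)" "star a * b = q *\<^sub>C (b * star a)" "b * star b = star b * b"
    "a * star a + b * star b = 1" "a * D = D * a" "b * D = (q / cnj q) *\<^sub>C (D * b)"
    "D * star D = 1" "star D * D = 1" "star a * a + s *\<^sub>C (star b * b) = 1"
    using r by blast+
qed

lemma nf_aa': "a * star a = 1 - b * star b"
  using rel_aa' by (simp add: eq_diff_eq)

lemma nf_a'a: "star a * a = 1 - s *\<^sub>C (b * star b)"
  using rel_a'a by (simp add: eq_diff_eq rel_bb')

lemma nf_b'a: "star b * a = cnj q *\<^sub>C (a * star b)"
  using arg_cong[OF rel_a'b, of star] by (simp add: star_mult star_star star_scaleC)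

lemma nf_ba': "b * star a = (1 / q) *\<^sub>C (star a * b)"
  by (simp add: rel_a'b scaleC_simps)

lemma nf_b'a': "star b * star a = (1 / cnj q) *\<^sub>C (star a * star b)"
  using arg_cong[OF rel_ba, of star] by (simp add: star_mult star_star star_scaleC scaleC_simps)

lemma unitary_cancel: "star D * (D * x) = x" "D * (star D * x) = x"
  by (simp_all add: mult.assoc[symmetric] rel_D'D rel_DD')

text \<open>The adjoint of \<open>rel_aD\<close> concerns \<open>star D\<close>; multiplication by
  the unitary \<open>D\<close> from both sides turns it into a rule for \<open>D\<close>.\<close>

lemma nf_a'D: "star a * D = D * star a"
proof -
  have "star D * star a = star a * star D"
    using arg_cong[OF rel_aD, of star] by (simp add: star_mult)
  then have "D * (star D * star a) * D = D * (star a * star D) * D" by simp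
  then show ?thesis by (simp add: mult.assoc unitary_cancel rel_D'D)
qed

lemma nf_b'D: "star b * D = (cnj q / q) *\<^sub>C (D * star b)"
proof -
  have "star D * star b = (cnj q / q) *\<^sub>C (star b * star D)"
    using arg_cong[OF rel_bD, of star] by (simp add: star_mult star_scaleC)
  then have "D * (star D * star b) * D = D * ((cnj q / q) *\<^sub>C (star b * star D)) * D" by simp
  then show ?thesis by (simp add: mult.assoc unitary_cancel rel_D'D scaleC_simps)
qed

lemma nf_aD': "a * star D = star D * a"
  using arg_cong[OF nf_a'D, of star] by (simp add: star_mult star_star)

lemma nf_a'D': "star a * star D = star D * star a"
  using arg_cong[OF rel_aD, of star] by (simp add: star_mult)

lemma nf_bD': "b * star D = (cnj q / q) *\<^sub>C (star D * b)"
  using arg_cong[OF nf_b'D, of star] by (simp add: star_mult star_star star_scaleC scaleC_simps)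

lemma nf_b'D': "star b * star D = (q / cnj q) *\<^sub>C (star D * star b)"
  using arg_cong[OF rel_bD, of star] by (simp add: star_mult star_scaleC scaleC_simps)

lemmas nf_base = rel_ba nf_ba' nf_b'a nf_b'a' rel_bb'[symmetric] nf_aa' nf_a'a rel_aD rel_bD nf_a'D
  nf_b'D nf_aD' nf_a'D' nf_bD' nf_b'D' rel_DD' rel_D'D

text \<open>
  Rewriting with \<open>nf\<close> moves \<open>D\<close> to the left, \<open>b\<close> and \<open>b\<^sup>*\<close> to the right and scalars to the front.
\<close>

lemmas nf = nf_base nf_base[THEN arg_cong[of _ _ "\<lambda>x. x * z" for z], simplified mult.assoc]
  mult.assoc scaleC_simps

section \<open>Unitarity of the matrix with rows (a, b) and (c, d)\<close>

lemma row_a: "a * star a + b * star b = 1"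
  by (rule rel_aa')

lemma row_ac: "a * star c + b * star d = 0"
  by (simp add: c_def d_def star_mult star_minus star_scaleC star_star nf left_diff_distrib)

lemma row_ca: "c * star a + d * star b = 0"
  using arg_cong[OF row_ac, of star] by (simp add: star_add star_mult star_star star_zero)

lemma row_c: "c * star c + d * star d = 1"
  by (simp add: c_def d_def star_mult star_minus star_scaleC star_star nf left_diff_distrib
      right_diff_distrib s_eq)

lemma col_a: "star a * a + star c * c = 1"
  by (simp add: c_def d_def star_mult star_minus star_scaleC star_star nf left_diff_distrib
      right_diff_distrib s_eq)

lemma col_ab: "star a * b + star c * d = 0"
  by (simp add: c_def d_def star_mult star_minus star_scaleC star_star nf left_diff_distrib
      right_diff_distrib s_eq)

lemma col_ba: "star b * a + star d * c = 0"
  using arg_cong[OF col_ab, of star] by (simp add: star_add star_mult star_star star_zero)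

lemma col_b: "star b * b + star d * d = 1"
  by (simp add: c_def d_def star_mult star_minus star_scaleC star_star nf left_diff_distrib
      right_diff_distrib s_eq)

lemma ca: "c * a = cnj q *\<^sub>C (a * c)"
  by (simp add: c_def nf)

lemma dc: "d * c = q *\<^sub>C (c * d)"
  by (simp add: c_def d_def nf)

text \<open>Exactly what \<open>step_commute\<close> requires of the terms in which one letter acts
  through the first row and the other through the second.\<close>

lemma mixed: "q *\<^sub>C (d * a) + b * c = (q * q) *\<^sub>C (c * b) + q *\<^sub>C (a * d)"
  by (simp add: c_def d_def nf left_diff_distrib right_diff_distrib s_eq cvec.scale_right_diff_distrib)

text \<open>Let \<open>z\<close> have coefficients \<open>v i\<close> along \<open>f n i\<close>,
  and let \<open>x\<close> have coproduct a \<otimes> x + b \<otimes> y. Then this is the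
  coefficient vector of \<open>z * x\<close> at level n + 1: moving \<open>a\<close> past b ^ i
  costs q ^ i, and \<open>b\<close> raises the index by one.\<close>

definition step :: "'a \<Rightarrow> 'a \<Rightarrow> (nat \<Rightarrow> 'a) \<Rightarrow> nat \<Rightarrow> 'a"
  where "step x y v i = q ^ i *\<^sub>C (v i * x) + (case i of 0 \<Rightarrow> 0 | Suc j \<Rightarrow> v j * y)"

lemma step_0: "step x y v 0 = v 0 * x"
  and step_Suc: "step x y v (Suc i) = q ^ Suc i *\<^sub>C (v (Suc i) * x) + v i * y"
  by (simp_all add: step_def scaleC_one)

lemma step_scale: "step x y (\<lambda>i. r *\<^sub>C v i) = (\<lambda>i. r *\<^sub>C step x y v i)"
proof
  fix i
  show "step x y (\<lambda>i. r *\<^sub>C v i) i = r *\<^sub>C step x y v i"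
    by (cases i) (simp_all add: step_0 step_Suc scaleC_simps scaleC_add_right mult.commute)
qed

text \<open>The coefficient form of \<open>rel_ba\<close>. In the entry at i, the terms with v at i,
  i - 1 and i - 2 match by \<open>rel_ba\<close>, \<open>mixed\<close> and \<open>dc\<close>
  respectively.\<close>

lemma step_commute: "step a c (step b d v) = (\<lambda>i. q *\<^sub>C step b d (step a c v) i)"
proof
  fix i :: nat
  consider "i = 0" | "i = 1" | j where "i = Suc (Suc j)"
    by (metis One_nat_def not0_implies_Suc)
  then show "step a c (step b d v) i = q *\<^sub>C step b d (step a c v) i"
  proof cases
    case 1
    then show ?thesis by (simp add: step_0 mult.assoc rel_ba scaleC_simps)
  next
    case 2
    have "v 0 * (q *\<^sub>C (d * a) + b * c) = v 0 * ((q * q) *\<^sub>C (c * b) + q *\<^sub>C (a * d))"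
      by (simp only: mixed)
    then show ?thesis unfolding 2 One_nat_def
      by (simp add: step_0 step_Suc mult.assoc rel_ba scaleC_simps distrib_left distrib_right
          scaleC_add_right algebra_simps)
  next
    case (3 j)
    have "q ^ Suc j *\<^sub>C (v (Suc j) * (q *\<^sub>C (d * a) + b * c))
        = q ^ Suc j *\<^sub>C (v (Suc j) * ((q * q) *\<^sub>C (c * b) + q *\<^sub>C (a * d)))"
      by (simp only: mixed)
    then show ?thesis unfolding 3
      by (simp add: step_Suc mult.assoc rel_ba dc scaleC_simps distrib_left distrib_right
          scaleC_add_right algebra_simps)
  qed
qed

text \<open>Column k of the coefficient matrix, with one \<open>step\<close> for each letter of a ^
  (n - k) * b ^ k, starting from the coproduct of 1.\<close>

definition tau :: "nat \<Rightarrow> nat \<Rightarrow> nat \<Rightarrow> 'a"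
  where "tau n k = (step b d ^^ k) ((step a c ^^ (n - k)) (\<lambda>i. if i = 0 then 1 else 0))"

lemma tau_Suc_Suc: "tau (Suc n) (Suc k) = step b d (tau n k)"
  by (simp add: tau_def)

lemma tau_Suc_0: "tau (Suc n) 0 = step a c (tau n 0)"
  by (simp add: tau_def)

text \<open>The coefficient form of \<open>f_a\<close>: the last letter of a ^ (n - k) * b ^ k * a
  moves left past b ^ k.\<close>

lemma step_tau: "k \<le> n \<Longrightarrow> step a c (tau n k) = (\<lambda>i. q ^ k *\<^sub>C tau (Suc n) k i)"
proof (induction k arbitrary: n)
  case 0
  then show ?case by (simp add: tau_Suc_0 scaleC_one)
next
  case (Suc k)
  then obtain m where n: "n = Suc m" "k \<le> m" by (cases n) auto
  have "step a c (tau n (Suc k)) = (\<lambda>i. q *\<^sub>C step b d (step a c (tau m k)) i)"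
    by (simp only: n tau_Suc_Suc step_commute)
  also have "\<dots> = (\<lambda>i. q ^ Suc k *\<^sub>C tau (Suc n) (Suc k) i)"
    using Suc.IH[OF n(2)] by (simp add: n step_scale tau_Suc_Suc scaleC_scaleC)
  finally show ?case .
qed

text \<open>Follows the letters of the monomial, all \<open>a\<close> before all \<open>b\<close>.
  The property takes the whole vector, so that vanishing beyond n and membership in \<open>A\<close>
  can be carried along with the main claim.\<close>

lemma tau_induct [consumes 1, case_names zero left right]:
  assumes "k \<le> n" and "P 0 0 (\<lambda>i. if i = 0 then 1 else 0)"
    and "\<And>n v. P n 0 v \<Longrightarrow> P (Suc n) 0 (step a c v)"
    and "\<And>n k v. k \<le> n \<Longrightarrow> P n k v \<Longrightarrow> P (Suc n) (Suc k) (step b d v)"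
  shows "P n k (tau n k)"
  using assms(1)
proof (induction k arbitrary: n)
  case 0
  show ?case
  proof (induction n)
    case 0
    show ?case using assms(2) by (simp add: tau_def)
  qed (simp add: tau_Suc_0 assms(3))
next
  case (Suc k)
  then obtain m where "n = Suc m" "k \<le> m" by (cases n) auto
  with Suc.IH show ?case by (simp add: tau_Suc_Suc assms(4))
qed

lemma step_zero: "\<forall>i>n. v i = 0 \<Longrightarrow> \<forall>i>Suc n. step x y v i = 0"
  by (auto simp: step_Suc gr0_conv_Suc elim!: Suc_lessE)

lemma tau_zero: "k \<le> n \<Longrightarrow> n < i \<Longrightarrow> tau n k i = 0"
proof -
  have "\<forall>i>n. tau n k i = 0" if "k \<le> n"
    using that
  proof (induction rule: tau_induct)
    case zero
    show ?case by simp
  qed (rule step_zero, assumption)+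
  then show "k \<le> n \<Longrightarrow> n < i \<Longrightarrow> tau n k i = 0" by blast
qed

definition f :: "nat \<Rightarrow> nat \<Rightarrow> 'a" where "f n i = a ^ (n - i) * b ^ i"

lemma f_b: "f n i * b = f (Suc n) (Suc i)"
  by (simp add: f_def mult.assoc power_commutes)

lemma bpow_a: "b ^ i * a = q ^ i *\<^sub>C (a * b ^ i)"
proof (induction i)
  case (Suc i)
  have "b ^ Suc i * a = b ^ i * (b * a)" by (simp only: power_Suc2 mult.assoc)
  also have "\<dots> = q *\<^sub>C (b ^ i * a * b)" by (simp add: rel_ba scaleC_simps mult.assoc)
  also have "\<dots> = q ^ Suc i *\<^sub>C (a * b ^ Suc i)"
    unfolding Suc by (simp add: scaleC_simps mult.assoc power_Suc2[of b] del: power_Suc) simp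
  finally show ?case .
qed (simp add: scaleC_one)

lemma f_a: "i \<le> n \<Longrightarrow> f n i * a = q ^ i *\<^sub>C f (Suc n) i"
  by (simp add: f_def mult.assoc bpow_a scaleC_simps Suc_diff_le power_Suc2[of a] del: power_Suc)

lemma A_star_subalgebra: "star_subalgebra A"
  unfolding Uq2_alg_def
proof (rule hull_in)
  fix S :: "'a set set"
  assume "\<forall>T\<in>S. star_subalgebra T"
  then show "star_subalgebra (\<Inter>S)"
    unfolding star_subalgebra_def by (intro conjI ballI cvec.subspace_Inter) auto
qed

lemma A_subspace [simp]: "csubspace A"
  using A_star_subalgebra by (simp add: star_subalgebra_def)

lemma A_closed [simp, intro]:
  "1 \<in> A" "a \<in> A" "b \<in> A" "D \<in> A" "0 \<in> A"
  "x \<in> A \<Longrightarrow> y \<in> A \<Longrightarrow> x * y \<in> A" "x \<in> A \<Longrightarrow> y \<in> A \<Longrightarrow> x + y \<in> A"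
  "x \<in> A \<Longrightarrow> star x \<in> A" "x \<in> A \<Longrightarrow> r *\<^sub>C x \<in> A" "x \<in> A \<Longrightarrow> - x \<in> A"
  "x \<in> A \<Longrightarrow> y \<in> A \<Longrightarrow> x - y \<in> A"
  using A_star_subalgebra A_subspace
  unfolding star_subalgebra_def
  by (auto intro: cvec.subspace_add cvec.subspace_scale cvec.subspace_0 cvec.subspace_neg
      cvec.subspace_diff simp: Uq2_alg_def hull_inc)

lemma A_sum [intro]: "(\<And>i. i \<in> I \<Longrightarrow> x i \<in> A) \<Longrightarrow> (\<Sum>i\<in>I. x i) \<in> A"
  by (rule cvec.subspace_sum[OF A_subspace])

lemma A_power [simp, intro]: "x \<in> A \<Longrightarrow> x ^ n \<in> A"
  by (induction n) simp_all

lemma cd_in_A [simp, intro]: "c \<in> A" "d \<in> A" "f n i \<in> A"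
  by (auto simp: c_def d_def f_def)

section \<open>The comultiplication on the monomials and on their coefficients\<close>

lemma Delta_linear: "linear_on A \<Delta>"
  and Delta_one: "\<Delta> 1 = 1 \<otimes> 1"
  and Delta_mult: "x \<in> A \<Longrightarrow> y \<in> A \<Longrightarrow> \<Delta> (x * y) = tensor_mult (\<Delta> x) (\<Delta> y)"
  and Delta_star: "x \<in> A \<Longrightarrow> \<Delta> (star x) = tensor_star (\<Delta> x)"
  and Delta_D: "\<Delta> D = D \<otimes> D"
  and Delta_b: "\<Delta> b = a \<otimes> b + b \<otimes> d"
  using comult by (simp_all add: Uq2_comult_def Let_def d_def)

lemma Delta_a: "\<Delta> a = a \<otimes> a + b \<otimes> c"
  using comult by (simp add: Uq2_comult_def Let_def c_def tensor_scale_right tensor_minus_right)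

lemma Delta_d: "\<Delta> d = c \<otimes> b + d \<otimes> d"
proof -
  have "D * star c = - cnj q *\<^sub>C b"
    by (simp add: c_def star_minus star_scaleC star_mult star_star nf nf_bD' unitary_cancel)
  then have "(D * star b) \<otimes> (D * star c) = c \<otimes> b"
    by (simp add: c_def tensor_scale_right tensor_scale_left tensor_minus_left tensor_minus_right)
  then show ?thesis
    by (simp add: d_def Delta_mult Delta_D Delta_star Delta_a tensor_star_add tensor_star_elem
        tensor_mult_add_right tensor_mult_elem_elem)
qed

lemma Delta_c: "\<Delta> c = c \<otimes> a + d \<otimes> c"
proof -
  have "\<Delta> (D * star b) = d \<otimes> (D * star b) + (D * star b) \<otimes> a"
    by (simp add: d_def Delta_mult Delta_D Delta_star Delta_b tensor_star_add tensor_star_elem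
      tensor_mult_add_right tensor_mult_elem_elem star_mult star_star nf_aD' unitary_cancel)
  moreover have "\<Delta> c = - cnj q *\<^sub>C \<Delta> (D * star b)"
    unfolding c_def by (rule linear_onD(2)[OF Delta_linear]) simp
  moreover have "- cnj q *\<^sub>C ((D * star b) \<otimes> a) = c \<otimes> a"
    "- cnj q *\<^sub>C (d \<otimes> (D * star b)) = d \<otimes> c"
    by (simp_all only: c_def tensor_scale_left tensor_scale_right)
  ultimately show ?thesis
    by (simp only: scaleC_add_right add.commute)
qed

text \<open>The condition at \<open>Suc n\<close> lets the sum for the letter \<open>a\<close> be
  extended by a zero term, so that it runs over the same range as the shifted sum for
  \<open>b\<close>.\<close>

lemma Delta_step:
  assumes "z \<in> A" "x \<in> A" and z: "\<Delta> z = (\<Sum>i\<le>n. f n i \<otimes> v i)" and v: "v (Suc n) = 0"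
    and x: "\<Delta> x = a \<otimes> x + b \<otimes> y"
  shows "\<Delta> (z * x) = (\<Sum>i\<le>Suc n. f (Suc n) i \<otimes> step x y v i)"
proof -
  have "\<Delta> (z * x) = (\<Sum>i\<le>n. (f n i * a) \<otimes> (v i * x)) + (\<Sum>i\<le>n. (f n i * b) \<otimes> (v i * y))"
    by (simp add: Delta_mult assms tensor_mult_sum_left tensor_mult_add_right tensor_mult_elem_elem
        sum.distrib)
  also have "(\<Sum>i\<le>n. (f n i * a) \<otimes> (v i * x)) = (\<Sum>i\<le>n. f (Suc n) i \<otimes> (q ^ i *\<^sub>C (v i * x)))"
    by (rule sum.cong) (simp_all add: f_a tensor_scale_left tensor_scale_right)
  also have "\<dots> = (\<Sum>i\<le>Suc n. f (Suc n) i \<otimes> (q ^ i *\<^sub>C (v i * x)))"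
    by (simp add: v tensor_zero_right)
  also have "(\<Sum>i\<le>n. (f n i * b) \<otimes> (v i * y))
      = (\<Sum>i\<le>Suc n. f (Suc n) i \<otimes> (case i of 0 \<Rightarrow> 0 | Suc j \<Rightarrow> v j * y))"
    by (subst sum.atMost_Suc_shift) (simp add: f_b tensor_zero_right)
  finally show ?thesis
    by (simp only: sum.distrib[symmetric] tensor_add_right[symmetric] step_def)
qed

lemma step_in_A: "(\<And>i. v i \<in> A) \<Longrightarrow> x \<in> A \<Longrightarrow> y \<in> A \<Longrightarrow> step x y v i \<in> A"
  by (cases i) (auto simp: step_0 step_Suc)

lemma tau_in_A: "k \<le> n \<Longrightarrow> tau n k i \<in> A"
proof -
  assume "k \<le> n"
  then have "\<forall>i. tau n k i \<in> A"
    by (induction rule: tau_induct) (auto simp: step_in_A)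
  then show ?thesis by blast
qed

lemma f_Suc_0: "f (Suc n) 0 = f n 0 * a"
  by (simp add: f_def power_Suc2 del: power_Suc)

lemma Delta_f: "k \<le> n \<Longrightarrow> \<Delta> (f n k) = (\<Sum>i\<le>n. f n i \<otimes> tau n k i)"
proof -
  have step: "v (Suc (Suc n)) = 0 \<Longrightarrow> v (Suc n) = 0 \<Longrightarrow> step x y v (Suc (Suc n)) = 0" for v n x y
    by (simp add: step_Suc)
  assume "k \<le> n"
  then have "\<Delta> (f n k) = (\<Sum>i\<le>n. f n i \<otimes> tau n k i) \<and> (\<forall>i>n. tau n k i = 0)"
  proof (induction rule: tau_induct)
    case zero
    show ?case by (simp add: f_def Delta_one)
  next
    case (left n v)
    then have "\<Delta> (f n 0 * a) = (\<Sum>i\<le>Suc n. f (Suc n) i \<otimes> step a c v i)"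
      by (intro Delta_step) (auto simp: Delta_a)
    moreover have "\<forall>i>Suc n. step a c v i = 0"
      using left step_zero by blast
    ultimately show ?case by (simp only: f_Suc_0)
  next
    case (right n k v)
    then have "\<Delta> (f n k * b) = (\<Sum>i\<le>Suc n. f (Suc n) i \<otimes> step b d v i)"
      by (intro Delta_step) (auto simp: Delta_b)
    moreover have "\<forall>i>Suc n. step b d v i = 0"
      using right step_zero by blast
    ultimately show ?case by (simp only: f_b)
  qed
  then show ?thesis by blast
qed

text \<open>In the product the second leg is multiplied by x or y, while the first leg turns
  \<open>tau n r\<close> into its image under \<open>step a c\<close> or \<open>step b d\<close>. By
  \<open>step_tau\<close> and \<open>tau_Suc_Suc\<close> both images are columns of level n + 1, and
  collecting the second legs gives \<open>step x y v\<close>.\<close>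

lemma Delta_tau_step:
  assumes v: "\<And>i. \<Delta> (v i) = (\<Sum>r\<le>n. tau n r i \<otimes> v r)" "\<And>i. v i \<in> A" "v (Suc n) = 0"
    and x: "\<Delta> x = a \<otimes> x + b \<otimes> y" "\<Delta> y = c \<otimes> x + d \<otimes> y" "x \<in> A" "y \<in> A"
  shows "\<Delta> (step x y v i) = (\<Sum>r\<le>Suc n. tau (Suc n) r i \<otimes> step x y v r)"
proof -
  have "\<Delta> (step x y v i)
      = (\<Sum>r\<le>n. step a c (tau n r) i \<otimes> (v r * x)) + (\<Sum>r\<le>n. step b d (tau n r) i \<otimes> (v r * y))"
  proof (cases i)
    case 0
    then show ?thesis
      by (simp add: step_0 Delta_mult v x tensor_mult_sum_left tensor_mult_add_right
          tensor_mult_elem_elem sum.distrib)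
  next
    case (Suc j)
    then show ?thesis
      by (simp add: step_Suc linear_onD[OF Delta_linear] v(2) x(3,4) Delta_mult v(1) x(1,2)
          tensor_mult_sum_left tensor_mult_add_right tensor_mult_elem_elem sum.distrib
          tensor_add_left tensor_scale_left cvec.scale_sum_right scaleC_add_right)
  qed
  also have "(\<Sum>r\<le>n. step a c (tau n r) i \<otimes> (v r * x))
      = (\<Sum>r\<le>n. tau (Suc n) r i \<otimes> (q ^ r *\<^sub>C (v r * x)))"
    by (rule sum.cong) (simp_all add: step_tau tensor_scale_left tensor_scale_right)
  also have "\<dots> = (\<Sum>r\<le>Suc n. tau (Suc n) r i \<otimes> (q ^ r *\<^sub>C (v r * x)))"
    by (simp add: v tensor_zero_right)
  also have "(\<Sum>r\<le>n. step b d (tau n r) i \<otimes> (v r * y))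
      = (\<Sum>r\<le>Suc n. tau (Suc n) r i \<otimes> (case r of 0 \<Rightarrow> 0 | Suc j \<Rightarrow> v j * y))"
    by (subst sum.atMost_Suc_shift) (simp add: tau_Suc_Suc tensor_zero_right)
  finally show ?thesis
    by (simp only: sum.distrib[symmetric] tensor_add_right[symmetric] step_def)
qed

text \<open>\<open>Uq2_comult\<close> prescribes \<open>\<Delta>\<close> on the generators, so the
  matrix coproduct is derived along the recursion of \<open>tau\<close> from the coproducts of a, b,
  c, d.\<close>

lemma Delta_tau: "k \<le> n \<Longrightarrow> \<Delta> (tau n k i) = (\<Sum>r\<le>n. tau n r i \<otimes> tau n k r)"
proof -
  assume "k \<le> n"
  then have "(\<forall>i. \<Delta> (tau n k i) = (\<Sum>r\<le>n. tau n r i \<otimes> tau n k r)) \<and>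
      (\<forall>i. tau n k i \<in> A) \<and> (\<forall>i>n. tau n k i = 0)"
  proof (induction rule: tau_induct)
    case zero
    have "\<Delta> 0 = 0" by (rule linear_on_zero[OF Delta_linear]) simp
    then show ?case by (simp add: tau_def Delta_one tensor_zero_left)
  next
    case (left n v)
    have "\<Delta> (step a c v i) = (\<Sum>r\<le>Suc n. tau (Suc n) r i \<otimes> step a c v r)" for i
      using left by (intro Delta_tau_step) (auto simp: Delta_a Delta_c)
    moreover have "\<forall>i>Suc n. step a c v i = 0"
      using left step_zero by blast
    ultimately show ?case using left by (auto simp: step_in_A)
  next
    case (right n k v)
    have "\<Delta> (step b d v i) = (\<Sum>r\<le>Suc n. tau (Suc n) r i \<otimes> step b d v r)" for i
      using right by (intro Delta_tau_step) (auto simp: Delta_b Delta_d)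
    moreover have "\<forall>i>Suc n. step b d v i = 0"
      using right step_zero by blast
    ultimately show ?case using right by (auto simp: step_in_A)
  qed
  then show ?thesis by blast
qed

end

section \<open>A representation on finitely supported functions\<close>

text \<open>Vectors are plain functions, with finiteness of the support as a side condition. A
  pre-Hilbert space suffices here, because the aim is only a C*-seminorm on the free
  *-algebra.\<close>

definition supp :: "('p \<Rightarrow> complex) \<Rightarrow> 'p set"
  where "supp v = {p. v p \<noteq> 0}"

definition ip :: "('p \<Rightarrow> complex) \<Rightarrow> ('p \<Rightarrow> complex) \<Rightarrow> complex"
  where "ip u v = (\<Sum>p\<in>supp u. cnj (u p) * v p)"

definition nrm :: "('p \<Rightarrow> complex) \<Rightarrow> real"
  where "nrm v = L2_set (\<lambda>p. cmod (v p)) (supp v)"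

lemma ip_superset: "finite B \<Longrightarrow> supp u \<subseteq> B \<Longrightarrow> ip u v = (\<Sum>p\<in>B. cnj (u p) * v p)"
  unfolding ip_def by (rule sum.mono_neutral_left) (auto simp: supp_def)

lemma nrm_superset: "finite B \<Longrightarrow> supp v \<subseteq> B \<Longrightarrow> nrm v = L2_set (\<lambda>p. cmod (v p)) B"
  unfolding nrm_def L2_set_def
  by (rule arg_cong[of _ _ sqrt], rule sum.mono_neutral_left) (auto simp: supp_def)

lemma ip_commute:
  assumes "finite (supp u)" "finite (supp v)"
  shows "ip u v = cnj (ip v u)"
  using assms by (simp add: ip_superset[of "supp u \<union> supp v"] mult.commute)

lemma ip_self: "finite (supp v) \<Longrightarrow> ip v v = complex_of_real ((nrm v)\<^sup>2)"
  by (simp add: ip_def nrm_def L2_set_def sum_nonneg mult.commute[of "cnj _"] complex_norm_square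
      del: of_real_power)

lemma ip_Cauchy_Schwarz:
  assumes "finite (supp u)" "finite (supp v)"
  shows "cmod (ip u v) \<le> nrm u * nrm v"
proof -
  let ?B = "supp u \<union> supp v"
  have "cmod (ip u v) \<le> (\<Sum>p\<in>?B. \<bar>cmod (u p)\<bar> * \<bar>cmod (v p)\<bar>)"
    using assms by (simp add: ip_superset[of ?B]) (rule order_trans[OF norm_sum], simp add: norm_mult)
  also have "\<dots> \<le> nrm u * nrm v"
    using assms L2_set_mult_ineq[of "\<lambda>p. cmod (u p)" "\<lambda>p. cmod (v p)" ?B]
    by (simp add: nrm_superset[of ?B])
  finally show ?thesis .
qed

lemma nrm_nonneg: "0 \<le> nrm v"
  by (simp add: nrm_def)

lemma nrm_zero: "nrm (\<lambda>_. 0) = 0"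
  by (simp add: nrm_def supp_def)

lemma nrm_eq_0: "finite (supp v) \<Longrightarrow> nrm v = 0 \<Longrightarrow> v = (\<lambda>_. 0)"
  by (auto simp: nrm_def L2_set_eq_0_iff supp_def)

lemma supp_add: "supp (\<lambda>p. u p + v p) \<subseteq> supp u \<union> supp v"
  by (auto simp: supp_def)

lemma supp_scale: "supp (\<lambda>p. r * v p) \<subseteq> supp v"
  by (auto simp: supp_def)

lemma nrm_triangle:
  assumes "finite (supp u)" "finite (supp v)"
  shows "nrm (\<lambda>p. u p + v p) \<le> nrm u + nrm v"
proof -
  let ?B = "supp u \<union> supp v"
  have "nrm (\<lambda>p. u p + v p) = L2_set (\<lambda>p. cmod (u p + v p)) ?B"
    using assms by (intro nrm_superset) (auto simp: supp_def)
  also have "\<dots> \<le> L2_set (\<lambda>p. cmod (u p) + cmod (v p)) ?B"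
    by (rule L2_set_mono) (simp_all add: norm_triangle_ineq)
  also have "\<dots> \<le> nrm u + nrm v"
    using assms L2_set_triangle_ineq[of "\<lambda>p. cmod (u p)" "\<lambda>p. cmod (v p)" ?B]
    by (simp add: nrm_superset[of ?B])
  finally show ?thesis .
qed

lemma nrm_scale: "finite (supp v) \<Longrightarrow> nrm (\<lambda>p. r * v p) = cmod r * nrm v"
  by (subst nrm_superset[of "supp v" "\<lambda>p. r * v p"])
     (auto simp: supp_scale nrm_def norm_mult L2_set_right_distrib)

text \<open>The letters act as contractions, the starred letter being the adjoint. Contractivity
  bounds every word by 1, which makes the operator norm of a polynomial finite.\<close>

locale star_rep =
  fixes G :: "'g \<times> bool \<Rightarrow> ('p \<Rightarrow> complex) \<Rightarrow> ('p \<Rightarrow> complex)"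
  assumes add: "G x (\<lambda>p. u p + v p) = (\<lambda>p. G x u p + G x v p)"
    and scale: "G x (\<lambda>p. r * u p) = (\<lambda>p. r * G x u p)"
    and fin: "finite (supp v) \<Longrightarrow> finite (supp (G x v))"
    and adj: "finite (supp u) \<Longrightarrow> finite (supp v) \<Longrightarrow> ip (G (g, t) u) v = ip u (G (g, \<not> t) v)"
    and contr: "finite (supp v) \<Longrightarrow> nrm (G x v) \<le> nrm v"
begin

definition word_op :: "'g word \<Rightarrow> ('p \<Rightarrow> complex) \<Rightarrow> ('p \<Rightarrow> complex)"
  where "word_op w = foldr G (letters w)"

lemma word_op_plus: "word_op (w + w') v = word_op w (word_op w' v)"
  by (simp add: word_op_def plus_word_def)

lemma foldr_sum: "foldr G ws (\<lambda>p. \<Sum>i\<in>I. u i p) = (\<lambda>p. \<Sum>i\<in>I. foldr G ws (u i) p)"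
proof (induction I rule: infinite_finite_induct)
  case (insert i I)
  have "foldr G ws (\<lambda>p. u p + v p) = (\<lambda>p. foldr G ws u p + foldr G ws v p)" for u v
    by (induction ws) (simp_all add: add)
  with insert show ?case by simp
next
  case empty
  \<comment> \<open>The zero vector is written as a multiple by 0, so that \<open>scale\<close>
    gives its image.\<close>
  have "foldr G ws (\<lambda>p. 0 * 0) = (\<lambda>p. 0 * foldr G ws (\<lambda>_. 0) p)"
    by (induction ws) (simp, simp only: foldr_Cons comp_def scale)
  then show ?case by simp
next
  case (infinite I)
  have "foldr G ws (\<lambda>p. 0 * 0) = (\<lambda>p. 0 * foldr G ws (\<lambda>_. 0) p)"
    by (induction ws) (simp, simp only: foldr_Cons comp_def scale)
  with infinite show ?case by simp
qed

lemma foldr_scale: "foldr G ws (\<lambda>p. r * u p) = (\<lambda>p. r * foldr G ws u p)"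
  by (induction ws) (simp_all add: scale)

lemma fin_foldr: "finite (supp v) \<Longrightarrow> finite (supp (foldr G ws v))"
  by (induction ws) (simp_all add: fin)

lemma contr_foldr: "finite (supp v) \<Longrightarrow> nrm (foldr G ws v) \<le> nrm v"
  by (induction ws) (simp_all, metis contr fin_foldr order_trans)

lemma adj_foldr:
  assumes "finite (supp u)" "finite (supp v)"
  shows "ip (foldr G ws u) v = ip u (foldr G (rev (map (\<lambda>(g, t). (g, \<not> t)) ws)) v)"
  using assms(2)
proof (induction ws arbitrary: v)
  case (Cons x ws)
  obtain g t where x: "x = (g, t)" by (cases x)
  have "ip (foldr G (x # ws) u) v = ip (foldr G ws u) (G (g, \<not> t) v)"
    using Cons.prems assms(1) by (simp add: x adj fin_foldr)
  also have "\<dots> = ip u (foldr G (rev (map (\<lambda>(g, t). (g, \<not> t)) ws)) (G (g, \<not> t) v))"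
    using Cons.prems by (intro Cons.IH fin)
  finally show ?case by (simp add: x)
qed simp

definition rep :: "'g free_alg \<Rightarrow> ('p \<Rightarrow> complex) \<Rightarrow> 'p \<Rightarrow> complex"
  where "rep X v p = (\<Sum>w\<in>Poly_Mapping.keys X. Poly_Mapping.lookup X w * word_op w v p)"

lemma rep_add: "rep (X + Y) v p = rep X v p + rep Y v p"
  unfolding rep_def by (rule setsum_keys_plus_distrib) (simp_all add: distrib_right)

lemma rep_zero: "rep 0 v p = 0"
  by (simp add: rep_def)

lemma rep_sum: "rep (sum F I) v p = (\<Sum>i\<in>I. rep (F i) v p)"
  by (induction I rule: infinite_finite_induct) (simp_all add: rep_zero rep_add)

lemma rep_diff: "rep (X - Y) v p = rep X v p - rep Y v p"
  by (metis rep_add diff_add_cancel eq_diff_eq)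

lemma rep_single: "rep (Poly_Mapping.single w r) v p = r * word_op w v p"
  by (cases "r = 0") (simp_all add: rep_def)

lemma rep_sum_right: "rep X (\<lambda>p. \<Sum>i\<in>I. u i p) p = (\<Sum>i\<in>I. rep X (u i) p)"
  unfolding rep_def word_op_def foldr_sum sum_distrib_left by (rule sum.swap)

lemma rep_scale_right: "rep X (\<lambda>p. r * u p) p = r * rep X u p"
  unfolding rep_def word_op_def foldr_scale sum_distrib_left by (simp add: mult.left_commute)

lemma rep_mult: "rep (X * Y) v = rep X (rep Y v)"
proof
  fix p
  have *: "rep (Poly_Mapping.single u r * Poly_Mapping.single w t) v p =
      rep (Poly_Mapping.single u r) (rep (Poly_Mapping.single w t) v) p" for u w r t
  proof -
    have "rep (Poly_Mapping.single w t) v = (\<lambda>p. t * word_op w v p)"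
      by (rule ext) (rule rep_single)
    then show ?thesis
      by (simp only: mult_single rep_single word_op_plus rep_scale_right mult.assoc mult.left_commute)
  qed
  define P Q where "P = (\<lambda>k. Poly_Mapping.single k (Poly_Mapping.lookup X k))"
    and "Q = (\<lambda>k. Poly_Mapping.single k (Poly_Mapping.lookup Y k))"
  have x: "X = sum P (Poly_Mapping.keys X)" and y: "Y = sum Q (Poly_Mapping.keys Y)"
    unfolding P_def Q_def by (rule poly_mapping_sum_single)+
  have "rep (sum P I * sum Q J) v p = rep (sum P I) (rep (sum Q J) v) p" for I J
  proof -
    have "rep (sum Q J) v = (\<lambda>p. \<Sum>j\<in>J. rep (Q j) v p)" by (rule ext) (rule rep_sum)
    then have "rep (sum P I) (rep (sum Q J) v) p = (\<Sum>i\<in>I. \<Sum>j\<in>J. rep (P i) (rep (Q j) v) p)"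
      by (simp only: rep_sum rep_sum_right) (rule sum.swap)
    then show ?thesis by (simp only: sum_product rep_sum * P_def Q_def)
  qed
  then show "rep (X * Y) v p = rep X (rep Y v) p"
    using x y by metis
qed

lemma rep_const: "rep (fa_const r) v p = r * v p"
  by (simp add: fa_const_def rep_single word_op_def zero_word_def)

lemma rep_one: "rep 1 v p = v p"
  using rep_const[of 1] by (simp add: fa_const_def)

lemma rep_gen: "rep (fa_gen g) v = G (g, False) v"
  by (rule ext) (simp add: fa_gen_def rep_single word_op_def)

lemma rep_gen_star: "rep (fa_star (fa_gen g)) v = G (g, True) v"
  by (rule ext) (simp add: fa_gen_def fa_star_def rep_single word_star_def word_op_def)

lemma fin_sum:
  assumes "\<And>i. i \<in> I \<Longrightarrow> finite (supp (u i))"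
  shows "finite (supp (\<lambda>p. \<Sum>i\<in>I. u i p))"
proof (cases "finite I")
  case True
  have "supp (\<lambda>p. \<Sum>i\<in>I. u i p) \<subseteq> (\<Union>i\<in>I. supp (u i))"
    by (auto simp: supp_def intro: sum.neutral)
  with True assms show ?thesis by (metis finite_UN_I finite_subset)
qed (simp add: supp_def)

lemma fin_rep: "finite (supp v) \<Longrightarrow> finite (supp (rep X v))"
  unfolding rep_def word_op_def
  by (rule fin_sum) (rule finite_subset[OF supp_scale], rule fin_foldr)

lemma ip_sum_left:
  assumes "\<And>i. i \<in> I \<Longrightarrow> finite (supp (u i))" "finite (supp v)"
  shows "ip (\<lambda>p. \<Sum>i\<in>I. u i p) v = (\<Sum>i\<in>I. ip (u i) v)"
proof -
  have "ip (\<lambda>p. \<Sum>i\<in>I. u i p) v = cnj (ip v (\<lambda>p. \<Sum>i\<in>I. u i p))"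
    using assms by (intro ip_commute fin_sum)
  also have "\<dots> = (\<Sum>i\<in>I. cnj (ip v (u i)))"
    unfolding ip_def sum_distrib_left by (subst sum.swap) simp
  also have "\<dots> = (\<Sum>i\<in>I. ip (u i) v)"
    using assms by (intro sum.cong refl ip_commute[symmetric])
  finally show ?thesis .
qed

lemma ip_scale_left: "finite (supp u) \<Longrightarrow> ip (\<lambda>p. r * u p) v = cnj r * ip u v"
  by (subst ip_superset[of "supp u"]) (simp_all add: supp_scale ip_def sum_distrib_left mult.assoc)

lemma rep_adj:
  assumes "finite (supp u)" "finite (supp v)"
  shows "ip (rep X u) v = ip u (rep (fa_star X) v)"
proof -
  have "ip (rep X u) v = (\<Sum>w\<in>Poly_Mapping.keys X. ip (\<lambda>p. Poly_Mapping.lookup X w * word_op w u p) v)"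
    unfolding rep_def[abs_def]
    by (rule ip_sum_left) (use assms in \<open>auto simp: word_op_def intro: finite_subset[OF supp_scale] fin_foldr\<close>)
  also have "\<dots> = (\<Sum>w\<in>Poly_Mapping.keys X. cnj (Poly_Mapping.lookup X w) * ip u (word_op (word_star w) v))"
    using assms by (intro sum.cong refl)
      (simp add: ip_scale_left fin_foldr word_op_def word_star_def adj_foldr)
  also have "\<dots> = ip u (rep (fa_star X) v)"
    unfolding ip_def fa_star_def rep_sum rep_single sum_distrib_left
    by (subst sum.swap) (simp add: mult.left_commute)
  finally show ?thesis .
qed

definition opnorm :: "'g free_alg \<Rightarrow> real"
  where "opnorm X = (SUP v\<in>{v. finite (supp v) \<and> nrm v \<le> 1}. nrm (rep X v))"

lemma rep_bounded:
  assumes "finite (supp v)"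
  shows "nrm (rep X v) \<le> (\<Sum>w\<in>Poly_Mapping.keys X. cmod (Poly_Mapping.lookup X w)) * nrm v"
proof -
  have fw: "finite (supp (word_op w v))" for w
    using assms by (simp add: word_op_def fin_foldr)
  have 1: "finite (supp (\<lambda>p. Poly_Mapping.lookup X w * word_op w v p))" for w
    using fw finite_subset[OF supp_scale] by blast
  have "nrm (\<lambda>p. \<Sum>w\<in>K. Poly_Mapping.lookup X w * word_op w v p)
      \<le> (\<Sum>w\<in>K. cmod (Poly_Mapping.lookup X w)) * nrm v" if "finite K" for K
    using that
  proof (induction K)
    case empty
    then show ?case by (simp add: nrm_zero)
  next
    case (insert w K)
    have 2: "nrm (\<lambda>p. Poly_Mapping.lookup X w * word_op w v p) \<le> cmod (Poly_Mapping.lookup X w) * nrm v"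
      using contr_foldr[OF assms, of "letters w"] unfolding nrm_scale[OF fw]
      by (simp add: mult_left_mono word_op_def)
    show ?case
      using insert 2 nrm_triangle[OF 1[of w]
          fin_sum[of K "\<lambda>w p. Poly_Mapping.lookup X w * word_op w v p", OF 1]]
      by (simp add: distrib_right)
  qed
  from this[OF finite_keys] show ?thesis by (simp add: rep_def[abs_def])
qed

lemma opnorm_bdd: "bdd_above ((\<lambda>v. nrm (rep X v)) ` {v. finite (supp v) \<and> nrm v \<le> 1})"
proof (rule bdd_aboveI2)
  fix v :: "'p \<Rightarrow> complex"
  assume v: "v \<in> {v. finite (supp v) \<and> nrm v \<le> 1}"
  have "nrm (rep X v) \<le> (\<Sum>w\<in>Poly_Mapping.keys X. cmod (Poly_Mapping.lookup X w)) * nrm v"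
    using v by (intro rep_bounded) simp
  also have "\<dots> \<le> (\<Sum>w\<in>Poly_Mapping.keys X. cmod (Poly_Mapping.lookup X w)) * 1"
    using v by (intro mult_left_mono) (simp_all add: sum_nonneg)
  finally show "nrm (rep X v) \<le> (\<Sum>w\<in>Poly_Mapping.keys X. cmod (Poly_Mapping.lookup X w))" by simp
qed

lemma nrm_le_opnorm:
  assumes "finite (supp v)"
  shows "nrm (rep X v) \<le> opnorm X * nrm v"
proof (cases "nrm v = 0")
  case True
  then show ?thesis using rep_bounded[OF assms, of X] by simp
next
  case False
  then have pos: "0 < nrm v" using nrm_nonneg[of v] by simp
  let ?u = "\<lambda>p. complex_of_real (1 / nrm v) * v p"
  have fu: "finite (supp ?u)" using assms finite_subset[OF supp_scale] by blast
  have "nrm ?u = 1" using pos by (subst nrm_scale[OF assms]) (simp add: norm_divide)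
  with fu have "nrm (rep X ?u) \<le> opnorm X"
    unfolding opnorm_def by (intro cSUP_upper opnorm_bdd) simp
  moreover have "rep X ?u = (\<lambda>p. complex_of_real (1 / nrm v) * rep X v p)"
    by (rule ext) (rule rep_scale_right)
  ultimately have "nrm (rep X v) / nrm v \<le> opnorm X"
    using pos by (simp only: nrm_scale[OF fin_rep[OF assms]]) (simp add: norm_divide)
  then show ?thesis using pos by (simp add: pos_divide_le_eq)
qed

lemma opnorm_le:
  assumes "0 \<le> C" "\<And>v. finite (supp v) \<Longrightarrow> nrm (rep X v) \<le> C * nrm v"
  shows "opnorm X \<le> C"
  unfolding opnorm_def
proof (rule cSUP_least)
  show "{v :: 'p \<Rightarrow> complex. finite (supp v) \<and> nrm v \<le> 1} \<noteq> {}"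
    using nrm_zero[where 'a = 'p] by (auto intro!: exI[of _ "\<lambda>_. 0"] simp: supp_def)
next
  fix v :: "'p \<Rightarrow> complex"
  assume v: "v \<in> {v. finite (supp v) \<and> nrm v \<le> 1}"
  then have "nrm (rep X v) \<le> C * nrm v" by (intro assms(2)) simp
  also have "\<dots> \<le> C * 1" using v assms(1) by (intro mult_left_mono) simp_all
  finally show "nrm (rep X v) \<le> C" by simp
qed

lemma opnorm_nonneg: "0 \<le> opnorm X"
proof -
  have "nrm (rep X (\<lambda>_. 0)) \<le> opnorm X"
    unfolding opnorm_def by (rule cSUP_upper[OF _ opnorm_bdd]) (simp add: supp_def nrm_zero)
  with nrm_nonneg show ?thesis by (rule order_trans)
qed

lemma opnorm_mult: "opnorm (X * Y) \<le> opnorm X * opnorm Y"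
proof (rule opnorm_le)
  fix v :: "'p \<Rightarrow> complex"
  assume v: "finite (supp v)"
  have "nrm (rep X (rep Y v)) \<le> opnorm X * nrm (rep Y v)"
    using v by (intro nrm_le_opnorm fin_rep)
  also have "\<dots> \<le> opnorm X * (opnorm Y * nrm v)"
    using v by (intro mult_left_mono nrm_le_opnorm opnorm_nonneg)
  finally show "nrm (rep (X * Y) v) \<le> opnorm X * opnorm Y * nrm v"
    by (simp add: rep_mult mult.assoc)
qed (simp add: opnorm_nonneg)

lemma nrm_square_le:
  assumes "finite (supp v)"
  shows "(nrm (rep X v))\<^sup>2 \<le> nrm v * nrm (rep (fa_star X) (rep X v))"
proof -
  have "complex_of_real ((nrm (rep X v))\<^sup>2) = ip v (rep (fa_star X) (rep X v))"
    using assms by (simp only: ip_self[OF fin_rep, symmetric] rep_adj fin_rep)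
  then have "(nrm (rep X v))\<^sup>2 = cmod (ip v (rep (fa_star X) (rep X v)))"
    by (metis abs_power2 norm_of_real)
  also have "\<dots> \<le> nrm v * nrm (rep (fa_star X) (rep X v))"
    using assms by (intro ip_Cauchy_Schwarz fin_rep)
  finally show ?thesis .
qed

text \<open>The lower bound is Cauchy-Schwarz in the form of \<open>nrm_square_le\<close>. The upper
  bound is submultiplicativity, once the norms of X and its adjoint are known to agree.\<close>

lemma opnorm_cstar: "opnorm (fa_star X * X) = (opnorm X)\<^sup>2"
proof (rule antisym)
  have star_le: "opnorm X \<le> opnorm (fa_star X)" for X
  proof (rule opnorm_le[OF opnorm_nonneg])
    fix v :: "'p \<Rightarrow> complex"
    assume v: "finite (supp v)"
    have "nrm (rep X v) * nrm (rep X v) \<le> nrm v * nrm (rep (fa_star X) (rep X v))"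
      using nrm_square_le[OF v, of X] by (simp add: power2_eq_square)
    also have "\<dots> \<le> nrm v * (opnorm (fa_star X) * nrm (rep X v))"
      using v by (intro mult_left_mono nrm_le_opnorm fin_rep nrm_nonneg)
    finally have "nrm (rep X v) * nrm (rep X v) \<le> (opnorm (fa_star X) * nrm v) * nrm (rep X v)"
      by (simp add: mult_ac)
    then show "nrm (rep X v) \<le> opnorm (fa_star X) * nrm v"
      using nrm_nonneg[of "rep X v"] opnorm_nonneg nrm_nonneg[of v]
      by (cases "nrm (rep X v) = 0") auto
  qed
  \<comment> \<open>The double adjoint is compared with X through its action: both have the same
    inner products with every finitely supported vector, in particular with their
    difference.\<close>
  have star_star: "rep (fa_star (fa_star X)) v = rep X v" if v: "finite (supp v)" for v
  proof (rule ccontr)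
    assume ne: "rep (fa_star (fa_star X)) v \<noteq> rep X v"
    define u where "u = (\<lambda>p. rep (fa_star (fa_star X)) v p + (-1) * rep X v p)"
    have fu: "finite (supp u)"
      unfolding u_def using finite_subset[OF supp_scale fin_rep[OF v]] fin_rep[OF v]
      by (intro finite_subset[OF supp_add] finite_UnI) blast+
    have "ip v' (rep (fa_star (fa_star X)) v) = ip v' (rep X v)" if "finite (supp v')" for v'
    proof -
      have "ip v' (rep (fa_star (fa_star X)) v) = ip (rep (fa_star X) v') v"
        using that v by (simp add: rep_adj)
      also have "\<dots> = cnj (ip v (rep (fa_star X) v'))"
        using that v by (intro ip_commute fin_rep)
      also have "\<dots> = cnj (ip (rep X v) v')"
        using that v by (simp add: rep_adj)
      also have "\<dots> = ip v' (rep X v)"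
        using that v by (intro ip_commute[symmetric] fin_rep)
      finally show ?thesis .
    qed
    from this[OF fu] have "ip u u = 0"
      by (simp add: u_def[abs_def] ip_def sum_subtractf right_diff_distrib)
    then have "nrm u = 0" using fu by (simp add: ip_self)
    then have "u = (\<lambda>_. 0)" by (rule nrm_eq_0[OF fu])
    with ne show False by (auto simp: u_def fun_eq_iff)
  qed
  have "opnorm (fa_star X) \<le> opnorm X"
  proof (rule opnorm_le[OF opnorm_nonneg])
    fix v :: "'p \<Rightarrow> complex"
    assume v: "finite (supp v)"
    have "nrm (rep (fa_star X) v) * nrm (rep (fa_star X) v)
        \<le> nrm v * nrm (rep (fa_star (fa_star X)) (rep (fa_star X) v))"
      using nrm_square_le[OF v, of "fa_star X"] by (simp add: power2_eq_square)
    also have "\<dots> \<le> nrm v * (opnorm X * nrm (rep (fa_star X) v))"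
      using v by (simp add: star_star fin_rep mult_left_mono nrm_le_opnorm nrm_nonneg)
    finally have "nrm (rep (fa_star X) v) * nrm (rep (fa_star X) v)
        \<le> (opnorm X * nrm v) * nrm (rep (fa_star X) v)"
      by (simp add: mult_ac)
    then show "nrm (rep (fa_star X) v) \<le> opnorm X * nrm v"
      using nrm_nonneg[of "rep (fa_star X) v"] opnorm_nonneg nrm_nonneg[of v]
      by (cases "nrm (rep (fa_star X) v) = 0") auto
  qed
  then have "opnorm (fa_star X) * opnorm X \<le> opnorm X * opnorm X"
    by (intro mult_right_mono opnorm_nonneg)
  with opnorm_mult[of "fa_star X" X] show "opnorm (fa_star X * X) \<le> (opnorm X)\<^sup>2"
    by (simp add: power2_eq_square)
next
  have "opnorm X \<le> sqrt (opnorm (fa_star X * X))"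
  proof (rule opnorm_le)
    fix v :: "'p \<Rightarrow> complex"
    assume v: "finite (supp v)"
    have "(nrm (rep X v))\<^sup>2 \<le> nrm v * nrm (rep (fa_star X * X) v)"
      using nrm_square_le[OF v] by (simp add: rep_mult)
    also have "\<dots> \<le> nrm v * (opnorm (fa_star X * X) * nrm v)"
      using v by (intro mult_left_mono nrm_le_opnorm nrm_nonneg)
    finally have "(nrm (rep X v))\<^sup>2 \<le> (sqrt (opnorm (fa_star X * X)) * nrm v)\<^sup>2"
      by (simp add: power_mult_distrib opnorm_nonneg) (simp add: power2_eq_square mult_ac)
    then show "nrm (rep X v) \<le> sqrt (opnorm (fa_star X * X)) * nrm v"
      by (rule power2_le_imp_le) (simp add: opnorm_nonneg nrm_nonneg)
  qed (simp add: opnorm_nonneg)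
  then show "(opnorm X)\<^sup>2 \<le> opnorm (fa_star X * X)"
    by (metis opnorm_nonneg real_le_rsqrt real_sqrt_le_iff real_sqrt_pow2 power_mono)
qed

lemma rep_fa_const_mult: "rep (fa_const r * X) v = (\<lambda>p. r * rep X v p)"
  by (rule ext) (simp add: rep_mult rep_const)

lemma cstar_seminorm_opnorm: "cstar_seminorm opnorm"
  unfolding cstar_seminorm_def
proof (intro conjI allI)
  fix X Y
  show "opnorm (X + Y) \<le> opnorm X + opnorm Y"
  proof (rule opnorm_le)
    fix v :: "'p \<Rightarrow> complex"
    assume v: "finite (supp v)"
    have "rep (X + Y) v = (\<lambda>p. rep X v p + rep Y v p)" by (rule ext) (rule rep_add)
    then have "nrm (rep (X + Y) v) \<le> nrm (rep X v) + nrm (rep Y v)"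
      using v by (simp add: nrm_triangle fin_rep)
    also have "\<dots> \<le> (opnorm X + opnorm Y) * nrm v"
      using v by (simp add: distrib_right add_mono nrm_le_opnorm)
    finally show "nrm (rep (X + Y) v) \<le> (opnorm X + opnorm Y) * nrm v" .
  qed (simp add: opnorm_nonneg)
  show "opnorm (X * Y) \<le> opnorm X * opnorm Y" by (rule opnorm_mult)
  show "opnorm (fa_star X * X) = (opnorm X)\<^sup>2" by (rule opnorm_cstar)
next
  fix r X
  have le: "opnorm (fa_const r * X) \<le> cmod r * opnorm X" for r X
  proof (rule opnorm_le)
    fix v :: "'p \<Rightarrow> complex"
    assume v: "finite (supp v)"
    then show "nrm (rep (fa_const r * X) v) \<le> cmod r * opnorm X * nrm v"
      by (simp add: rep_fa_const_mult nrm_scale fin_rep mult.assoc mult_left_mono nrm_le_opnorm)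
  qed (simp add: opnorm_nonneg)
  show "opnorm (fa_const r * X) = cmod r * opnorm X"
  proof (cases "r = 0")
    case True
    then show ?thesis using le[of 0 X] opnorm_nonneg[of "fa_const 0 * X"] by simp
  next
    case False
    have "fa_const (1 / r) * (fa_const r * X) = X"
      using False by (simp add: fa_const_def mult.assoc[symmetric] mult_single)
    then have "opnorm X \<le> cmod (1 / r) * opnorm (fa_const r * X)"
      using le[of "1 / r" "fa_const r * X"] by simp
    then have "cmod r * opnorm X \<le> opnorm (fa_const r * X)"
      using False by (simp add: norm_divide field_simps)
    with le show ?thesis by (rule antisym)
  qed
qed

lemma opnorm_eq_0:
  assumes "opnorm X \<le> 0" "finite (supp v)"
  shows "rep X v p = 0"
proof -
  have "nrm (rep X v) \<le> 0"
    using nrm_le_opnorm[OF assms(2), of X] assms(1) nrm_nonneg[of v]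
    by (meson mult_nonpos_nonneg order_trans)
  then have "nrm (rep X v) = 0" using nrm_nonneg[of "rep X v"] by simp
  then have "rep X v = (\<lambda>_. 0)" by (rule nrm_eq_0[OF fin_rep[OF assms(2)]])
  then show ?thesis by simp
qed

lemma opnorm_zeroI:
  assumes "\<And>v. rep X v = (\<lambda>_. 0)"
  shows "opnorm X = 0"
  using opnorm_le[of 0 X] opnorm_nonneg[of X] assms by (simp add: nrm_zero)

end

text \<open>On basis vectors e (n, k) the operator \<open>a\<close> raises n, \<open>b\<close> is
  diagonal and \<open>D\<close> raises k. The phase (q / cnj q) ^ k in \<open>b\<close> realizes its
  commutation with \<open>D\<close>. For n = 0 the factor before v (n - 1, k) is 0, so truncated
  subtraction is harmless.\<close>

definition rep_op :: "complex \<Rightarrow> Uq2_gen \<times> bool \<Rightarrow> (nat \<times> int \<Rightarrow> complex) \<Rightarrow> nat \<times> int \<Rightarrow> complex"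
  where "rep_op q x v = (\<lambda>(n, k). case x of
    (Gen_a, False) \<Rightarrow> complex_of_real (sqrt (1 - (cmod q ^ 2) ^ n)) * v (n - 1, k)
  | (Gen_a, True) \<Rightarrow> complex_of_real (sqrt (1 - (cmod q ^ 2) ^ Suc n)) * v (Suc n, k)
  | (Gen_b, False) \<Rightarrow> q ^ n * (q / cnj q) powi k * v (n, k)
  | (Gen_b, True) \<Rightarrow> cnj (q ^ n * (q / cnj q) powi k) * v (n, k)
  | (Gen_D, False) \<Rightarrow> v (n, k - 1)
  | (Gen_D, True) \<Rightarrow> v (n, k + 1))"

lemma rep_op_simps:
  "rep_op q (Gen_a, False) v (n, k) = complex_of_real (sqrt (1 - (cmod q ^ 2) ^ n)) * v (n - 1, k)"
  "rep_op q (Gen_a, True) v (n, k) = complex_of_real (sqrt (1 - (cmod q ^ 2) ^ Suc n)) * v (Suc n, k)"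
  "rep_op q (Gen_b, False) v (n, k) = q ^ n * (q / cnj q) powi k * v (n, k)"
  "rep_op q (Gen_b, True) v (n, k) = cnj (q ^ n * (q / cnj q) powi k) * v (n, k)"
  "rep_op q (Gen_D, False) v (n, k) = v (n, k - 1)"
  "rep_op q (Gen_D, True) v (n, k) = v (n, k + 1)"
  by (simp_all add: rep_op_def)

lemma gen_bool_cases:
  assumes "x = (Gen_a, False) \<Longrightarrow> P" "x = (Gen_a, True) \<Longrightarrow> P" "x = (Gen_b, False) \<Longrightarrow> P"
    "x = (Gen_b, True) \<Longrightarrow> P" "x = (Gen_D, False) \<Longrightarrow> P" "x = (Gen_D, True) \<Longrightarrow> P"
  shows P
  using assms by (cases x; cases "fst x"; cases "snd x") auto

text \<open>An unstarred generator moves basis vectors along an injective map up to a factor, so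
  adjointness becomes a termwise check after reindexing.\<close>

lemma ip_reindex:
  assumes "finite (supp u)" "inj_on \<sigma> (supp u)" "supp u' \<subseteq> \<sigma> ` supp u"
    "\<And>p. p \<in> supp u \<Longrightarrow> cnj (u' (\<sigma> p)) * v (\<sigma> p) = cnj (u p) * v' p"
  shows "ip u' v = ip u v'"
proof -
  have "ip u' v = (\<Sum>p\<in>\<sigma> ` supp u. cnj (u' p) * v p)"
    using assms by (intro ip_superset) auto
  also have "\<dots> = (\<Sum>p\<in>supp u. cnj (u' (\<sigma> p)) * v (\<sigma> p))"
    using assms(2) by (simp add: sum.reindex)
  also have "\<dots> = ip u v'"
    unfolding ip_def by (intro sum.cong refl assms(4))
  finally show ?thesis .
qed

lemma rep_op_fin: "finite (supp v) \<Longrightarrow> finite (supp (rep_op q x v))"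
proof -
  assume fin: "finite (supp v)"
  have *: "finite (supp (rep_op q x v))" if "supp (rep_op q x v) \<subseteq> \<sigma> ` supp v" for \<sigma>
    using that fin by (metis finite_imageI finite_subset)
  show ?thesis
  proof (rule gen_bool_cases[of x])
    assume x: "x = (Gen_a, False)"
    have "(n, k) \<in> (\<lambda>(n, k). (Suc n, k)) ` supp v" if "rep_op q x v (n, k) \<noteq> 0" for n k
      using that by (cases n) (auto simp: x rep_op_simps supp_def intro!: image_eqI)
    then show ?thesis by (intro *[of "\<lambda>(n, k). (Suc n, k)"]) (auto simp: supp_def)
  next
    assume x: "x = (Gen_a, True)"
    have "(n, k) \<in> (\<lambda>(n, k). (n - 1, k)) ` supp v" if "rep_op q x v (n, k) \<noteq> 0" for n k
      using that by (auto simp: x rep_op_simps supp_def intro!: image_eqI[of _ _ "(Suc n, k)"])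
    then show ?thesis by (intro *[of "\<lambda>(n, k). (n - 1, k)"]) (auto simp: supp_def)
  next
    assume x: "x = (Gen_b, False)"
    show ?thesis by (rule *[of id]) (auto simp: supp_def x rep_op_simps)
  next
    assume x: "x = (Gen_b, True)"
    show ?thesis by (rule *[of id]) (auto simp: supp_def x rep_op_simps)
  next
    assume x: "x = (Gen_D, False)"
    have "(n, k) \<in> (\<lambda>(n, k). (n, k + 1)) ` supp v" if "rep_op q x v (n, k) \<noteq> 0" for n k
      using that by (auto simp: x rep_op_simps supp_def intro!: image_eqI[of _ _ "(n, k - 1)"])
    then show ?thesis by (intro *[of "\<lambda>(n, k). (n, k + 1)"]) (auto simp: supp_def)
  next
    assume x: "x = (Gen_D, True)"
    have "(n, k) \<in> (\<lambda>(n, k). (n, k - 1)) ` supp v" if "rep_op q x v (n, k) \<noteq> 0" for n k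
      using that by (auto simp: x rep_op_simps supp_def intro!: image_eqI[of _ _ "(n, k + 1)"])
    then show ?thesis by (intro *[of "\<lambda>(n, k). (n, k - 1)"]) (auto simp: supp_def)
  qed
qed

lemma rep_op_adj_False:
  assumes "finite (supp u)"
  shows "ip (rep_op q (g, False) u) v = ip u (rep_op q (g, True) v)"
proof (cases g)
  case Gen_a
  have "(n, k) \<in> (\<lambda>(n, k). (Suc n, k)) ` supp u" if "rep_op q (g, False) u (n, k) \<noteq> 0" for n k
    using that by (cases n) (auto simp: Gen_a rep_op_simps supp_def intro!: image_eqI)
  then show ?thesis
    by (intro ip_reindex[of u "\<lambda>(n, k). (Suc n, k)"] assms)
      (auto simp: Gen_a rep_op_simps supp_def inj_on_def)
next
  case Gen_b
  then show ?thesis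
    by (intro ip_reindex[of u id] assms) (auto simp: rep_op_simps supp_def)
next
  case Gen_D
  have "(n, k) \<in> (\<lambda>(n, k). (n, k + 1)) ` supp u" if "rep_op q (g, False) u (n, k) \<noteq> 0" for n k
    using that by (auto simp: Gen_D rep_op_simps supp_def intro!: image_eqI[of _ _ "(n, k - 1)"])
  then show ?thesis
    by (intro ip_reindex[of u "\<lambda>(n, k). (n, k + 1)"] assms)
      (auto simp: Gen_D rep_op_simps supp_def inj_on_def)
qed

lemma rep_op_adj:
  assumes "finite (supp u)" "finite (supp v)"
  shows "ip (rep_op q (g, t) u) v = ip u (rep_op q (g, \<not> t) v)"
proof (cases t)
  case True
  have "ip (rep_op q (g, True) u) v = cnj (ip v (rep_op q (g, True) u))"
    using assms by (intro ip_commute rep_op_fin)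
  also have "\<dots> = cnj (ip (rep_op q (g, False) v) u)"
    using assms by (simp add: rep_op_adj_False)
  also have "\<dots> = ip u (rep_op q (g, False) v)"
    using assms by (intro ip_commute[symmetric] rep_op_fin)
  finally show ?thesis using True by simp
qed (use assms in \<open>simp add: rep_op_adj_False\<close>)

lemma cmod_twist: "q \<noteq> 0 \<Longrightarrow> cmod ((q / cnj q) powi k) = 1"
  by (simp add: norm_power_int norm_divide)

lemma rep_op_square:
  assumes "0 < cmod q" "cmod q < 1"
  shows "rep_op q (Gen_a, False) (rep_op q (Gen_a, True) v) (n, k) = complex_of_real (1 - (cmod q ^ 2) ^ n) * v (n, k)"
    and "rep_op q (Gen_a, True) (rep_op q (Gen_a, False) v) (n, k) = complex_of_real (1 - (cmod q ^ 2) ^ Suc n) * v (n, k)"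
    and "rep_op q (Gen_b, False) (rep_op q (Gen_b, True) v) (n, k) = complex_of_real ((cmod q ^ 2) ^ n) * v (n, k)"
    and "rep_op q (Gen_b, True) (rep_op q (Gen_b, False) v) (n, k) = complex_of_real ((cmod q ^ 2) ^ n) * v (n, k)"
proof -
  have p: "0 \<le> 1 - (cmod q ^ 2) ^ n" for n
    using assms by (simp add: power_le_one)
  have rt: "complex_of_real (sqrt x) * complex_of_real (sqrt x) = complex_of_real x" if "0 \<le> x" for x
    using that by (simp add: of_real_mult[symmetric] del: of_real_mult)
  show "rep_op q (Gen_a, False) (rep_op q (Gen_a, True) v) (n, k) = complex_of_real (1 - (cmod q ^ 2) ^ n) * v (n, k)"
  proof (cases n)
    case (Suc m)
    then show ?thesis
      by (simp only: rep_op_simps mult.assoc[symmetric] rt[OF p] diff_Suc_1)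
  qed (simp add: rep_op_simps)
  show "rep_op q (Gen_a, True) (rep_op q (Gen_a, False) v) (n, k) = complex_of_real (1 - (cmod q ^ 2) ^ Suc n) * v (n, k)"
    by (simp only: rep_op_simps mult.assoc[symmetric] rt[OF p] diff_Suc_1)
  have nz: "q \<noteq> 0" using assms by auto
  have "cnj (q ^ n * (q / cnj q) powi k) * (q ^ n * (q / cnj q) powi k) = complex_of_real ((cmod q ^ 2) ^ n)"
    unfolding mult.commute[of "cnj _"] complex_norm_square[symmetric]
    by (simp only: norm_mult norm_power cmod_twist[OF nz] mult_1_right power_mult[symmetric] mult.commute[of n 2])
  from arg_cong[OF this, of "\<lambda>z. z * v (n, k)"]
  show "rep_op q (Gen_b, False) (rep_op q (Gen_b, True) v) (n, k) = complex_of_real ((cmod q ^ 2) ^ n) * v (n, k)"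
    and "rep_op q (Gen_b, True) (rep_op q (Gen_b, False) v) (n, k) = complex_of_real ((cmod q ^ 2) ^ n) * v (n, k)"
    by (simp_all only: rep_op_simps mult_ac)
qed

text \<open>For every letter, the adjoint times the operator is diagonal with real entries at most
  1, and the squared norm of the image is the corresponding quadratic form.\<close>

lemma rep_op_contr:
  assumes "0 < cmod q" "cmod q < 1" "finite (supp v)"
  shows "nrm (rep_op q x v) \<le> nrm v"
proof -
  obtain g t where x: "x = (g, t)" by (cases x)
  have p: "0 \<le> (cmod q ^ 2) ^ n" "(cmod q ^ 2) ^ n \<le> 1" for n
    using assms by (simp_all add: power_le_one)
  have "\<exists>m \<le> 1. rep_op q (g, \<not> t) (rep_op q (g, t) v) (n, k) = complex_of_real m * v (n, k)" for n k
    using rep_op_square[OF assms(1,2), of v n k] p[of n] p(1)[of "Suc n"]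
    by (cases g; cases t)
      (auto simp del: of_real_diff power_Suc of_real_power simp: rep_op_simps intro: exI[of _ "1 - (cmod q ^ 2) ^ n"]
        exI[of _ "1 - (cmod q ^ 2) ^ Suc n"] exI[of _ "(cmod q ^ 2) ^ n"] exI[of _ "1"])
  then have "\<forall>p. \<exists>m \<le> 1. rep_op q (g, \<not> t) (rep_op q (g, t) v) p = complex_of_real m * v p" by auto
  then obtain m where m: "\<And>p. m p \<le> 1"
      "\<And>p. rep_op q (g, \<not> t) (rep_op q (g, t) v) p = complex_of_real (m p) * v p"
    by metis
  have "complex_of_real ((nrm (rep_op q x v))\<^sup>2) = ip v (rep_op q (g, \<not> t) (rep_op q (g, t) v))"
    using assms by (simp only: ip_self[OF rep_op_fin, symmetric] rep_op_adj rep_op_fin x)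
  also have "\<dots> = complex_of_real (\<Sum>p\<in>supp v. m p * (cmod (v p))\<^sup>2)"
    unfolding ip_def m(2) of_real_sum
    by (rule sum.cong) (simp_all add: complex_norm_square mult_ac del: of_real_power)
  finally have "(nrm (rep_op q x v))\<^sup>2 = (\<Sum>p\<in>supp v. m p * (cmod (v p))\<^sup>2)"
    by (simp only: of_real_eq_iff)
  also have "\<dots> \<le> (\<Sum>p\<in>supp v. (cmod (v p))\<^sup>2)"
  proof (rule sum_mono)
    fix p
    show "m p * (cmod (v p))\<^sup>2 \<le> (cmod (v p))\<^sup>2"
      using mult_right_mono[OF m(1)[of p], of "(cmod (v p))\<^sup>2"] by simp
  qed
  also have "\<dots> = (nrm v)\<^sup>2"
    by (simp add: nrm_def L2_set_def sum_nonneg)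
  finally show ?thesis by (rule power2_le_imp_le) (rule nrm_nonneg)
qed

lemma star_rep_op:
  assumes "0 < cmod q" "cmod q < 1"
  shows "star_rep (rep_op q)"
proof
  fix x r and u v :: "nat \<times> int \<Rightarrow> complex"
  show "rep_op q x (\<lambda>p. u p + v p) = (\<lambda>p. rep_op q x u p + rep_op q x v p)"
    by (rule gen_bool_cases[of x]) (auto simp: fun_eq_iff rep_op_simps distrib_left)
  show "rep_op q x (\<lambda>p. r * u p) = (\<lambda>p. r * rep_op q x u p)"
    by (rule gen_bool_cases[of x]) (auto simp: fun_eq_iff rep_op_simps)
  show "finite (supp v) \<Longrightarrow> finite (supp (rep_op q x v))" by (rule rep_op_fin)
  show "finite (supp u) \<Longrightarrow> finite (supp v) \<Longrightarrow> ip (rep_op q (g, t) u) v = ip u (rep_op q (g, \<not> t) v)" for g t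
    by (rule rep_op_adj)
  show "finite (supp v) \<Longrightarrow> nrm (rep_op q x v) \<le> nrm v"
    using assms by (rule rep_op_contr)
qed

lemma rep_relators:
  assumes "0 < cmod q" "cmod q < 1" "r \<in> Uq2_relators q"
  shows "star_rep.rep (rep_op q) r v = (\<lambda>_. 0)"
proof
  fix p :: "nat \<times> int"
  interpret star_rep "rep_op q" using assms(1,2) by (rule star_rep_op)
  have nz: "q \<noteq> 0" using assms(1) by auto
  obtain n k where p: "p = (n, k)" by (cases p)
  have tw: "(q / cnj q) powi k = (q / cnj q) * (q / cnj q) powi (k - 1)"
    using nz power_int_add_1'[of "q / cnj q" "k - 1"] by simp
  have tw2: "q\<^sup>2 / complex_of_real ((cmod q)\<^sup>2) = q / cnj q"
    unfolding complex_norm_square using nz by (simp add: power2_eq_square)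
  note e = rep_diff rep_add rep_mult rep_const rep_gen rep_gen_star rep_one
  note sq = rep_op_square[OF assms(1,2)]
  have "\<forall>r\<in>Uq2_relators q. rep r v (n, k) = 0"
    unfolding Uq2_relators_def Let_def ball_simps
  proof (intro conjI TrueI, goal_cases)
    case 1 show ?case by (cases n) (simp_all add: e rep_op_simps)
  next
    case 2 show ?case by (simp add: e rep_op_simps)
  next
    case 3 show ?case by (simp only: e sq diff_self)
  next
    case 4 show ?case by (simp only: e sq) (simp add: algebra_simps)
  next
    case 5 show ?case by (simp add: e rep_op_simps)
  next
    case 6 show ?case unfolding tw2 by (simp only: e rep_op_simps tw) simp
  next
    case 7 show ?case by (simp add: e rep_op_simps)
  next
    case 8 show ?case by (simp add: e rep_op_simps)
  next
    case 9 show ?case by (simp only: e sq) (simp add: algebra_simps)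
  qed
  with assms(3) show "rep r v p = 0" unfolding p by blast
qed

text \<open>Makes the complex numbers a target of \<open>universal_cstar_property\<close>, which
  then provides the characters.\<close>

instantiation complex :: cstar_algebra
begin

definition star_complex :: "complex \<Rightarrow> complex" where "star_complex = cnj"

instance
  by standard (simp_all add: star_complex_def scaleC_complex_def norm_mult power2_eq_square)

end

context uq2
begin

section \<open>Linear independence of the monomials, and the characters\<close>

abbreviation gens where "gens \<equiv> case_Uq2_gen a b D"

text \<open>The operator norm vanishes on the relators, so it is dominated by the universal norm,
  and a linear relation in the C*-algebra holds in the representation as well. It is tested on the
  basis vector at (0, 0), which the elements send to nonzero multiples of different basis
  vectors.\<close>

lemma independent_by_rep:
  assumes "finite I" "inj_on P I"
    and x: "\<And>i. i \<in> I \<Longrightarrow> x i = fa_eval gens (X i)"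
    and X: "\<And>i p. i \<in> I \<Longrightarrow> star_rep.rep (rep_op q) (X i) (\<lambda>p. if p = (0, 0) then 1 else 0) p
        = (if p = P i then C i else 0)"
    and C: "\<And>i. i \<in> I \<Longrightarrow> C i \<noteq> 0"
    and eq: "(\<Sum>i\<in>I. r i *\<^sub>C x i) = 0"
  shows "\<forall>i\<in>I. r i = 0"
proof
  fix i assume i: "i \<in> I"
  interpret R: star_rep "rep_op q" using q_pos q_less by (rule star_rep_op)
  let ?e = "\<lambda>p :: nat \<times> int. if p = (0, 0) then 1 else 0 :: complex"
  let ?Y = "\<Sum>i\<in>I. fa_const (r i) * X i"
  have "fa_eval gens ?Y = 0"
    using eq x by (simp add: fa_eval_sum fa_eval_mult fa_eval_const mult_scaleC_left)
  moreover have "R.opnorm ?Y \<le> norm (fa_eval gens ?Y)"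
    using cstar R.cstar_seminorm_opnorm R.opnorm_zeroI[OF rep_relators[OF q_pos q_less]]
    by (simp add: Uq2_cstar_def universal_cstar_def)
  ultimately have "R.opnorm ?Y \<le> 0" by simp
  then have "R.rep ?Y ?e (P i) = 0"
    by (rule R.opnorm_eq_0) (simp add: supp_def)
  moreover have "R.rep ?Y ?e (P i) = (\<Sum>j\<in>I. if j = i then r i * C i else 0)"
    unfolding R.rep_sum using assms(2) i
    by (intro sum.cong refl) (auto simp: R.rep_fa_const_mult X inj_on_def)
  ultimately show "r i = 0" using i C[OF i] assms(1) by simp
qed

lemma rep_power:
  assumes "star_rep G"
  shows "star_rep.rep G (X ^ n) v = ((star_rep.rep G X) ^^ n) v"
proof -
  interpret star_rep G by fact
  have "rep 1 v = v" for v by (rule ext) (rule rep_one)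
  then show ?thesis by (induction n arbitrary: v) (simp_all add: rep_mult)
qed

lemma pow_rep_a:
  "\<exists>r. r \<noteq> 0 \<and> (rep_op q (Gen_a, False) ^^ m) (\<lambda>p. if p = (n, k) then t else 0)
    = (\<lambda>p. if p = (n + m, k) then r * t else 0)"
proof (induction m)
  case 0
  show ?case by (intro exI[of _ 1]) (simp cong: if_cong)
next
  case (Suc m)
  then obtain r where r: "r \<noteq> 0" "(rep_op q (Gen_a, False) ^^ m) (\<lambda>p. if p = (n, k) then t else 0)
    = (\<lambda>p. if p = (n + m, k) then r * t else 0)" by blast
  have "(cmod q ^ 2) ^ Suc (n + m) < 1"
    using q_pos q_less by (intro power_Suc_less_one) (simp_all add: power_less_one_iff)
  then have "complex_of_real (sqrt (1 - (cmod q ^ 2) ^ Suc (n + m))) \<noteq> 0" by simp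
  moreover
  have "rep_op q (Gen_a, False) (\<lambda>p. if p = (n + m, k) then r * t else 0) (n', k')
      = (if (n', k') = (n + Suc m, k) then complex_of_real (sqrt (1 - (cmod q ^ 2) ^ Suc (n + m))) * (r * t) else 0)"
    for n' k'
    by (cases n') (auto simp: rep_op_simps)
  then have "rep_op q (Gen_a, False) (\<lambda>p. if p = (n + m, k) then r * t else 0)
      = (\<lambda>p. if p = (n + Suc m, k) then complex_of_real (sqrt (1 - (cmod q ^ 2) ^ Suc (n + m))) * r * t else 0)"
    by (intro ext) (simp only: split_paired_all mult.assoc)
  ultimately show ?case using r
    by (intro exI[of _ "complex_of_real (sqrt (1 - (cmod q ^ 2) ^ Suc (n + m))) * r"])
      (simp only: funpow.simps comp_def, simp)
qed

text \<open>\<open>b\<close> fixes the basis vector at (0, 0), so a ^ (n - i) * b ^ i carries it to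
  a nonzero multiple of the one at (n - i, 0).\<close>

lemma independent_f:
  "(\<Sum>i\<le>n. r i *\<^sub>C f n i) = 0 \<Longrightarrow> \<forall>i\<in>{..n}. r i = 0"
proof -
  assume eq: "(\<Sum>i\<le>n. r i *\<^sub>C f n i) = 0"
  have G: "star_rep (rep_op q)" using q_pos q_less by (rule star_rep_op)
  interpret R: star_rep "rep_op q" by (fact G)
  let ?e = "\<lambda>p :: nat \<times> int. if p = (0, 0) then 1 else 0 :: complex"
  have "\<exists>r. r \<noteq> 0 \<and> (rep_op q (Gen_a, False) ^^ m) ?e = (\<lambda>p. if p = (m, 0) then r else 0)" for m
    using pow_rep_a[of m 0 0 1] by (simp cong: if_cong)
  then obtain C where C: "\<And>m. C m \<noteq> 0"
    "\<And>m. (rep_op q (Gen_a, False) ^^ m) ?e = (\<lambda>p. if p = (m, 0) then C m else 0)"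
    by metis
  have b: "(rep_op q (Gen_b, False) ^^ m) ?e = ?e" for m
  proof (induction m)
    case (Suc m)
    have "rep_op q (Gen_b, False) ?e = ?e" by (auto simp: rep_op_simps fun_eq_iff)
    with Suc show ?case by simp
  qed simp
  have rg: "R.rep (fa_gen g) = rep_op q (g, False)" for g by (rule ext) (simp add: R.rep_gen)
  show ?thesis
  proof (rule independent_by_rep[where P = "\<lambda>i. (n - i, 0)" and C = "\<lambda>i. C (n - i)"
        and X = "\<lambda>i. fa_gen Gen_a ^ (n - i) * fa_gen Gen_b ^ i", OF _ _ _ _ _ eq])
    have pow: "fa_eval gens (X ^ m) = fa_eval gens X ^ m" for X m
      by (induction m) (simp_all add: fa_eval_one fa_eval_mult)
    show "f n i = fa_eval gens (fa_gen Gen_a ^ (n - i) * fa_gen Gen_b ^ i)" for i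
      by (simp add: fa_eval_mult pow fa_eval_gen f_def)
    show "R.rep (fa_gen Gen_a ^ (n - i) * fa_gen Gen_b ^ i) ?e p = (if p = (n - i, 0) then C (n - i) else 0)" for i p
      by (simp only: R.rep_mult rep_power[OF G] rg b C(2))
  qed (auto simp: C inj_on_def)
qed

definition g :: "nat \<Rightarrow> nat \<Rightarrow> 'a" where "g n i = a ^ (n - i) * c ^ i"

text \<open>The factor \<open>D\<close> in \<open>c\<close> raises the second coordinate, so a ^ (n
  - i) * c ^ i carries the basis vector at (0, 0) to a nonzero multiple of the one at (n - i,
  i).\<close>

lemma independent_g:
  "(\<Sum>i\<le>n. r i *\<^sub>C g n i) = 0 \<Longrightarrow> \<forall>i\<in>{..n}. r i = 0"
proof -
  assume eq: "(\<Sum>i\<le>n. r i *\<^sub>C g n i) = 0"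
  have G: "star_rep (rep_op q)" using q_pos q_less by (rule star_rep_op)
  interpret R: star_rep "rep_op q" by (fact G)
  let ?e = "\<lambda>p :: nat \<times> int. if p = (0, 0) then 1 else 0 :: complex"
  let ?c = "fa_const (- cnj q) * (fa_gen Gen_D * fa_star (fa_gen Gen_b))"
  have "\<exists>t. t \<noteq> 0 \<and> (R.rep ?c ^^ m) ?e = (\<lambda>p. if p = (0, int m) then t else 0)" for m
  proof (induction m)
    case 0
    show ?case by (intro exI[of _ 1]) simp
  next
    case (Suc m)
    then obtain t where t: "t \<noteq> 0" "(R.rep ?c ^^ m) ?e = (\<lambda>p. if p = (0, int m) then t else 0)" by blast
    define u where "u = - cnj q * cnj ((q / cnj q) powi int m)"
    have "u \<noteq> 0" by (simp add: u_def)
    moreover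
    have "R.rep ?c (\<lambda>p. if p = (0, int m) then t else 0) (n, k)
        = (if (n, k) = (0, int (Suc m)) then u * t else 0)" for n k
      by (auto simp: R.rep_fa_const_mult R.rep_mult R.rep_const R.rep_gen R.rep_gen_star rep_op_simps u_def)
    then have "R.rep ?c (\<lambda>p. if p = (0, int m) then t else 0)
        = (\<lambda>p. if p = (0, int (Suc m)) then u * t else 0)"
      by (intro ext) (simp only: split_paired_all)
    ultimately show ?case using t
      by (intro exI[of _ "u * t"]) (simp only: funpow.simps comp_def, simp)
  qed
  then obtain T where T: "\<And>m. T m \<noteq> 0" "\<And>m. (R.rep ?c ^^ m) ?e = (\<lambda>p. if p = (0, int m) then T m else 0)"
    by metis
  have "\<exists>r. r \<noteq> 0 \<and> (rep_op q (Gen_a, False) ^^ m) (\<lambda>p. if p = (0, int k) then T k else 0)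
      = (\<lambda>p. if p = (m, int k) then r else 0)" for m k
    using pow_rep_a[of m 0 "int k" "T k"] T(1)[of k] by (metis add_0 mult_eq_0_iff)
  then obtain C where C: "\<And>m k. C m k \<noteq> 0"
    "\<And>m k. (rep_op q (Gen_a, False) ^^ m) (\<lambda>p. if p = (0, int k) then T k else 0)
      = (\<lambda>p. if p = (m, int k) then C m k else 0)"
    by metis
  have rg: "R.rep (fa_gen g) = rep_op q (g, False)" for g by (rule ext) (simp add: R.rep_gen)
  show ?thesis
  proof (rule independent_by_rep[where P = "\<lambda>i. (n - i, int i)" and C = "\<lambda>i. C (n - i) i"
        and X = "\<lambda>i. fa_gen Gen_a ^ (n - i) * ?c ^ i", OF _ _ _ _ _ eq])
    have pow: "fa_eval gens (X ^ m) = fa_eval gens X ^ m" for X m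
      by (induction m) (simp_all add: fa_eval_one fa_eval_mult)
    have "fa_eval gens ?c = c"
      by (simp add: fa_eval_mult fa_eval_const fa_eval_gen fa_eval_star c_def mult_scaleC_left)
    then show "g n i = fa_eval gens (fa_gen Gen_a ^ (n - i) * ?c ^ i)" for i
      by (simp only: fa_eval_mult[of _ "_ ^ _"] pow fa_eval_gen g_def Uq2_gen.case)
    show "R.rep (fa_gen Gen_a ^ (n - i) * ?c ^ i) ?e p = (if p = (n - i, int i) then C (n - i) i else 0)" for i p
      by (simp only: R.rep_mult[of "_ ^ _"] rep_power[OF G] rg T(2) C(2))
  qed (auto simp: C inj_on_def)
qed

lemma character:
  obtains \<xi> where "linear_on UNIV \<xi>" "\<xi> 1 = (1 :: complex)" "\<And>x y. \<xi> (x * y) = \<xi> x * \<xi> y"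
    "\<And>x. \<xi> (star x) = cnj (\<xi> x)" "\<xi> a = cis \<theta>" "\<xi> b = 0" "\<xi> D = cis \<phi>"
proof -
  let ?\<delta> = "case_Uq2_gen (cis \<theta>) 0 (cis \<phi>)"
  have cis: "cis x * cnj (cis x) = 1" "cnj (cis x) * cis x = 1" for x
    by (simp_all add: cis_cnj cis_mult)
  have "\<forall>r\<in>Uq2_relators q. fa_eval ?\<delta> r = 0"
    unfolding Uq2_relators_def Let_def ball_simps
    by (simp add: fa_eval_diff fa_eval_add fa_eval_mult fa_eval_const fa_eval_star fa_eval_one
        fa_eval_gen star_complex_def scaleC_complex_def cis)
  with cstar obtain \<xi> where "linear_on UNIV \<xi>" "\<xi> 1 = 1" "\<forall>x y. \<xi> (x * y) = \<xi> x * \<xi> y"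
    "\<forall>x. \<xi> (star x) = star (\<xi> x)" "\<forall>g. \<xi> (gens g) = ?\<delta> g"
    unfolding Uq2_cstar_def using universal_cstar_property[of "Uq2_relators q" gens ?\<delta>] by blast
  moreover from this(5) have "\<xi> a = cis \<theta>" "\<xi> b = 0" "\<xi> D = cis \<phi>"
    by (metis Uq2_gen.case)+
  ultimately show thesis by (intro that[of \<xi>]) (simp_all add: star_complex_def)
qed

end

section \<open>Unitarity and the Clebsch-Gordan relations\<close>

context uq2
begin

text \<open>Extending the q-binomial coefficients for s = |q| ^ 2 by 0 frees the Pascal rule and the
  shifted sums of side conditions.\<close>

definition w :: "nat \<Rightarrow> nat \<Rightarrow> real"
  where "w n k = (if k \<le> n then q_binom s n k else 0)"

lemma q_poch_pos: "0 < q_poch s s n"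
  unfolding q_poch_def
proof (rule prod_pos)
  fix r
  have "s * s ^ r < 1" using s_pos s_less by (metis power_Suc power_Suc_less_one)
  then show "0 < 1 - s * s ^ r" by simp
qed

lemma w_pos: "k \<le> n \<Longrightarrow> 0 < w n k"
  by (simp add: w_def q_binom_def q_poch_pos)

lemma w_0: "w n 0 = 1"
  using q_poch_pos[of n] by (simp add: w_def q_binom_def) (simp add: q_poch_def)

lemma w_zero: "n < k \<Longrightarrow> w n k = 0"
  by (simp add: w_def)

text \<open>For k < n and over a common denominator this is the identity 1 - s ^ (n + 1) = s ^ (k +
  1) (1 - s ^ (n - k)) + (1 - s ^ (k + 1)).\<close>

lemma w_Pascal: "w (Suc n) (Suc k) = s ^ Suc k * w n (Suc k) + w n k"
proof -
  let ?P = "q_poch s s"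
  have P: "?P (Suc m) = ?P m * (1 - s ^ Suc m)" for m
    by (simp add: q_poch_def)
  have nz: "?P m \<noteq> 0" for m using q_poch_pos[of m] by simp
  then have nz': "1 - s ^ Suc m \<noteq> 0" for m using P[of m] by (metis mult_zero_right)
  consider "n < k" | "k = n" | "k < n" by linarith
  then show ?thesis
  proof cases
    case 2
    then show ?thesis using nz[of 0] nz by (simp add: w_def q_binom_def)
  next
    case 3
    then obtain m where n: "n = Suc (k + m)" by (metis less_natE)
    have "w (Suc n) (Suc k) = ?P n * (1 - s ^ Suc n) / (?P k * (1 - s ^ Suc k) * (?P m * (1 - s ^ Suc m)))"
      by (simp add: w_def q_binom_def n P)
    moreover have "w n (Suc k) = ?P n * (1 - s ^ Suc m) / (?P k * (1 - s ^ Suc k) * (?P m * (1 - s ^ Suc m)))"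
      using nz'[of m] by (simp add: w_def q_binom_def n P)
    moreover have "w n k = ?P n * (1 - s ^ Suc k) / (?P k * (1 - s ^ Suc k) * (?P m * (1 - s ^ Suc m)))"
      using nz'[of k] by (simp add: w_def q_binom_def n P)
    moreover have "1 - s ^ Suc n = s ^ Suc k * (1 - s ^ Suc m) + (1 - s ^ Suc k)"
      by (simp add: n algebra_simps power_add)
    ultimately show ?thesis
      by (simp only: times_divide_eq_right add_divide_distrib[symmetric]) (simp only: algebra_simps)
  qed (simp add: w_def)
qed

lemma w_rec: "w (Suc n) k = s ^ k * w n k + (case k of 0 \<Rightarrow> 0 | Suc j \<Rightarrow> w n j)"
  by (cases k) (simp_all add: w_0 w_Pascal)

text \<open>Lowers a weighted sum from level n + 1 to level n. The two resulting terms correspond to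
  the two kinds of step, and this drives both unitarity inductions.\<close>

lemma w_sum:
  "(\<Sum>k\<le>Suc n. w (Suc n) k *\<^sub>C X k) = (\<Sum>k\<le>n. w n k *\<^sub>C (s ^ k *\<^sub>C X k + X (Suc k)))"
  for X :: "nat \<Rightarrow> 'a"
proof -
  have "(\<Sum>k\<le>Suc n. w (Suc n) k *\<^sub>C X k)
      = (\<Sum>k\<le>Suc n. (w n k * s ^ k) *\<^sub>C X k) + (\<Sum>k\<le>Suc n. (case k of 0 \<Rightarrow> 0 | Suc j \<Rightarrow> w n j) *\<^sub>C X k)"
    unfolding sum.distrib[symmetric] w_rec
    by (intro sum.cong refl) (simp add: scaleC_add_left[symmetric] mult.commute)
  also have "(\<Sum>k\<le>Suc n. (w n k * s ^ k) *\<^sub>C X k) = (\<Sum>k\<le>n. (w n k * s ^ k) *\<^sub>C X k)"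
    by (simp add: w_zero)
  also have "(\<Sum>k\<le>Suc n. (case k of 0 \<Rightarrow> 0 | Suc j \<Rightarrow> w n j) *\<^sub>C X k) = (\<Sum>k\<le>n. w n k *\<^sub>C X (Suc k))"
    by (subst sum.atMost_Suc_shift) simp
  finally show ?thesis by (simp add: sum.distrib scaleC_add_right scaleC_scaleC)
qed

lemma cpow_a: "c ^ i * a = cnj q ^ i *\<^sub>C (a * c ^ i)"
proof (induction i)
  case (Suc i)
  have "c ^ Suc i * a = c ^ i * (c * a)" by (simp only: power_Suc2 mult.assoc)
  also have "\<dots> = cnj q *\<^sub>C (c ^ i * a * c)" by (simp add: ca scaleC_simps mult.assoc)
  also have "\<dots> = cnj q ^ Suc i *\<^sub>C (a * c ^ Suc i)"
    unfolding Suc by (simp add: scaleC_simps mult.assoc power_Suc2[of c] del: power_Suc) simp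
  finally show ?case .
qed (simp add: scaleC_one)

lemma g_a: "i \<le> n \<Longrightarrow> g n i * a = cnj q ^ i *\<^sub>C g (Suc n) i"
  by (simp add: g_def mult.assoc cpow_a scaleC_simps Suc_diff_le power_Suc2[of a] del: power_Suc)

lemma g_c: "g n i * c = g (Suc n) (Suc i)"
  by (simp add: g_def mult.assoc power_commutes)

lemma g_in_A [simp, intro]: "g n i \<in> A"
  by (auto simp: g_def)

text \<open>Moving \<open>a\<close> past c ^ i contributes cnj q ^ i and the step contributes q ^ i.
  Together they are s ^ i, so the scalars obey the Pascal rule.\<close>

lemma tau_0_eq_g: "tau n 0 i = w n i *\<^sub>C g n i"
proof (induction n arbitrary: i)
  case 0
  then show ?case by (cases i) (simp_all add: tau_def w_0 w_zero g_def scaleC_one)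
next
  case (Suc n)
  show ?case
  proof (cases i)
    case 0
    then show ?thesis
      using Suc[of 0] g_a[of 0 n] by (simp add: tau_Suc_0 step_0 w_0 scaleC_one)
  next
    case (Suc j)
    have "w n i *\<^sub>C (g n i * a) = (w n i * cnj q ^ i) *\<^sub>C g (Suc n) i"
      by (cases "i \<le> n") (simp_all add: g_a scaleC_simps w_zero)
    then have "tau (Suc n) 0 i = (q ^ i * (w n i * cnj q ^ i) + w n j) *\<^sub>C g (Suc n) i"
      using Suc.IH[of i] Suc.IH[of j]
      by (simp add: tau_Suc_0 Suc step_Suc scaleC_simps scaleC_add_left g_c del: power_Suc)
    also have "q ^ i * (w n i * cnj q ^ i) + w n j = w (Suc n) i"
      unfolding w_rec[of n i] of_real_add of_real_mult of_real_power s_eq power_mult_distrib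
      by (simp add: Suc mult_ac)
    finally show ?thesis .
  qed
qed

text \<open>The factor \<open>u\<close>, taken to be \<open>D\<close> in \<open>tau_lower\<close>,
  is undone by composing the dual functionals with right multiplication by
  \<open>u'\<close>.\<close>

lemma tensor_f_eq:
  assumes "(\<Sum>i\<le>n. (f n i * u) \<otimes> x i) = (\<Sum>i\<le>n. (f n i * u) \<otimes> y i)" "u * u' = 1" "i \<le> n"
  shows "x i = y i"
proof -
  obtain \<phi> where \<phi>: "\<And>i. linear_on UNIV (\<phi> i)"
    "\<And>i j. i \<in> {..n} \<Longrightarrow> j \<in> {..n} \<Longrightarrow> \<phi> i (f n j) = (if i = j then 1 else 0 :: complex)"
    using dual_functionals[of "{..n}" "f n"] independent_f by auto
  show ?thesis
  proof (rule tensor_coeff_right[OF _ _ _ _ assms(1)])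
    show "linear_on UNIV (\<lambda>z. \<phi> i (z * u'))"
      using \<phi>(1)[of i] by (simp add: linear_on_def distrib_right mult_scaleC_left)
  qed (use assms \<phi>(2) in \<open>auto simp: mult.assoc\<close>)
qed

lemma tensor_g_eq:
  assumes "(\<Sum>i\<le>n. x i \<otimes> g n i) = (\<Sum>i\<le>n. y i \<otimes> g n i)" "i \<le> n"
  shows "x i = y i"
proof -
  obtain \<phi> where \<phi>: "\<And>i. linear_on UNIV (\<phi> i)"
    "\<And>i j. i \<in> {..n} \<Longrightarrow> j \<in> {..n} \<Longrightarrow> \<phi> i (g n j) = (if i = j then 1 else 0 :: complex)"
    using dual_functionals[of "{..n}" "g n"] independent_g by auto
  show ?thesis
    by (rule tensor_coeff_left[OF _ _ \<phi>(1)[of i] _ assms(1)]) (use assms \<phi>(2) in auto)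
qed

text \<open>The coefficient matrix of the left comodule spanned by the \<open>g n i\<close>. The
  quotient of weights comes from passing between \<open>g\<close> and the first column of
  \<open>tau\<close> by \<open>tau_0_eq_g\<close>.\<close>

definition sig :: "nat \<Rightarrow> nat \<Rightarrow> nat \<Rightarrow> 'a"
  where "sig n i j = (w n j / w n i) *\<^sub>C tau n j i"

lemma sig_zero: "n < j \<Longrightarrow> sig n i j = 0"
  by (simp add: sig_def w_zero)

lemma Delta_g: "i \<le> n \<Longrightarrow> \<Delta> (g n i) = (\<Sum>j\<le>n. sig n i j \<otimes> g n j)"
proof -
  assume i: "i \<le> n"
  have wn: "complex_of_real (w n i) \<noteq> 0" using w_pos[OF i] by simp
  have "\<Delta> (tau n 0 i) = (\<Sum>r\<le>n. tau n r i \<otimes> tau n 0 r)" by (rule Delta_tau) simp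
  then have "w n i *\<^sub>C \<Delta> (g n i) = (\<Sum>r\<le>n. tau n r i \<otimes> (w n r *\<^sub>C g n r))"
    by (simp add: tau_0_eq_g linear_onD(2)[OF Delta_linear])
  then have "(1 / w n i) *\<^sub>C w n i *\<^sub>C \<Delta> (g n i) = (\<Sum>r\<le>n. sig n i r \<otimes> g n r)"
    by (simp add: cvec.scale_sum_right sig_def tensor_scale_left tensor_scale_right scaleC_scaleC)
  then show ?thesis using wn by (simp add: scaleC_scaleC scaleC_one)
qed

text \<open>The transposed counterpart of \<open>step\<close>: for x with coproduct x \<otimes> a +
  y \<otimes> c it gives the coefficients of \<open>g n i * x\<close> along the
  \<open>g (Suc n) j\<close>. The power of cnj q comes from moving \<open>a\<close> past c ^
  j.\<close>

definition rstep :: "'a \<Rightarrow> 'a \<Rightarrow> (nat \<Rightarrow> 'a) \<Rightarrow> nat \<Rightarrow> 'a"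
  where "rstep x y v j = cnj q ^ j *\<^sub>C (v j * x) + (case j of 0 \<Rightarrow> 0 | Suc k \<Rightarrow> v k * y)"

lemma Delta_g_mult:
  assumes i: "i \<le> n" and x: "\<Delta> x = x \<otimes> a + y \<otimes> c" "x \<in> A"
  shows "\<Delta> (g n i * x) = (\<Sum>j\<le>Suc n. rstep x y (sig n i) j \<otimes> g (Suc n) j)"
proof -
  have "\<Delta> (g n i * x) = (\<Sum>j\<le>n. (sig n i j * x) \<otimes> (g n j * a)) + (\<Sum>j\<le>n. (sig n i j * y) \<otimes> (g n j * c))"
    by (simp add: Delta_mult assms Delta_g tensor_mult_sum_left tensor_mult_add_right
        tensor_mult_elem_elem sum.distrib)
  also have "(\<Sum>j\<le>n. (sig n i j * x) \<otimes> (g n j * a)) = (\<Sum>j\<le>n. (cnj q ^ j *\<^sub>C (sig n i j * x)) \<otimes> g (Suc n) j)"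
    by (rule sum.cong) (simp_all add: g_a tensor_scale_left tensor_scale_right)
  also have "\<dots> = (\<Sum>j\<le>Suc n. (cnj q ^ j *\<^sub>C (sig n i j * x)) \<otimes> g (Suc n) j)"
    by (simp add: sig_zero tensor_zero_left)
  also have "(\<Sum>j\<le>n. (sig n i j * y) \<otimes> (g n j * c))
      = (\<Sum>j\<le>Suc n. (case j of 0 \<Rightarrow> 0 | Suc k \<Rightarrow> sig n i k * y) \<otimes> g (Suc n) j)"
    by (subst sum.atMost_Suc_shift) (simp add: g_c tensor_zero_left)
  finally show ?thesis
    by (simp only: sum.distrib[symmetric] tensor_add_left[symmetric] rstep_def)
qed

text \<open>The coproduct of \<open>g n i * a\<close> is expanded once as a product and once through
  \<open>g_a\<close>; the independent elements \<open>g (Suc n) j\<close> allow a comparison. The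
  next lemma does the same with \<open>c\<close>.\<close>

lemma rstep_sig_ab:
  assumes "i \<le> n" "j \<le> Suc n"
  shows "rstep a b (sig n i) j = cnj q ^ i *\<^sub>C sig (Suc n) i j"
proof (rule tensor_g_eq[OF _ assms(2)])
  have "\<Delta> (g n i * a) = \<Delta> (cnj q ^ i *\<^sub>C g (Suc n) i)" using assms by (simp add: g_a)
  also have "\<dots> = (\<Sum>j\<le>Suc n. (cnj q ^ i *\<^sub>C sig (Suc n) i j) \<otimes> g (Suc n) j)"
    using assms by (simp add: linear_onD(2)[OF Delta_linear] Delta_g cvec.scale_sum_right tensor_scale_left
        scaleC_add_right del: sum.atMost_Suc)
  finally show "(\<Sum>j\<le>Suc n. rstep a b (sig n i) j \<otimes> g (Suc n) j) = (\<Sum>j\<le>Suc n. (cnj q ^ i *\<^sub>C sig (Suc n) i j) \<otimes> g (Suc n) j)"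
    using assms by (simp only: Delta_g_mult[OF _ Delta_a A_closed(2)])
qed

lemma rstep_sig_cd:
  assumes "i \<le> n" "j \<le> Suc n"
  shows "rstep c d (sig n i) j = sig (Suc n) (Suc i) j"
proof (rule tensor_g_eq[OF _ assms(2)])
  have "\<Delta> (g n i * c) = (\<Sum>j\<le>Suc n. sig (Suc n) (Suc i) j \<otimes> g (Suc n) j)"
    using assms by (simp add: g_c Delta_g del: sum.atMost_Suc)
  then show "(\<Sum>j\<le>Suc n. rstep c d (sig n i) j \<otimes> g (Suc n) j) = (\<Sum>j\<le>Suc n. sig (Suc n) (Suc i) j \<otimes> g (Suc n) j)"
    using assms by (simp only: Delta_g_mult[OF _ Delta_c cd_in_A(1)])
qed

lemma row_bilinear:
  "(x * a + y * c) * star (x' * a + y' * c) + (x * b + y * d) * star (x' * b + y' * d)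
    = x * star x' + y * star y'"
proof -
  have "(x * a + y * c) * star (x' * a + y' * c) + (x * b + y * d) * star (x' * b + y' * d)
      = x * (a * star a + b * star b) * star x' + x * (a * star c + b * star d) * star y'
      + y * (c * star a + d * star b) * star x' + y * (c * star c + d * star d) * star y'"
    by (simp add: star_add star_mult distrib_left distrib_right mult.assoc add_ac)
  then show ?thesis by (simp add: row_a row_ac row_ca row_c)
qed

text \<open>After \<open>w_sum\<close> has paired the columns k and Suc k, the 2 by 2 row relations
  stand between the two entries of level n and apply term by term. The factors q ^ k from
  \<open>step_tau\<close> account for s ^ k.\<close>

lemma row_unitary:
  "(\<Sum>k\<le>n. w n k *\<^sub>C (tau n k i * star (tau n k i'))) = (if i = i' then w n i else 0) *\<^sub>C 1"
proof (induction n arbitrary: i i')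
  case 0
  show ?case by (auto simp: tau_def w_0 w_zero scaleC_one star_one star_zero)
next
  case (Suc n)
  define p where "p v i = (case i of 0 \<Rightarrow> 0 | Suc j \<Rightarrow> v j)" for v :: "nat \<Rightarrow> 'a" and i :: nat
  have step: "step x y v i = (q ^ i *\<^sub>C v i) * x + p v i * y" for x y v i
    by (cases i) (simp_all add: step_def p_def mult_scaleC_left)
  let ?X = "\<lambda>k. tau (Suc n) k i * star (tau (Suc n) k i')"
  have "s ^ k *\<^sub>C ?X k + ?X (Suc k)
      = (q ^ i * cnj q ^ i') *\<^sub>C (tau n k i * star (tau n k i')) + p (tau n k) i * star (p (tau n k) i')"
    if k: "k \<le> n" for k
  proof -
    have "s ^ k *\<^sub>C ?X k = step a c (tau n k) i * star (step a c (tau n k) i')"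
      using k by (simp add: step_tau star_scaleC scaleC_simps s_eq power_mult_distrib mult.commute)
    moreover have "?X (Suc k) = step b d (tau n k) i * star (step b d (tau n k) i')"
      by (simp add: tau_Suc_Suc)
    ultimately show ?thesis
      by (simp only: step row_bilinear) (simp add: star_scaleC scaleC_simps mult.commute)
  qed
  then have "(\<Sum>k\<le>Suc n. w (Suc n) k *\<^sub>C ?X k)
      = (\<Sum>k\<le>n. w n k *\<^sub>C ((q ^ i * cnj q ^ i') *\<^sub>C (tau n k i * star (tau n k i')) + p (tau n k) i * star (p (tau n k) i')))"
    unfolding w_sum by (intro sum.cong) simp_all
  also have "\<dots> = (q ^ i * cnj q ^ i') *\<^sub>C (\<Sum>k\<le>n. w n k *\<^sub>C (tau n k i * star (tau n k i')))
      + (\<Sum>k\<le>n. w n k *\<^sub>C (p (tau n k) i * star (p (tau n k) i')))"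
    by (simp add: scaleC_add_right sum.distrib cvec.scale_sum_right scaleC_scaleC mult.commute)
  also have "(\<Sum>k\<le>n. w n k *\<^sub>C (p (tau n k) i * star (p (tau n k) i')))
      = (if i = i' then (case i of 0 \<Rightarrow> 0 | Suc j \<Rightarrow> w n j) else 0) *\<^sub>C 1"
    by (cases i; cases i') (simp_all add: p_def Suc.IH star_zero)
  finally show ?case
    unfolding Suc.IH w_rec[of n i]
    by (auto simp: scaleC_scaleC scaleC_add_left s_eq power_mult_distrib mult_ac)
qed

text \<open>In contrast to the rows, the products of level n now stand between an adjoint and a
  generator. They are summed first: the induction hypothesis makes the sums scalar, so that they can
  be pulled out before the 2 by 2 relations are used.\<close>

lemma column_unitary:
  "(\<Sum>i\<le>n. w n i *\<^sub>C (star (sig n i j) * sig n i j')) = (if j = j' then w n j else 0) *\<^sub>C 1"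
proof (induction n arbitrary: j j')
  case 0
  show ?case
    by (cases j; cases j') (simp_all add: sig_def tau_def w_0 w_zero scaleC_one star_one star_zero)
next
  case (Suc n)
  define p where "p v i = (case i of 0 \<Rightarrow> 0 | Suc j \<Rightarrow> v j)" for v :: "nat \<Rightarrow> 'a" and i :: nat
  have step: "rstep x y v i = (cnj q ^ i *\<^sub>C v i) * x + p v i * y" for x y v i
    by (cases i) (simp_all add: rstep_def p_def mult_scaleC_left)
  define W where "W x y = (\<Sum>i\<le>n. w n i *\<^sub>C (star (x i) * y i))" for x y :: "nat \<Rightarrow> 'a"
  have W: "(\<Sum>i\<le>n. w n i *\<^sub>C (z * (star (x i) * y i) * z')) = z * W x y * z'" for x y z z'
    by (simp add: W_def sum_distrib_left sum_distrib_right scaleC_simps)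
  \<comment> \<open>The mixed sums need only be scalar; they multiply the left-hand sides of
    \<open>col_ab\<close> and \<open>col_ba\<close>, which vanish.\<close>
  have main: "(\<Sum>i\<le>n. w n i *\<^sub>C (star (x i * a + y i * b) * (x' i * a + y' i * b)
        + star (x i * c + y i * d) * (x' i * c + y' i * d))) = r *\<^sub>C 1 + t *\<^sub>C 1"
    if "W x x' = r *\<^sub>C 1" "W y y' = t *\<^sub>C 1" "W x y' = u *\<^sub>C 1" "W y x' = v *\<^sub>C 1"
    for x y x' y' r t u v
  proof -
    have "w n i *\<^sub>C (star (x i * a + y i * b) * (x' i * a + y' i * b)
        + star (x i * c + y i * d) * (x' i * c + y' i * d))
      = w n i *\<^sub>C (star a * (star (x i) * x' i) * a) + w n i *\<^sub>C (star a * (star (x i) * y' i) * b)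
      + w n i *\<^sub>C (star b * (star (y i) * x' i) * a) + w n i *\<^sub>C (star b * (star (y i) * y' i) * b)
      + w n i *\<^sub>C (star c * (star (x i) * x' i) * c) + w n i *\<^sub>C (star c * (star (x i) * y' i) * d)
      + w n i *\<^sub>C (star d * (star (y i) * x' i) * c) + w n i *\<^sub>C (star d * (star (y i) * y' i) * d)" for i
      by (simp add: star_add star_mult distrib_left distrib_right mult.assoc scaleC_add_right add_ac)
    then have "(\<Sum>i\<le>n. w n i *\<^sub>C (star (x i * a + y i * b) * (x' i * a + y' i * b)
        + star (x i * c + y i * d) * (x' i * c + y' i * d)))
      = r *\<^sub>C (star a * a + star c * c) + u *\<^sub>C (star a * b + star c * d)
      + v *\<^sub>C (star b * a + star d * c) + t *\<^sub>C (star b * b + star d * d)"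
      by (simp only: sum.distrib W that) (simp add: scaleC_simps scaleC_add_right add_ac)
    then show ?thesis by (simp add: col_a col_ab col_ba col_b)
  qed
  let ?X = "\<lambda>k. star (sig (Suc n) k j) * sig (Suc n) k j'"
  show ?case
  proof (cases "j \<le> Suc n \<and> j' \<le> Suc n")
    case False
    then show ?thesis by (auto simp: sig_zero star_zero w_zero)
  next
    case True
    have "s ^ i *\<^sub>C ?X i + ?X (Suc i)
        = star (rstep a b (sig n i) j) * rstep a b (sig n i) j' + star (rstep c d (sig n i) j) * rstep c d (sig n i) j'"
      if i: "i \<le> n" for i
      using i True by (simp add: rstep_sig_ab rstep_sig_cd star_scaleC scaleC_simps s_eq power_mult_distrib mult.commute)
    then have "(\<Sum>k\<le>Suc n. w (Suc n) k *\<^sub>C ?X k)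
        = (\<Sum>i\<le>n. w n i *\<^sub>C (star (rstep a b (sig n i) j) * rstep a b (sig n i) j' + star (rstep c d (sig n i) j) * rstep c d (sig n i) j'))"
      unfolding w_sum by (intro sum.cong) simp_all
    also have "\<dots> = (q ^ j * (cnj q ^ j' * (if j = j' then w n j else 0))) *\<^sub>C 1
        + (case j of 0 \<Rightarrow> 0 | Suc m \<Rightarrow> case j' of 0 \<Rightarrow> 0 | Suc m' \<Rightarrow> if m = m' then w n m else 0) *\<^sub>C 1"
      unfolding step
    proof (rule main)
      have IH: "W (\<lambda>i. sig n i k) (\<lambda>i. sig n i k') = (if k = k' then w n k else 0) *\<^sub>C 1" for k k'
        unfolding W_def by (rule Suc.IH)
      have W0: "W (\<lambda>_. 0) x = 0 *\<^sub>C 1" "W x (\<lambda>_. 0) = 0 *\<^sub>C 1" for x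
        by (simp_all add: W_def star_zero)
      have W1: "W (\<lambda>i. r *\<^sub>C x i) y = cnj r *\<^sub>C W x y" "W x (\<lambda>i. r *\<^sub>C y i) = r *\<^sub>C W x y" for r x y
        by (simp_all add: W_def star_scaleC scaleC_simps cvec.scale_sum_right mult.commute)
      show "W (\<lambda>i. cnj q ^ j *\<^sub>C sig n i j) (\<lambda>i. cnj q ^ j' *\<^sub>C sig n i j') =
          (q ^ j * (cnj q ^ j' * (if j = j' then w n j else 0))) *\<^sub>C 1"
        by (simp only: W1 IH scaleC_scaleC) simp
      show "W (\<lambda>i. p (sig n i) j) (\<lambda>i. p (sig n i) j') =
          (case j of 0 \<Rightarrow> 0 | Suc m \<Rightarrow> case j' of 0 \<Rightarrow> 0 | Suc m' \<Rightarrow> if m = m' then w n m else 0) *\<^sub>C 1"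
        by (cases j; cases j') (simp_all only: p_def nat.case IH W0, simp_all)
      show "W (\<lambda>i. cnj q ^ j *\<^sub>C sig n i j) (\<lambda>i. p (sig n i) j') =
          (case j' of 0 \<Rightarrow> 0 | Suc m \<Rightarrow> q ^ j * (if j = m then w n j else 0)) *\<^sub>C 1"
        by (cases j') (simp_all only: p_def nat.case IH W0 W1 scaleC_scaleC, simp_all)
      show "W (\<lambda>i. p (sig n i) j) (\<lambda>i. cnj q ^ j' *\<^sub>C sig n i j') =
          (case j of 0 \<Rightarrow> 0 | Suc m \<Rightarrow> cnj q ^ j' * (if m = j' then w n m else 0)) *\<^sub>C 1"
        by (cases j) (simp_all only: p_def nat.case IH W0 W1 scaleC_scaleC of_real_mult of_real_power mult_zero_left mult_zero_right of_real_0)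
    qed
    also have "\<dots> = (if j = j' then w (Suc n) j else 0) *\<^sub>C 1"
      unfolding w_rec[of n j]
      by (cases j; cases j') (auto simp: scaleC_add_left[symmetric] s_eq power_mult_distrib mult_ac)
    finally show ?thesis .
  qed
qed

text \<open>For k = m = 0 this reads a d - (1 / q) b c = D, so \<open>D\<close> is the quantum
  determinant. The general case moves b ^ k past \<open>D\<close> and \<open>star a\<close>; the
  resulting powers of q combine to a common factor of \<open>rel_aa'\<close>.\<close>

lemma f_quantum_det:
  "f (Suc m) (Suc k) * c - q ^ Suc k *\<^sub>C (f (Suc m) k * d) = (- q) *\<^sub>C (f m k * D)" if "k \<le> m"
proof -
  have bD: "b ^ i * D = ((q / cnj q) ^ i) *\<^sub>C (D * b ^ i)" for i
  proof (induction i)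
    case (Suc i)
    have "b ^ Suc i * D = b ^ i * (b * D)" by (simp only: power_Suc2 mult.assoc)
    also have "\<dots> = (q / cnj q) *\<^sub>C (b ^ i * D * b)" by (simp add: rel_bD scaleC_simps mult.assoc)
    finally show ?case
      unfolding Suc by (simp add: scaleC_simps mult.assoc power_Suc2[of b] del: power_Suc) simp
  qed (simp add: scaleC_one)
  have ba': "b ^ i * star a = ((1 / q) ^ i) *\<^sub>C (star a * b ^ i)" for i
  proof (induction i)
    case (Suc i)
    have "b ^ Suc i * star a = b ^ i * (b * star a)" by (simp only: power_Suc2 mult.assoc)
    also have "\<dots> = (1 / q) *\<^sub>C (b ^ i * star a * b)" by (simp only: nf_ba' scaleC_simps mult.assoc)
    finally show ?case
      unfolding Suc by (simp add: scaleC_simps mult.assoc power_Suc2[of b] del: power_Suc) simp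
  qed (simp add: scaleC_one)
  have bb': "b ^ i * star b = star b * b ^ i" for i
    by (induction i) (simp_all add: mult.assoc, metis mult.assoc rel_bb')
  have exp: "a ^ (Suc m - k) = a ^ (m - k) * a"
    using that by (simp add: Suc_diff_le power_Suc2 del: power_Suc)
  have 1: "b ^ Suc k * (D * star b) = (q / cnj q) ^ Suc k *\<^sub>C (D * (star b * b * b ^ k))"
    by (simp only: mult.assoc[symmetric] bD mult_scaleC_left)
       (simp add: mult.assoc bb' rel_bb', metis bb' mult.assoc rel_bb')
  have 2: "a * (b ^ k * (D * star a)) = ((q / cnj q) ^ k * (1 / q) ^ k) *\<^sub>C (D * (a * star a * b ^ k))"
    by (simp only: mult.assoc[symmetric] bD mult_scaleC_left)
       (simp add: mult.assoc ba' scaleC_simps, metis rel_aD mult.assoc)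
  have "f (Suc m) (Suc k) * c - q ^ Suc k *\<^sub>C (f (Suc m) k * d)
      = a ^ (m - k) * (- cnj q *\<^sub>C (b ^ Suc k * (D * star b)) - q ^ Suc k *\<^sub>C (a * (b ^ k * (D * star a))))"
    by (simp add: f_def c_def d_def exp mult.assoc scaleC_simps right_diff_distrib)
  also have "\<dots> = a ^ (m - k) * ((- (q * (q / cnj q) ^ k)) *\<^sub>C (D * (star b * b * b ^ k))
      - (q * (q / cnj q) ^ k) *\<^sub>C (D * (a * star a * b ^ k)))"
    unfolding 1 2 by (simp add: scaleC_simps power_divide)
  also have "\<dots> = (- (q * (q / cnj q) ^ k)) *\<^sub>C (a ^ (m - k) * (D * ((star b * b + a * star a) * b ^ k)))"
    by (simp add: scaleC_simps distrib_left distrib_right right_diff_distrib cvec.scale_right_distrib)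
  also have "star b * b + a * star a = 1" using rel_aa' by (simp add: rel_bb' add.commute)
  finally show ?thesis
    by (simp add: f_def mult.assoc bD scaleC_simps)
qed

text \<open>The coefficient form of
  \<open>f n (Suc k) * a = q ^ Suc k *\<^sub>C (f n k * b)\<close>. It ties the combination with c,
  d at i - 1 to the one with a, b at i.\<close>

lemma kernel_step:
  assumes "Suc k \<le> n"
  shows "q ^ i *\<^sub>C (tau n (Suc k) i * a - q ^ Suc k *\<^sub>C (tau n k i * b))
    + (case i of 0 \<Rightarrow> 0 | Suc j \<Rightarrow> tau n (Suc k) j * c - q ^ Suc k *\<^sub>C (tau n k j * d)) = 0"
proof -
  have "step a c (tau n (Suc k)) i = q ^ Suc k *\<^sub>C step b d (tau n k) i"
    using assms by (simp add: step_tau tau_Suc_Suc)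
  then have "step a c (tau n (Suc k)) i - q ^ Suc k *\<^sub>C step b d (tau n k) i = 0" by simp
  then show ?thesis
    by (cases i) (simp_all add: step_def scaleC_simps cvec.scale_right_diff_distrib scaleC_add_right
        mult.commute algebra_simps)
qed

lemma tau_lower_0: "Suc k \<le> n \<Longrightarrow> tau n (Suc k) 0 * a - q ^ Suc k *\<^sub>C (tau n k 0 * b) = 0"
  using kernel_step[of k n 0] by (simp add: scaleC_one)

lemma tau_lower_cd:
  assumes "Suc k \<le> n"
  shows "tau n (Suc k) i * c - q ^ Suc k *\<^sub>C (tau n k i * d)
    = - (q ^ Suc i *\<^sub>C (tau n (Suc k) (Suc i) * a - q ^ Suc k *\<^sub>C (tau n k (Suc i) * b)))"
  using kernel_step[OF assms, of "Suc i"] by (simp add: eq_neg_iff_add_eq_0 add.commute)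

text \<open>Applying \<open>\<Delta>\<close> to \<open>f_quantum_det\<close> gives left legs ending
  in \<open>c\<close> and in \<open>d\<close>. Since \<open>tau_lower_cd\<close> expresses Y i by X
  (Suc i), the terms regroup into \<open>f_quantum_det\<close> with X (Suc i) at
  \<open>f m i * D\<close>. The coefficients are then compared with the coproduct of
  \<open>f m k * D\<close>.\<close>

lemma tau_lower:
  assumes k: "k \<le> m" and i: "i \<le> m"
  shows "tau (Suc m) (Suc k) (Suc i) * a - q ^ Suc k *\<^sub>C (tau (Suc m) k (Suc i) * b) = tau m k i * D"
proof -
  define X where "X i = tau (Suc m) (Suc k) i * a - q ^ Suc k *\<^sub>C (tau (Suc m) k i * b)" for i
  define Y where "Y i = tau (Suc m) (Suc k) i * c - q ^ Suc k *\<^sub>C (tau (Suc m) k i * d)" for i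
  \<comment> \<open>The terms X 0 and X (Suc (Suc m)) vanish, so after the shift both sums run over
    i \<le> m.\<close>
  have X0: "X 0 = 0" using tau_lower_0[of k "Suc m"] k by (simp add: X_def)
  have Y: "Y i = - (q ^ Suc i *\<^sub>C X (Suc i))" for i
    using tau_lower_cd[of k "Suc m" i] k by (simp add: X_def Y_def)
  have XS: "X (Suc (Suc m)) = 0" using k by (simp add: X_def tau_zero)
  have D: "\<Delta> (f (Suc m) j * x) = (\<Sum>i\<le>Suc m. (f (Suc m) i * c) \<otimes> (tau (Suc m) j i * u) + (f (Suc m) i * d) \<otimes> (tau (Suc m) j i * v))"
    if "\<Delta> x = c \<otimes> u + d \<otimes> v" "x \<in> A" "j \<le> Suc m" for j x u v
    using that by (simp add: Delta_mult Delta_f tensor_mult_sum_left tensor_mult_add_right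
        tensor_mult_elem_elem sum.distrib del: sum.atMost_Suc)
  have "\<Delta> (f (Suc m) (Suc k) * c - q ^ Suc k *\<^sub>C (f (Suc m) k * d))
      = \<Delta> (f (Suc m) (Suc k) * c) - q ^ Suc k *\<^sub>C \<Delta> (f (Suc m) k * d)"
    by (simp add: linear_on_diff[OF Delta_linear A_subspace] linear_onD(2)[OF Delta_linear] del: power_Suc)
  also have "\<dots> = (\<Sum>i\<le>Suc m. (f (Suc m) i * c) \<otimes> X i + (f (Suc m) i * d) \<otimes> Y i)"
    using k unfolding D[OF Delta_c cd_in_A(1) Suc_le_mono[THEN iffD2, OF k]] D[OF Delta_d cd_in_A(2) le_SucI[OF k]]
      cvec.scale_sum_right sum_subtractf[symmetric]
    by (intro sum.cong refl) (simp only: X_def Y_def tensor_diff_right tensor_scale_right scaleC_add_right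
        add_diff_add)
  also have "\<dots> = (\<Sum>i\<le>Suc m. (f (Suc m) i * c) \<otimes> X i) - (\<Sum>i\<le>Suc m. (q ^ Suc i *\<^sub>C (f (Suc m) i * d)) \<otimes> X (Suc i))"
    unfolding sum_subtractf[symmetric]
    by (intro sum.cong refl) (simp only: Y tensor_minus_right tensor_scale_left tensor_scale_right diff_conv_add_uminus)
  also have "(\<Sum>i\<le>Suc m. (f (Suc m) i * c) \<otimes> X i) = (\<Sum>i\<le>m. (f (Suc m) (Suc i) * c) \<otimes> X (Suc i))"
    by (subst sum.atMost_Suc_shift) (simp add: X0 tensor_zero_right)
  also have "(\<Sum>i\<le>Suc m. (q ^ Suc i *\<^sub>C (f (Suc m) i * d)) \<otimes> X (Suc i)) = (\<Sum>i\<le>m. (q ^ Suc i *\<^sub>C (f (Suc m) i * d)) \<otimes> X (Suc i))"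
    by (simp add: XS tensor_zero_right)
  also have "(\<Sum>i\<le>m. (f (Suc m) (Suc i) * c) \<otimes> X (Suc i)) - (\<Sum>i\<le>m. (q ^ Suc i *\<^sub>C (f (Suc m) i * d)) \<otimes> X (Suc i))
      = (\<Sum>i\<le>m. (f m i * D) \<otimes> ((- q) *\<^sub>C X (Suc i)))"
    unfolding sum_subtractf[symmetric] tensor_diff_left[symmetric]
    by (intro sum.cong refl) (simp only: f_quantum_det atMost_iff tensor_scale_left tensor_scale_right)
  finally have 1: "\<Delta> (f (Suc m) (Suc k) * c - q ^ Suc k *\<^sub>C (f (Suc m) k * d)) = (\<Sum>i\<le>m. (f m i * D) \<otimes> ((- q) *\<^sub>C X (Suc i)))" .
  have 2: "\<Delta> ((- q) *\<^sub>C (f m k * D)) = (\<Sum>i\<le>m. (f m i * D) \<otimes> ((- q) *\<^sub>C (tau m k i * D)))"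
    using k by (simp add: linear_onD(2)[OF Delta_linear] linear_on_minus[OF Delta_linear] Delta_mult Delta_f Delta_D tensor_mult_sum_left
        tensor_mult_elem_elem cvec.scale_sum_right tensor_scale_right tensor_minus_right sum_negf)
  have "(- q) *\<^sub>C X (Suc i) = (- q) *\<^sub>C (tau m k i * D)"
    using 1[unfolded f_quantum_det[OF k] 2, symmetric] rel_DD' i by (rule tensor_f_eq)
  then show ?thesis by (simp add: X_def)
qed

end

section \<open>Spanning and orthogonality\<close>

context uq2
begin

section \<open>Integer powers of D\<close>

lemma upow_Suc: "upow D (m + 1) = upow D m * D"
proof (cases "0 \<le> m")
  case True
  then show ?thesis by (simp add: upow_def nat_add_distrib power_Suc2 del: power_Suc)
next
  case False
  define k where "k = nat (- m - 1)"
  have k: "m = - int (Suc k)" using False by (simp add: k_def)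
  have "upow D m * D = star D ^ k * (star D * D)"
    by (simp add: upow_def k power_Suc2 mult.assoc nat_add_distrib del: power_Suc)
  also have "\<dots> = upow D (m + 1)"
    by (cases k) (simp_all add: rel_D'D upow_def k nat_add_distrib)
  finally show ?thesis by simp
qed

lemma upow_pred: "upow D (m - 1) = upow D m * star D"
  using upow_Suc[of "m - 1"] by (simp add: mult.assoc rel_DD')

lemma upow_0: "upow D 0 = 1"
  by (simp add: upow_def)

lemma upow_add: "upow D (m + k) = upow D m * upow D k"
proof (induction k rule: int_induct[where k = 0])
  case (step1 k)
  then show ?case using upow_Suc[of "m + k"] by (simp add: upow_Suc mult.assoc add.assoc)
next
  case (step2 k)
  then show ?case using upow_pred[of "m + k"] by (simp add: upow_pred mult.assoc add_diff_eq)
qed (simp add: upow_0)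

lemma upow_inverse: "upow D m * upow D (- m) = 1" "upow D (- m) * upow D m = 1"
  by (simp_all add: upow_add[symmetric] upow_0)

lemma star_upow: "star (upow D m) = upow D (- m)"
  by (simp add: upow_def star_power star_star star_one)

lemma upow_in_A [simp, intro]: "upow D m \<in> A"
  by (simp add: upow_def)

lemma Delta_upow: "\<Delta> (upow D m) = upow D m \<otimes> upow D m"
proof -
  have "\<Delta> (x ^ k) = x ^ k \<otimes> x ^ k" if "x \<in> A" "\<Delta> x = x \<otimes> x" for x k
    using that by (induction k) (simp_all add: Delta_one Delta_mult tensor_mult_elem_elem)
  moreover have "\<Delta> (star D) = star D \<otimes> star D"
    by (simp add: Delta_star Delta_D tensor_star_elem)
  ultimately show ?thesis by (simp add: upow_def Delta_D)
qed

lemma upow_a: "upow D m * a = a * upow D m"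
proof -
  have "D ^ k * a = a * D ^ k" "star D ^ k * a = a * star D ^ k" for k
    by (induction k) (simp_all add: mult.assoc, metis mult.assoc rel_aD, metis mult.assoc nf_aD')
  then show ?thesis by (simp add: upow_def)
qed

lemma upow_b: "\<exists>r. upow D m * b = r *\<^sub>C (b * upow D m)"
proof -
  have 1: "D * b = (cnj q / q) *\<^sub>C (b * D)" "star D * b = (q / cnj q) *\<^sub>C (b * star D)"
    by (simp_all add: rel_bD nf_bD' scaleC_simps)
  have "\<exists>r. x ^ k * b = r *\<^sub>C (b * x ^ k)" if "x * b = t *\<^sub>C (b * x)" for x t k
  proof (induction k)
    case 0
    show ?case by (intro exI[of _ 1]) (simp add: scaleC_one)
  next
    case (Suc k)
    then obtain r where "x ^ k * b = r *\<^sub>C (b * x ^ k)" by blast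
    then have "x ^ Suc k * b = (t * r) *\<^sub>C (b * x ^ Suc k)"
      by (simp add: mult.assoc mult_scaleC_right) (simp add: mult.assoc[symmetric] that scaleC_simps mult.commute)
    then show ?case by blast
  qed
  from this[OF 1(1)] this[OF 1(2)] show ?thesis by (simp add: upow_def)
qed

text \<open>Spanning is shown for the unnormalized coefficients; \<open>span_U\<close> transfers it
  to the unitary matrices.\<close>

definition coeffs :: "'a set"
  where "coeffs = {tau n j i * upow D m |n i j m. i \<le> n \<and> j \<le> n}"

lemma span_mult_right:
  fixes x y :: 'a
  assumes "\<And>z. z \<in> B \<Longrightarrow> z * y \<in> cspan C" "x \<in> cspan B"
  shows "x * y \<in> cspan C"
  using assms(2)
proof (induction rule: cvec.span_induct)
  case (step x)
  then show ?case by (rule assms(1))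
next
  case base
  show ?case
    by (auto simp: cvec.subspace_def distrib_right mult_scaleC_left cvec.span_zero
        intro: cvec.span_add cvec.span_scale)
qed

lemma coeffs_upow: "x \<in> cspan coeffs \<Longrightarrow> x * upow D k \<in> cspan coeffs"
proof (rule span_mult_right)
  fix z assume "z \<in> coeffs"
  then obtain n i j m where "z = tau n j i * upow D m" "i \<le> n" "j \<le> n" by (auto simp: coeffs_def)
  then have "z * upow D k \<in> coeffs"
    unfolding coeffs_def by (auto simp: mult.assoc upow_add[symmetric])
  then show "z * upow D k \<in> cspan coeffs" by (rule cvec.span_base)
qed

lemma tau_in_span: "i \<le> n \<Longrightarrow> j \<le> n \<Longrightarrow> tau n j i \<in> cspan coeffs"
  unfolding coeffs_def
  by (intro cvec.span_base CollectI exI[of _ n] exI[of _ i] exI[of _ j] exI[of _ 0]) (simp add: upow_0)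

lemma sig_in_span: "i \<le> n \<Longrightarrow> sig n i j \<in> cspan coeffs"
proof (cases "j \<le> n")
  case True
  then show "i \<le> n \<Longrightarrow> sig n i j \<in> cspan coeffs"
    unfolding sig_def by (intro cvec.span_scale tau_in_span)
qed (simp add: sig_zero cvec.span_zero)

text \<open>The products of \<open>tau n (Suc j) i\<close> with x and of \<open>tau n j i\<close>
  with y satisfy two linear conditions modulo the span, one from R and one from K. Eliminating the
  first product leaves the second with factor w (Suc n) (Suc j), by the Pascal rule. The products
  missed in this way, with x for j = 0 and with y for j = n, are the end terms of
  \<open>rstep\<close>, where a single summand survives.\<close>

lemma tau_mult_in_span:
  assumes K: "\<And>j. Suc j \<le> n \<Longrightarrow> tau n (Suc j) i * x - q ^ Suc j *\<^sub>C (tau n j i * y) \<in> cspan coeffs"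
    and R: "\<And>j. j \<le> Suc n \<Longrightarrow> rstep x y (sig n i) j \<in> cspan coeffs"
    and ij: "i \<le> n" "j \<le> n"
  shows "tau n j i * x \<in> cspan coeffs \<and> tau n j i * y \<in> cspan coeffs"
proof -
  let ?M = "cspan coeffs"
  note nz = w_pos[OF ij(1)]
  have scale: "r \<noteq> 0 \<Longrightarrow> r *\<^sub>C z \<in> ?M \<Longrightarrow> z \<in> ?M" for r z
    using cvec.span_scale[of "r *\<^sub>C z" coeffs "1 / r"] by (simp add: scaleC_scaleC scaleC_one)
  have step: "tau n (Suc j) i * x \<in> ?M \<and> tau n j i * y \<in> ?M" if j: "Suc j \<le> n" for j
  proof -
    let ?P = "tau n (Suc j) i * x" and ?Q = "tau n j i * y"
    have "w n i *\<^sub>C rstep x y (sig n i) (Suc j) \<in> ?M"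
      using R[of "Suc j"] j by (intro cvec.span_scale) simp
    moreover have "w n i *\<^sub>C rstep x y (sig n i) (Suc j)
        = (cnj q ^ Suc j * w n (Suc j)) *\<^sub>C ?P + w n j *\<^sub>C ?Q"
      using nz by (simp add: rstep_def sig_def scaleC_simps scaleC_add_right mult_ac)
    moreover have "(cnj q ^ Suc j * w n (Suc j)) *\<^sub>C (?P - q ^ Suc j *\<^sub>C ?Q) \<in> ?M"
      by (rule cvec.span_scale[OF K[OF j]])
    ultimately have "((cnj q ^ Suc j * w n (Suc j)) *\<^sub>C ?P + w n j *\<^sub>C ?Q)
        - (cnj q ^ Suc j * w n (Suc j)) *\<^sub>C (?P - q ^ Suc j *\<^sub>C ?Q) \<in> ?M"
      by (metis cvec.span_diff)
    also have "((cnj q ^ Suc j * w n (Suc j)) *\<^sub>C ?P + w n j *\<^sub>C ?Q)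
        - (cnj q ^ Suc j * w n (Suc j)) *\<^sub>C (?P - q ^ Suc j *\<^sub>C ?Q)
        = (w n j + cnj q ^ Suc j * w n (Suc j) * q ^ Suc j) *\<^sub>C ?Q"
      by (simp only: cvec.scale_right_diff_distrib scaleC_scaleC scaleC_add_left) simp
    also have "w n j + cnj q ^ Suc j * w n (Suc j) * q ^ Suc j = w (Suc n) (Suc j)"
      unfolding w_Pascal of_real_add of_real_mult of_real_power s_eq power_mult_distrib
      by (simp add: mult_ac)
    finally have Q: "?Q \<in> ?M"
      by (rule scale[rotated]) (use w_pos[of "Suc j" "Suc n"] j in simp)
    have "?P - q ^ Suc j *\<^sub>C ?Q + q ^ Suc j *\<^sub>C ?Q \<in> ?M"
      by (rule cvec.span_add[OF K[OF j] cvec.span_scale[OF Q]])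
    with Q show ?thesis by simp
  qed
  have "tau n j i * x \<in> ?M"
  proof (cases j)
    case 0
    have "(1 / w n i) *\<^sub>C (tau n 0 i * x) \<in> ?M"
      using R[of 0] by (simp add: rstep_def sig_def scaleC_simps w_0)
    then show ?thesis unfolding 0 by (rule scale[rotated]) (use nz in simp)
  next
    case (Suc k)
    with step ij show ?thesis by blast
  qed
  moreover have "tau n j i * y \<in> ?M"
  proof (cases "j = n")
    case True
    have "(w n n / w n i) *\<^sub>C (tau n n i * y) \<in> ?M"
      using R[of "Suc n"] by (simp add: rstep_def sig_zero) (simp add: sig_def scaleC_simps)
    then show ?thesis
      unfolding True by (rule scale[rotated]) (use nz w_pos[of n n] in simp)
  next
    case False
    with step ij show ?thesis by simp
  qed
  ultimately show ?thesis by blast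
qed

lemma tau_ab_in_span:
  assumes "i \<le> n" "j \<le> n"
  shows "tau n j i * a \<in> cspan coeffs \<and> tau n j i * b \<in> cspan coeffs"
proof (rule tau_mult_in_span[OF _ _ assms])
  fix j assume "Suc j \<le> n"
  then obtain m where n: "n = Suc m" "j \<le> m" by (cases n) auto
  show "tau n (Suc j) i * a - q ^ Suc j *\<^sub>C (tau n j i * b) \<in> cspan coeffs"
  proof (cases i)
    case 0
    show ?thesis unfolding 0 tau_lower_0[OF \<open>Suc j \<le> n\<close>] by (rule cvec.span_zero)
  next
    case (Suc k)
    then have "k \<le> m" using assms n by simp
    have "tau m j k * upow D 1 \<in> cspan coeffs"
      using n \<open>k \<le> m\<close> by (intro coeffs_upow tau_in_span)
    then show ?thesis
      unfolding n Suc tau_lower[OF n(2) \<open>k \<le> m\<close>] by (simp add: upow_def)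
  qed
next
  fix j assume "j \<le> Suc n"
  with assms show "rstep a b (sig n i) j \<in> cspan coeffs"
    by (simp add: rstep_sig_ab cvec.span_scale sig_in_span)
qed

text \<open>For K, \<open>tau_lower_cd\<close> passes from c, d at i to a, b at Suc i. For i = n
  that combination is 0, as \<open>tau\<close> vanishes beyond n; otherwise \<open>tau_lower\<close>
  applies.\<close>

lemma tau_cd_in_span:
  assumes "i \<le> n" "j \<le> n"
  shows "tau n j i * c \<in> cspan coeffs \<and> tau n j i * d \<in> cspan coeffs"
proof (rule tau_mult_in_span[OF _ _ assms])
  fix j assume j: "Suc j \<le> n"
  then obtain m where n: "n = Suc m" "j \<le> m" by (cases n) auto
  show "tau n (Suc j) i * c - q ^ Suc j *\<^sub>C (tau n j i * d) \<in> cspan coeffs"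
    unfolding tau_lower_cd[OF j]
  proof (rule cvec.span_neg, rule cvec.span_scale, cases "i = n")
    case True
    then show "tau n (Suc j) (Suc i) * a - q ^ Suc j *\<^sub>C (tau n j (Suc i) * b) \<in> cspan coeffs"
      using j by (simp add: tau_zero cvec.span_zero)
  next
    case False
    then have "i \<le> m" using assms n by simp
    have "tau m j i * upow D 1 \<in> cspan coeffs"
      using n \<open>i \<le> m\<close> by (intro coeffs_upow tau_in_span)
    then show "tau n (Suc j) (Suc i) * a - q ^ Suc j *\<^sub>C (tau n j (Suc i) * b) \<in> cspan coeffs"
      unfolding n tau_lower[OF n(2) \<open>i \<le> m\<close>] by (simp add: upow_def)
  qed
next
  fix j assume "j \<le> Suc n"
  with assms show "rstep c d (sig n i) j \<in> cspan coeffs"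
    by (simp add: rstep_sig_cd sig_in_span)
qed

text \<open>The power of \<open>D\<close> at the right end of a coefficient passes each factor up to
  a scalar, which reduces the claim to \<open>tau\<close>.\<close>

lemma coeffs_mult: "x \<in> cspan coeffs \<Longrightarrow> x * a \<in> cspan coeffs" "x \<in> cspan coeffs \<Longrightarrow> x * b \<in> cspan coeffs"
  "x \<in> cspan coeffs \<Longrightarrow> x * c \<in> cspan coeffs" "x \<in> cspan coeffs \<Longrightarrow> x * d \<in> cspan coeffs"
proof -
  have gen: "x * y \<in> cspan coeffs"
    if y: "\<And>n i j. i \<le> n \<Longrightarrow> j \<le> n \<Longrightarrow> tau n j i * y \<in> cspan coeffs"
      and comm: "\<And>m. \<exists>r. upow D m * y = r *\<^sub>C (y * upow D m)" and x: "x \<in> cspan coeffs" for x y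
    using x
  proof (rule span_mult_right[rotated])
    fix z assume "z \<in> coeffs"
    then obtain n i j m where z: "z = tau n j i * upow D m" "i \<le> n" "j \<le> n" by (auto simp: coeffs_def)
    obtain r where r: "upow D m * y = r *\<^sub>C (y * upow D m)" using comm by blast
    have "z * y = r *\<^sub>C (tau n j i * y * upow D m)" by (simp add: z mult.assoc r mult_scaleC_right)
    then show "z * y \<in> cspan coeffs"
      using z(2,3) y by (simp add: cvec.span_scale coeffs_upow)
  qed
  have comm_a: "\<exists>r. upow D m * a = r *\<^sub>C (a * upow D m)" for m
    by (intro exI[of _ 1]) (simp add: scaleC_one upow_a)
  have star: "\<exists>r. upow D m * (D * star y) = r *\<^sub>C (D * star y * upow D m)"
    if comm: "\<And>m. \<exists>r. upow D m * y = r *\<^sub>C (y * upow D m)" for y m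
  proof -
    obtain r where "upow D (- m) * y = r *\<^sub>C (y * upow D (- m))" using comm by blast
    from arg_cong[OF this, of star] have r: "star y * upow D m = cnj r *\<^sub>C (upow D m * star y)"
      by (simp add: star_mult star_scaleC star_upow)
    have D: "D * upow D m = upow D m * D"
      using upow_add[of 1 m] upow_add[of m 1] by (simp add: upow_def[of D 1] add.commute)
    show ?thesis
    \<comment> \<open>The scalar from the hypothesis may be 0 a priori; in that case
      \<open>star y\<close> is 0 and the claim is trivial.\<close>
    proof (cases "r = 0")
      case True
      then have "star y * (upow D m * upow D (- m)) = 0" using r by (simp add: mult.assoc[symmetric])
      then show ?thesis by (simp add: upow_inverse)
    next
      case False
      then have "upow D m * star y = (1 / cnj r) *\<^sub>C (star y * upow D m)"
        using r by (simp add: scaleC_simps)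
      then have "upow D m * (D * star y) = (1 / cnj r) *\<^sub>C (D * star y * upow D m)"
        by (simp add: mult.assoc[symmetric] D[symmetric]) (simp add: mult.assoc mult_scaleC_right)
      then show ?thesis by blast
    qed
  qed
  show "x \<in> cspan coeffs \<Longrightarrow> x * a \<in> cspan coeffs"
    by (rule gen) (use tau_ab_in_span comm_a in blast)+
  show "x \<in> cspan coeffs \<Longrightarrow> x * b \<in> cspan coeffs"
    by (rule gen) (use tau_ab_in_span upow_b in blast)+
  show "x \<in> cspan coeffs \<Longrightarrow> x * d \<in> cspan coeffs"
    unfolding d_def by (rule gen) (use tau_cd_in_span star[OF comm_a] in \<open>auto simp: d_def\<close>)
  have Db: "tau n j i * (D * star b) \<in> cspan coeffs" if "i \<le> n" "j \<le> n" for n i j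
  proof -
    have "tau n j i * (D * star b) = (- 1 / cnj q) *\<^sub>C (tau n j i * c)"
      by (simp add: c_def scaleC_simps)
    with tau_cd_in_span[OF that] show ?thesis by (simp add: cvec.span_scale cvec.span_neg)
  qed
  have "x \<in> cspan coeffs \<Longrightarrow> x * (D * star b) \<in> cspan coeffs"
    by (rule gen) (use Db star[OF upow_b] in auto)
  then show "x \<in> cspan coeffs \<Longrightarrow> x * c \<in> cspan coeffs"
    by (simp add: c_def mult_scaleC_right cvec.span_scale cvec.span_neg)
qed

lemma A_eq_range: "A = range (fa_eval gens)"
proof -
  have "x \<in> {Gen_a, Gen_b, Gen_D}" for x by (cases x) simp_all
  then have "(UNIV :: Uq2_gen set) = {Gen_a, Gen_b, Gen_D}" by blast
  then have "range gens = gens ` {Gen_a, Gen_b, Gen_D}" by (rule arg_cong)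
  then have "range gens = {a, b, D}" by simp
  then show ?thesis unfolding Uq2_alg_def by (metis star_hull_eq_range)
qed

text \<open>Since \<open>star a\<close> equals \<open>star D * d\<close> and \<open>star b\<close>
  is a multiple of \<open>star D * c\<close>, the span is stable under right multiplication by all
  six letters. It contains 1, so words are built by appending letters.\<close>

lemma coeffs_span: "cspan coeffs = A"
proof
  have "coeffs \<subseteq> A" by (auto simp: coeffs_def intro: tau_in_A)
  then show "cspan coeffs \<subseteq> A" by (rule cvec.span_minimal) simp
next
  let ?M = "cspan coeffs"
  have D: "x * D \<in> ?M" "x * star D \<in> ?M" if "x \<in> ?M" for x
    using coeffs_upow[OF that, of 1] coeffs_upow[OF that, of "-1"] by (simp_all add: upow_def)
  have b': "x * star b \<in> ?M" if "x \<in> ?M" for x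
  proof -
    have "x * star b = (- 1 / cnj q) *\<^sub>C ((x * star D) * c)"
      by (simp add: c_def scaleC_simps mult.assoc unitary_cancel)
    with coeffs_mult(3)[OF D(2)[OF that]] show ?thesis by (simp add: cvec.span_scale cvec.span_neg)
  qed
  have a': "x * star a \<in> ?M" if "x \<in> ?M" for x
    using coeffs_mult(4)[OF D(2)[OF that]] by (simp add: d_def mult.assoc unitary_cancel)
  have "prod_list (map (\<lambda>(g, s). if s then star (gens g) else gens g) ws) \<in> ?M" for ws
  proof (induction ws rule: rev_induct)
    case Nil
    have "1 \<in> ?M" using tau_in_span[of 0 0 0] by (simp add: tau_def)
    then show ?case by simp
  next
    case (snoc x ws)
    obtain g t where x: "x = (g, t)" by (cases x)
    show ?case
      using snoc coeffs_mult(1,2) D a' b' by (cases g; cases t) (simp_all add: x)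
  qed
  then show "A \<subseteq> ?M"
    unfolding A_eq_range fa_eval_def by (auto intro!: cvec.span_sum cvec.span_scale)
qed

text \<open>The elements t^l_ij D^m for l = n / 2, with both indices shifted to 0, ..., n; see
  \<open>Uq2_t_eq\<close>. The square roots turn the weighted relations of rows and columns into
  unitarity.\<close>

definition U :: "nat \<Rightarrow> int \<Rightarrow> nat \<Rightarrow> nat \<Rightarrow> 'a"
  where "U n m i j = sqrt (w n j / w n i) *\<^sub>C (tau n j i * upow D m)"

lemma U_in_A: "j \<le> n \<Longrightarrow> U n m i j \<in> A"
  by (simp add: U_def tau_in_A)

lemma span_U: "cspan {U n m i j |n m i j. i \<le> n \<and> j \<le> n} = A"
proof -
  have "coeffs \<subseteq> cspan {U n m i j |n m i j. i \<le> n \<and> j \<le> n}"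
  proof
    fix z assume "z \<in> coeffs"
    then obtain n i j m where z: "z = tau n j i * upow D m" "i \<le> n" "j \<le> n" by (auto simp: coeffs_def)
    have "sqrt (w n j / w n i) \<noteq> 0" using w_pos[OF z(2)] w_pos[OF z(3)] by simp
    then have "z = (1 / sqrt (w n j / w n i)) *\<^sub>C U n m i j"
      by (simp add: U_def z(1) scaleC_simps)
    moreover have "U n m i j \<in> cspan {U n m i j |n m i j. i \<le> n \<and> j \<le> n}"
      using z by (intro cvec.span_base) blast
    ultimately show "z \<in> cspan {U n m i j |n m i j. i \<le> n \<and> j \<le> n}" by (simp add: cvec.span_scale)
  qed
  then have "A \<subseteq> cspan {U n m i j |n m i j. i \<le> n \<and> j \<le> n}"
    unfolding coeffs_span[symmetric] by (rule cvec.span_minimal) simp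
  moreover have "cspan {U n m i j |n m i j. i \<le> n \<and> j \<le> n} \<subseteq> A"
    by (rule cvec.span_minimal) (auto simp: U_in_A)
  ultimately show ?thesis by blast
qed

lemma Delta_U:
  assumes "i \<le> n" "j \<le> n"
  shows "\<Delta> (U n m i j) = (\<Sum>r\<le>n. U n m i r \<otimes> U n m r j)"
proof -
  have "sqrt (w n j / w n i) = sqrt (w n r / w n i) * sqrt (w n j / w n r)" if "r \<le> n" for r
    using w_pos[OF that] by (simp add: real_sqrt_mult[symmetric])
  then have "complex_of_real (sqrt (w n j / w n i)) *\<^sub>C ((tau n r i * upow D m) \<otimes> (tau n j r * upow D m)) = U n m i r \<otimes> U n m r j"
    if "r \<le> n" for r
    using that unfolding U_def tensor_scale_left tensor_scale_right scaleC_scaleC of_real_mult[symmetric]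
    by simp
  moreover have "\<Delta> (U n m i j) = (\<Sum>r\<le>n. complex_of_real (sqrt (w n j / w n i)) *\<^sub>C ((tau n r i * upow D m) \<otimes> (tau n j r * upow D m)))"
    using assms unfolding U_def
    by (simp add: linear_onD(2)[OF Delta_linear] tau_in_A Delta_mult Delta_tau Delta_upow
        tensor_mult_sum_left tensor_mult_elem_elem cvec.scale_sum_right)
  ultimately show ?thesis by simp
qed

lemma U_row:
  assumes "i \<le> n" "i' \<le> n"
  shows "(\<Sum>j\<le>n. U n m i j * star (U n m i' j)) = (if i = i' then 1 else 0)"
proof -
  have "U n m i j * star (U n m i' j) = (1 / sqrt (w n i * w n i')) *\<^sub>C w n j *\<^sub>C (tau n j i * star (tau n j i'))"
    if "j \<le> n" for j
  proof -
    have "U n m i j * star (U n m i' j) = (sqrt (w n j / w n i) * sqrt (w n j / w n i')) *\<^sub>C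
        (tau n j i * (upow D m * upow D (- m)) * star (tau n j i'))"
      by (simp add: U_def star_scaleC star_mult star_upow mult.assoc scaleC_simps mult.commute)
    also have "sqrt (w n j / w n i) * sqrt (w n j / w n i') = 1 / sqrt (w n i * w n i') * w n j"
      using w_pos[OF that] by (simp add: real_sqrt_divide real_sqrt_mult)
    finally show ?thesis by (simp add: upow_inverse scaleC_scaleC)
  qed
  then have "(\<Sum>j\<le>n. U n m i j * star (U n m i' j))
      = (1 / sqrt (w n i * w n i')) *\<^sub>C (if i = i' then w n i else 0) *\<^sub>C 1"
    unfolding row_unitary[symmetric] cvec.scale_sum_right by (intro sum.cong) simp_all
  also have "\<dots> = (if i = i' then 1 else 0)"
    using w_pos[OF assms(1)] by (auto simp: scaleC_simps)
  finally show ?thesis .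
qed

lemma U_col:
  assumes "j \<le> n" "j' \<le> n"
  shows "(\<Sum>i\<le>n. star (U n m i j) * U n m i j') = (if j = j' then 1 else 0)"
proof -
  \<comment> \<open>Expressed by \<open>sig\<close>, so that \<open>column_unitary\<close> applies;
    the quotient of weights in \<open>sig\<close> inverts the square root.\<close>
  have U: "U n m i j = sqrt (w n i / w n j) *\<^sub>C (sig n i j * upow D m)" if "i \<le> n" "j \<le> n" for i j
  proof -
    have "sqrt (w n j / w n i) = sqrt (w n i / w n j) * (w n j / w n i)"
      using w_pos[OF that(1)] w_pos[OF that(2)]
      by (simp add: real_sqrt_divide field_simps real_sqrt_mult_self[unfolded abs_of_pos])
    then show ?thesis by (simp only: U_def sig_def scaleC_simps of_real_mult)
  qed
  have "star (U n m i j) * U n m i j' = (1 / sqrt (w n j * w n j')) *\<^sub>C (upow D (- m) * (w n i *\<^sub>C (star (sig n i j) * sig n i j')) * upow D m)"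
    if "i \<le> n" for i
  proof -
    have "star (U n m i j) * U n m i j' = (sqrt (w n i / w n j) * sqrt (w n i / w n j')) *\<^sub>C
        (upow D (- m) * (star (sig n i j) * sig n i j') * upow D m)"
      using that assms by (simp add: U star_scaleC star_mult star_upow mult.assoc scaleC_simps mult.commute)
    also have "sqrt (w n i / w n j) * sqrt (w n i / w n j') = 1 / sqrt (w n j * w n j') * w n i"
      using w_pos[OF that] by (simp add: real_sqrt_divide real_sqrt_mult)
    finally show ?thesis by (simp add: scaleC_simps)
  qed
  then have "(\<Sum>i\<le>n. star (U n m i j) * U n m i j')
      = (1 / sqrt (w n j * w n j')) *\<^sub>C (upow D (- m) * ((if j = j' then w n j else 0) *\<^sub>C 1) * upow D m)"
    unfolding column_unitary[symmetric] cvec.scale_sum_right sum_distrib_left sum_distrib_right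
    by (intro sum.cong) simp_all
  also have "\<dots> = (if j = j' then 1 else 0)"
    using w_pos[OF assms(1)] by (auto simp: scaleC_simps upow_inverse)
  finally show ?thesis .
qed

section \<open>The first row and the first column of U\<close>

lemma tau_row_0: "k \<le> n \<Longrightarrow> tau n k 0 = f n k"
  by (induction rule: tau_induct) (simp_all add: step_0 f_b, simp_all add: f_def f_Suc_0[unfolded f_def] power_commutes)

lemma U_0: "j \<le> n \<Longrightarrow> U n m 0 j = sqrt (w n j) *\<^sub>C (f n j * upow D m)"
  by (simp add: U_def w_0 tau_row_0)

lemma U_col_0: "i \<le> n \<Longrightarrow> U n m i 0 = sqrt (w n i) *\<^sub>C (g n i * upow D m)"
proof -
  assume i: "i \<le> n"
  have "sqrt (1 / w n i) * w n i = sqrt (w n i)"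
    using w_pos[OF i] by (simp add: real_sqrt_divide real_div_sqrt)
  then show ?thesis
    by (simp add: U_def w_0 tau_0_eq_g scaleC_simps of_real_mult[symmetric] del: of_real_mult)
qed

lemma U_0_nz: "j \<le> n \<Longrightarrow> U n m 0 j \<noteq> 0"
proof
  assume j: "j \<le> n" and "U n m 0 j = 0"
  then have "f n j * upow D m = 0" using w_pos[OF j] by (simp add: U_0)
  then have "f n j * (upow D m * upow D (- m)) = 0" by (simp add: mult.assoc[symmetric])
  then have "(\<Sum>i\<le>n. (if i = j then 1 else 0) *\<^sub>C f n i) = 0"
    using j by (simp add: upow_inverse if_distrib[of "\<lambda>r. r *\<^sub>C _"] cong: if_cong)
  from bspec[OF independent_f[OF this], of j] j show False by simp
qed

lemma U_col_0_nz: "i \<le> n \<Longrightarrow> U n m i 0 \<noteq> 0"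
proof
  assume j: "i \<le> n" and "U n m i 0 = 0"
  then have "g n i * upow D m = 0" using w_pos[OF j] by (simp add: U_col_0)
  then have "g n i * (upow D m * upow D (- m)) = 0" by (simp add: mult.assoc[symmetric])
  then have "(\<Sum>k\<le>n. (if k = i then 1 else 0) *\<^sub>C g n k) = 0"
    using j by (simp add: upow_inverse if_distrib[of "\<lambda>r. r *\<^sub>C _"] cong: if_cong)
  from bspec[OF independent_g[OF this], of i] j show False by simp
qed

text \<open>Stated for homomorphisms on \<open>A\<close> alone, so that it covers the counit, with
  both angles 0, besides the characters. Since \<open>b\<close> and \<open>c\<close> go to 0, each
  step keeps a single nonzero diagonal entry.\<close>

lemma hom_U:
  assumes lin: "linear_on A \<xi>" and one: "\<xi> 1 = (1 :: complex)"
    and mult: "\<And>x y. x \<in> A \<Longrightarrow> y \<in> A \<Longrightarrow> \<xi> (x * y) = \<xi> x * \<xi> y"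
    and star: "\<And>x. x \<in> A \<Longrightarrow> \<xi> (star x) = cnj (\<xi> x)"
    and gens: "\<xi> a = cis \<theta>" "\<xi> b = 0" "\<xi> D = cis \<phi>"
    and ij: "i \<le> n" "j \<le> n"
  shows "\<xi> (U n m i j) = (if i = j then cis ((real n - 2 * real i) * \<theta> + (real i + of_int m) * \<phi>) else 0)"
proof -
  have sc: "\<xi> (r *\<^sub>C x) = r * \<xi> x" if "x \<in> A" for r x
    using linear_onD(2)[OF lin that] by (simp add: scaleC_complex_def)
  have z: "\<xi> 0 = 0" using linear_on_zero[OF lin] by simp
  have c: "\<xi> c = 0" using gens by (simp add: c_def sc mult star linear_on_minus[OF lin])
  have d: "\<xi> d = cis (\<phi> - \<theta>)" using gens by (simp add: d_def mult star cis_cnj cis_mult)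
  have "(\<forall>i. tau n j i \<in> A) \<and> (\<forall>i. \<xi> (tau n j i) = (if i = j then cis ((real n - real j) * \<theta> + real j * (\<phi> - \<theta>)) else 0))"
    using ij(2)
  proof (induction rule: tau_induct)
    case zero
    then show ?case by (simp add: one z)
  next
    case (left n v)
    have "\<xi> (step a c v i) = (if i = 0 then cis ((real (Suc n) - real 0) * \<theta> + real 0 * (\<phi> - \<theta>)) else 0)" for i
      using left by (cases i) (simp_all add: step_0 step_Suc linear_onD(1)[OF lin] sc mult c gens cis_mult algebra_simps)
    with left show ?case by (simp add: step_in_A)
  next
    case (right n k v)
    have "\<xi> (step b d v i) = (if i = Suc k then cis ((real (Suc n) - real (Suc k)) * \<theta> + real (Suc k) * (\<phi> - \<theta>)) else 0)" for i
      using right by (cases i) (simp_all add: step_0 step_Suc linear_onD(1)[OF lin] sc mult d gens cis_mult algebra_simps)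
    with right show ?case by (simp add: step_in_A)
  qed
  moreover have "\<xi> (upow D m) = cis (of_int m * \<phi>)"
  proof -
    have pow: "\<xi> (x ^ k) = \<xi> x ^ k" if "x \<in> A" for x k
      using that by (induction k) (simp_all add: one mult)
    show ?thesis by (simp add: upow_def pow star gens cis_cnj Complex.DeMoivre)
  qed
  ultimately show ?thesis
    using w_pos[OF ij(1)] ij by (auto simp: U_def sc mult cis_mult tau_in_A algebra_simps)
qed

lemma weight_eq:
  assumes "\<And>\<theta> \<phi>. cis ((real n - 2 * real i) * \<theta> + (real i + of_int m) * \<phi>)
      = cis ((real n' - 2 * real j) * \<theta> + (real j + of_int m') * \<phi>)"
  shows "int n - 2 * int i = int n' - 2 * int j \<and> int i + m = int j + m'"
proof -
  have "x = y" if eq: "\<And>\<theta>. cis (x * \<theta>) = cis (y * \<theta>)" for x y :: real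
  proof (rule ccontr)
    assume "x \<noteq> y"
    have "cis ((x - y) * \<theta>) = 1" for \<theta>
      using eq[of \<theta>] by (simp add: left_diff_distrib cis_divide[symmetric])
    \<comment> \<open>At this angle the value of \<open>cis\<close> is -1.\<close>
    from this[of "pi / (x - y)"] \<open>x \<noteq> y\<close> show False by simp
  qed
  from this[of "real n - 2 * real i" "real n' - 2 * real j"] this[of "real i + of_int m" "real j + of_int m'"]
  have "real n - 2 * real i = real n' - 2 * real j" "real i + of_int m = real j + of_int m'"
    using assms[of _ 0] assms[of 0] by auto
  then show ?thesis by linarith
qed

text \<open>Common frame for all weight arguments: a nonzero number that absorbs the weight of i on
  one side and that of j on the other, for every character, forces the weights to agree.\<close>

lemma hom_weight:
  assumes "\<And>\<xi> \<theta> \<phi>. linear_on UNIV \<xi> \<Longrightarrow> \<xi> 1 = (1 :: complex) \<Longrightarrow> (\<And>x y. \<xi> (x * y) = \<xi> x * \<xi> y) \<Longrightarrow>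
      (\<And>x. \<xi> (star x) = cnj (\<xi> x)) \<Longrightarrow>
      (\<And>n m i j. i \<le> n \<Longrightarrow> j \<le> n \<Longrightarrow> \<xi> (U n m i j) =
        (if i = j then cis ((real n - 2 * real i) * \<theta> + (real i + of_int m) * \<phi>) else 0)) \<Longrightarrow>
      X * cis ((real n - 2 * real i) * \<theta> + (real i + of_int m) * \<phi>)
        = X * cis ((real n' - 2 * real j) * \<theta> + (real j + of_int m') * \<phi>)"
    and "X \<noteq> 0"
  shows "int n - 2 * int i = int n' - 2 * int j \<and> int i + m = int j + m'"
proof (rule weight_eq)
  fix \<theta> \<phi>
  obtain \<xi> where \<xi>: "linear_on UNIV \<xi>" "\<xi> 1 = (1 :: complex)" "\<And>x y. \<xi> (x * y) = \<xi> x * \<xi> y"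
    "\<And>x. \<xi> (star x) = cnj (\<xi> x)" "\<xi> a = cis \<theta>" "\<xi> b = 0" "\<xi> D = cis \<phi>"
    using character[of \<theta> \<phi>] by metis
  have "linear_on A \<xi>" using \<xi>(1) by (rule linear_on_subset) simp
  then have "\<xi> (U n m i j) = (if i = j then cis ((real n - 2 * real i) * \<theta> + (real i + of_int m) * \<phi>) else 0)"
    if "i \<le> n" "j \<le> n" for n m i j
    using \<xi> that by (intro hom_U) auto
  from assms(1)[OF \<xi>(1-4) this] assms(2)
  show "cis ((real n - 2 * real i) * \<theta> + (real i + of_int m) * \<phi>)
      = cis ((real n' - 2 * real j) * \<theta> + (real j + of_int m') * \<phi>)" by simp
qed

text \<open>Schur's lemma: an intertwiner preserves the weights for the torus of characters, and the entries
  in the first row and in the first column of \<open>U\<close> do not vanish.\<close>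

lemma Schur:
  fixes X :: "nat \<Rightarrow> nat \<Rightarrow> complex"
  assumes inter: "\<And>i j. i \<le> n \<Longrightarrow> j \<le> n' \<Longrightarrow>
      (\<Sum>k\<le>n'. X i k *\<^sub>C U n' m' k j) = (\<Sum>k\<le>n. X k j *\<^sub>C U n m i k)"
    and ij: "i \<le> n" "j \<le> n'"
  shows "X i j = (if n = n' \<and> m = m' \<and> i = j then X 0 0 else 0)"
proof -
  have wt: "int n - 2 * int i = int n' - 2 * int j \<and> int i + m = int j + m'"
    if ij: "i \<le> n" "j \<le> n'" and nz: "X i j \<noteq> 0" for i j
  proof (rule hom_weight[OF _ nz])
    fix \<xi> and \<theta> \<phi> :: real
    assume lin: "linear_on UNIV \<xi>" and \<xi>: "\<And>n m i j. i \<le> n \<Longrightarrow> j \<le> n \<Longrightarrow> \<xi> (U n m i j) =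
        (if i = j then cis ((real n - 2 * real i) * \<theta> + (real i + of_int m) * \<phi>) else 0)"
    have "\<xi> (\<Sum>k\<le>N. r k *\<^sub>C y k) = (\<Sum>k\<le>N. r k * \<xi> (y k))" for N :: nat and r y
      by (simp add: linear_on_sum[OF lin csubspace_UNIV] linear_onD(2)[OF lin] scaleC_complex_def)
    with arg_cong[OF inter[OF ij], of \<xi>] have
      "(\<Sum>k\<le>n'. X i k * \<xi> (U n' m' k j)) = (\<Sum>k\<le>n. X k j * \<xi> (U n m i k))" by simp
    then show "X i j * cis ((real n - 2 * real i) * \<theta> + (real i + of_int m) * \<phi>)
        = X i j * cis ((real n' - 2 * real j) * \<theta> + (real j + of_int m') * \<phi>)"
      using ij by (simp add: \<xi> if_distrib[of "\<lambda>r. _ * r"] cong: if_cong) metis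
  qed
  \<comment> \<open>The weight relation determines i from j and j from i, so X has at most one
    nonzero entry in each row and column and the sums collapse.\<close>
  have row: "(\<Sum>k\<le>n. X k j *\<^sub>C U n m i' k) = X i j *\<^sub>C U n m i' i" if "X i j \<noteq> 0" "i \<le> n" "j \<le> n'" for i i' j
  proof -
    have "X k j = 0" if "k \<le> n" "k \<noteq> i" for k
      using wt[of i j] wt[of k j] that \<open>X i j \<noteq> 0\<close> \<open>i \<le> n\<close> \<open>j \<le> n'\<close> by auto
    then have "(\<Sum>k\<le>n. X k j *\<^sub>C U n m i' k) = (\<Sum>k\<le>n. if k = i then X i j *\<^sub>C U n m i' i else 0)"
      by (intro sum.cong) auto
    then show ?thesis using that by simp
  qed
  have col: "(\<Sum>k\<le>n'. X i k *\<^sub>C U n' m' k j') = X i j *\<^sub>C U n' m' j j'" if "X i j \<noteq> 0" "i \<le> n" "j \<le> n'" for i j j'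
  proof -
    have "X i k = 0" if "k \<le> n'" "k \<noteq> j" for k
      using wt[of i j] wt[of i k] that \<open>X i j \<noteq> 0\<close> \<open>i \<le> n\<close> \<open>j \<le> n'\<close> by auto
    then have "(\<Sum>k\<le>n'. X i k *\<^sub>C U n' m' k j') = (\<Sum>k\<le>n'. if k = j then X i j *\<^sub>C U n' m' j j' else 0)"
      by (intro sum.cong) auto
    then show ?thesis using that by simp
  qed
  consider "n' < n" | "n < n'" | "n = n'" by linarith
  then show ?thesis
  proof cases
    case 1
    have "X i j = 0"
    proof (rule ccontr)
      assume nz: "X i j \<noteq> 0"
      \<comment> \<open>Index 0 has first weight n, while the first weights at level n' are n' - 2 k
        \<le> n' < n.\<close>
      have "X 0 k = 0" if "k \<le> n'" for k using wt[of 0 k] 1 that by auto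
      then have "(\<Sum>k\<le>n'. X 0 k *\<^sub>C U n' m' k j) = 0" by simp
      then have "X i j *\<^sub>C U n m 0 i = 0" using inter[of 0 j] ij row[OF nz ij, of 0] by simp
      with nz U_0_nz[OF ij(1), of m] show False by simp
    qed
    then show ?thesis using 1 by simp
  next
    case 2
    have "X i j = 0"
    proof (rule ccontr)
      assume nz: "X i j \<noteq> 0"
      \<comment> \<open>Now the first weight n' of column 0 exceeds every n - 2 k.\<close>
      have "X k 0 = 0" if "k \<le> n" for k using wt[of k 0] 2 that by auto
      then have "(\<Sum>k\<le>n. X k 0 *\<^sub>C U n m i k) = 0" by simp
      then have "X i j *\<^sub>C U n' m' j 0 = 0" using inter[of i 0] ij col[OF nz ij, of 0] by simp
      with nz U_col_0_nz[OF ij(2), of m'] show False by simp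
    qed
    then show ?thesis using 2 by simp
  next
    case 3
    have diag: "X i j = 0" if "\<not> (m = m' \<and> i = j)" "i \<le> n" "j \<le> n'" for i j
      by (rule ccontr) (use wt[of i j] that 3 in auto)
    \<comment> \<open>Row 0 of the intertwining relation compares X i i with X 0 0 through the
      nonzero entry (0, i) of \<open>U\<close>.\<close>
    have "X i i = X 0 0" if "m = m'" "i \<le> n" for i
    proof -
      have "(\<Sum>k\<le>n'. X 0 k *\<^sub>C U n' m' k i) = (\<Sum>k\<le>n'. if k = 0 then X 0 0 *\<^sub>C U n' m' 0 i else 0)"
        using diag 3 by (intro sum.cong) auto
      moreover have "(\<Sum>k\<le>n. X k i *\<^sub>C U n m 0 k) = (\<Sum>k\<le>n. if k = i then X i i *\<^sub>C U n m 0 i else 0)"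
        using diag 3 that by (intro sum.cong) auto
      ultimately have "X 0 0 *\<^sub>C U n m 0 i = X i i *\<^sub>C U n m 0 i"
        using inter[of 0 i] that 3 by simp
      with U_0_nz[OF that(2)] show ?thesis by simp
    qed
    then show ?thesis using diag[OF _ ij] ij 3 by (metis (full_types))
  qed
qed

text \<open>Each factor \<open>c\<close> is - cnj q times \<open>D * star b\<close>. The scalar
  contributes s, the unitary \<open>D\<close> cancels because it commutes with what stands between,
  and \<open>b\<close> and \<open>star b\<close> may be exchanged as \<open>b\<close> is
  normal.\<close>

lemma conj_c_power:
  assumes "P * b = b * P" "P * star b = star b * P" "P * D = D * P" "P * star D = star D * P"
  shows "star (c ^ i) * P * c ^ i = s ^ i *\<^sub>C (star (b ^ i) * P * b ^ i) \<and>
    c ^ i * P * star (c ^ i) = s ^ i *\<^sub>C (b ^ i * P * star (b ^ i))"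
  using assms
proof (induction i arbitrary: P)
  case 0
  show ?case by (simp add: star_one scaleC_one)
next
  case (Suc i)
  \<comment> \<open>Peeling off the innermost factors replaces P by this element, which satisfies
    the same commutation hypotheses; hence the generalization over P.\<close>
  let ?P = "P * (b * star b)"
  note P = Suc.prems
  have cancel: "x * (star D * (D * y)) = x * y" for x y by (simp add: unitary_cancel)
  have com: "?P * b = b * ?P" "?P * star b = star b * ?P" "?P * D = D * ?P" "?P * star D = star D * ?P"
  proof -
    have "?P * b = (P * b) * star b * b" by (simp add: mult.assoc rel_bb'[symmetric])
    then show "?P * b = b * ?P" by (simp only: P(1) mult.assoc rel_bb')
    have "?P * star b = P * star b * (b * star b)" by (simp add: mult.assoc rel_bb')
    then show "?P * star b = star b * ?P" by (simp only: P(2) mult.assoc)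
    have "?P * D = P * D * (b * star b)" by (simp add: mult.assoc nf_b'D scaleC_simps) (simp add: mult.assoc[symmetric] rel_bD scaleC_simps)
    then show "?P * D = D * ?P" by (simp only: P(3) mult.assoc)
    have "?P * star D = P * star D * (b * star b)" by (simp add: mult.assoc nf_b'D' scaleC_simps) (simp add: mult.assoc[symmetric] nf_bD' scaleC_simps)
    then show "?P * star D = star D * ?P" by (simp only: P(4) mult.assoc)
  qed
  have 1: "star c * P * c = s *\<^sub>C ?P"
  proof -
    have "star c * P * c = s *\<^sub>C (b * (star D * P) * D * star b)"
      by (simp add: c_def star_minus star_scaleC star_mult star_star scaleC_simps mult.assoc s_eq)
    also have "\<dots> = s *\<^sub>C (b * P * star b)"
      unfolding P(4)[symmetric] by (simp add: mult.assoc unitary_cancel)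
    finally show ?thesis unfolding P(1)[symmetric] by (simp add: mult.assoc)
  qed
  have 2: "star b * P * b = ?P"
    unfolding P(2)[symmetric] by (simp add: mult.assoc rel_bb')
  have 3: "c * P * star c = s *\<^sub>C ?P"
  proof -
    have "c * P * star c = s *\<^sub>C (D * (star b * P * b) * star D)"
      by (simp add: c_def star_minus star_scaleC star_mult star_star scaleC_simps mult.assoc s_eq mult.commute)
    also have "\<dots> = s *\<^sub>C (?P * D * star D)" unfolding 2 com(3)[symmetric] ..
    finally show ?thesis by (simp add: mult.assoc rel_DD')
  qed
  have 4: "b * P * star b = ?P"
    unfolding P(1)[symmetric] by (simp add: mult.assoc)
  have "star (c ^ Suc i) * P * c ^ Suc i = star (c ^ i) * (star c * P * c) * c ^ i"
    by (simp add: star_mult mult.assoc)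
  also have "\<dots> = (s * s ^ i) *\<^sub>C (star (b ^ i) * (star b * P * b) * b ^ i)"
    unfolding 1 2 using conjunct1[OF Suc.IH[OF com]] by (simp add: scaleC_simps)
  finally have 5: "star (c ^ Suc i) * P * c ^ Suc i = s ^ Suc i *\<^sub>C (star (b ^ Suc i) * P * b ^ Suc i)"
    by (simp add: star_mult mult.assoc)
  have "c ^ Suc i * P * star (c ^ Suc i) = c ^ i * (c * P * star c) * star (c ^ i)"
    by (simp add: star_mult mult.assoc power_Suc2 del: power_Suc)
  also have "\<dots> = (s * s ^ i) *\<^sub>C (b ^ i * (b * P * star b) * star (b ^ i))"
    unfolding 3 4 using conjunct2[OF Suc.IH[OF com]] by (simp add: scaleC_simps)
  also have "b ^ i * (b * P * star b) * star (b ^ i) = b ^ Suc i * P * star (b ^ Suc i)"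
    by (simp add: star_mult mult.assoc power_Suc2 del: power_Suc)
  finally show ?case using 5 by simp
qed

text \<open>With \<open>g_star_g\<close> the source of the constants in the orthogonality relations:
  it compares the first column of \<open>U\<close> with the first row. The inner factor star (a ^ k)
  * a ^ k commutes with b, star b, D and star D, as \<open>conj_c_power\<close> requires.\<close>

lemma star_g_g: "star (g n i) * g n i = s ^ i *\<^sub>C (star (f n i) * f n i)"
proof -
  define P where "P k = star (a ^ k) * a ^ k" for k
  have com: "P k * b = b * P k \<and> P k * star b = star b * P k \<and> P k * D = D * P k \<and> P k * star D = star D * P k" for k
  proof (induction k)
    case (Suc k)
    have S: "P (Suc k) = star a * P k * a"
      by (simp add: P_def star_mult power_Suc2 mult.assoc del: power_Suc)
    have "P (Suc k) * b = (1 / q) *\<^sub>C (star a * (P k * b) * a)"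
      by (simp add: S mult.assoc rel_ba scaleC_simps)
    also have "\<dots> = b * P (Suc k)"
      using Suc by (simp add: S mult.assoc[symmetric] nf_ba' scaleC_simps)
    finally have 1: "P (Suc k) * b = b * P (Suc k)" .
    have "star b * P (Suc k) = (1 / cnj q) *\<^sub>C (star a * (star b * P k) * a)"
      by (simp add: S mult.assoc[symmetric] nf_b'a' scaleC_simps)
    also have "\<dots> = (1 / cnj q) *\<^sub>C (star a * (P k * star b) * a)" using Suc by simp
    also have "\<dots> = P (Suc k) * star b"
      by (simp add: S mult.assoc nf_b'a scaleC_simps)
    finally have 2: "P (Suc k) * star b = star b * P (Suc k)" by simp
    have "P (Suc k) * D = star a * (P k * D) * a" by (simp add: S mult.assoc rel_aD)
    also have "\<dots> = D * P (Suc k)" using Suc by (simp add: S mult.assoc[symmetric] nf_a'D)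
    finally have 3: "P (Suc k) * D = D * P (Suc k)" .
    have "P (Suc k) * star D = star a * (P k * star D) * a" by (simp add: S mult.assoc nf_aD')
    also have "\<dots> = star D * P (Suc k)" using Suc by (simp add: S mult.assoc[symmetric] nf_a'D')
    finally show ?case using 1 2 3 by blast
  qed (simp add: P_def star_one)
  have "star (g n i) * g n i = star (c ^ i) * P (n - i) * c ^ i"
    by (simp add: g_def star_mult P_def mult.assoc)
  also have "\<dots> = s ^ i *\<^sub>C (star (b ^ i) * P (n - i) * b ^ i)"
    using com by (intro conjunct1[OF conj_c_power]) blast+
  finally show ?thesis by (simp add: f_def star_mult P_def mult.assoc)
qed

lemma g_star_g: "g n i * star (g n i) = s ^ i *\<^sub>C (f n i * star (f n i))"
proof -
  have "g n i * star (g n i) = a ^ (n - i) * (c ^ i * 1 * star (c ^ i)) * star (a ^ (n - i))"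
    by (simp add: g_def star_mult mult.assoc)
  also have "\<dots> = s ^ i *\<^sub>C (a ^ (n - i) * (b ^ i * 1 * star (b ^ i)) * star (a ^ (n - i)))"
    by (subst conjunct2[OF conj_c_power]) (simp_all add: scaleC_simps)
  finally show ?thesis by (simp add: f_def star_mult mult.assoc)
qed

end

lemma sum_rotate: "(\<Sum>i\<in>I. \<Sum>j\<in>J. \<Sum>k\<in>K. F i j k) = (\<Sum>j\<in>J. \<Sum>k\<in>K. \<Sum>i\<in>I. F i j k)"
  by (rule trans[OF sum.swap sum.cong[OF refl sum.swap]])

section \<open>The Haar state and the Schur orthogonality relations\<close>

locale uq2_haar = uq2 +
  fixes h :: "'a \<Rightarrow> complex"
  assumes haar: "haar_state A \<Delta> h"
begin

lemma h_linear: "linear_on UNIV h" and h_one: "h 1 = 1"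
  using haar by (simp_all add: haar_state_def state_def)

lemma h_scale: "h (r *\<^sub>C x) = r * h x"
  using linear_onD(2)[OF h_linear] by (simp add: scaleC_complex_def)

lemma h_sum: "h (\<Sum>i\<in>I. x i) = (\<Sum>i\<in>I. h (x i))"
  by (rule linear_on_sum[OF h_linear]) simp_all

lemma invariance:
  assumes "x \<in> A" "\<Delta> x = (\<Sum>r\<in>I. u r \<otimes> v r)" "finite I" "\<And>r. r \<in> I \<Longrightarrow> u r \<in> A" "\<And>r. r \<in> I \<Longrightarrow> v r \<in> A"
  shows "(\<Sum>r\<in>I. h (v r) *\<^sub>C u r) = h x *\<^sub>C 1" "(\<Sum>r\<in>I. h (u r) *\<^sub>C v r) = h x *\<^sub>C 1"
proof -
  have b: "balanced A A (\<lambda>y z. h z *\<^sub>C y)" "balanced A A (\<lambda>y z. h y *\<^sub>C z)"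
    using h_linear by (simp_all add: balanced_def linear_on_def scaleC_add_right scaleC_add_left
        scaleC_scaleC h_scale mult.commute)
  have "tensor_lift A A (\<lambda>y z. h z *\<^sub>C y) (\<Delta> x) = (\<Sum>r\<in>I. h (v r) *\<^sub>C u r)"
    unfolding assms(2) by (rule tensor_lift_sum[OF b(1) assms(3-5)])
  moreover have "tensor_lift A A (\<lambda>y z. h y *\<^sub>C z) (\<Delta> x) = (\<Sum>r\<in>I. h (u r) *\<^sub>C v r)"
    unfolding assms(2) by (rule tensor_lift_sum[OF b(2) assms(3-5)])
  ultimately show "(\<Sum>r\<in>I. h (v r) *\<^sub>C u r) = h x *\<^sub>C 1" "(\<Sum>r\<in>I. h (u r) *\<^sub>C v r) = h x *\<^sub>C 1"
    using haar assms(1) unfolding haar_state_def by auto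
qed

lemma Delta_star_U:
  assumes "i \<le> n" "j \<le> n"
  shows "\<Delta> (star (U n m i j)) = (\<Sum>r\<le>n. star (U n m i r) \<otimes> star (U n m r j))"
  using assms by (simp add: Delta_star U_in_A Delta_U tensor_star_sum)

text \<open>The products of the entries of two corepresentation matrices again form such a matrix.
  Invariance of \<open>h\<close> on them yields one relation summed over the row indices and one
  summed over the column indices; they are used with one of the two factors starred.\<close>

lemma pair_invariance:
  fixes x y :: "nat \<Rightarrow> nat \<Rightarrow> 'a"
  assumes x: "\<And>i j. i \<le> n \<Longrightarrow> j \<le> n \<Longrightarrow> x i j \<in> A"
      "\<And>i j. i \<le> n \<Longrightarrow> j \<le> n \<Longrightarrow> \<Delta> (x i j) = (\<Sum>r\<le>n. x i r \<otimes> x r j)"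
    and y: "\<And>i j. i \<le> n' \<Longrightarrow> j \<le> n' \<Longrightarrow> y i j \<in> A"
      "\<And>i j. i \<le> n' \<Longrightarrow> j \<le> n' \<Longrightarrow> \<Delta> (y i j) = (\<Sum>r\<le>n'. y i r \<otimes> y r j)"
    and ij: "i \<le> n" "j \<le> n" "i' \<le> n'" "j' \<le> n'"
  shows "(\<Sum>k\<le>n. \<Sum>k'\<le>n'. h (x k j * y k' j') *\<^sub>C (x i k * y i' k')) = h (x i j * y i' j') *\<^sub>C 1"
    "(\<Sum>k\<le>n. \<Sum>k'\<le>n'. h (x i k * y i' k') *\<^sub>C (x k j * y k' j')) = h (x i j * y i' j') *\<^sub>C 1"
proof -
  have 1: "\<Delta> (x i j * y i' j') = (\<Sum>p\<in>{..n} \<times> {..n'}. (x i (fst p) * y i' (snd p)) \<otimes> (x (fst p) j * y (snd p) j'))"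
    using ij by (simp only: Delta_mult x y tensor_mult_sum_left)
      (simp only: tensor_mult_sum_right tensor_mult_elem_elem sum.cartesian_product case_prod_unfold)
  have "(\<Sum>p\<in>{..n} \<times> {..n'}. h (x (fst p) j * y (snd p) j') *\<^sub>C (x i (fst p) * y i' (snd p))) = h (x i j * y i' j') *\<^sub>C 1"
    "(\<Sum>p\<in>{..n} \<times> {..n'}. h (x i (fst p) * y i' (snd p)) *\<^sub>C (x (fst p) j * y (snd p) j')) = h (x i j * y i' j') *\<^sub>C 1"
    using ij by (auto intro!: invariance[OF _ 1] x y)
  then show "(\<Sum>k\<le>n. \<Sum>k'\<le>n'. h (x k j * y k' j') *\<^sub>C (x i k * y i' k')) = h (x i j * y i' j') *\<^sub>C 1"
    "(\<Sum>k\<le>n. \<Sum>k'\<le>n'. h (x i k * y i' k') *\<^sub>C (x k j * y k' j')) = h (x i j * y i' j') *\<^sub>C 1"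
    by (simp_all add: sum.cartesian_product case_prod_unfold)
qed

lemmas L_invariance = pair_invariance[where x = "\<lambda>i j. star (U n m i j)" and y = "U n' m'" for n m n' m',
    OF _ Delta_star_U _ Delta_U]

lemmas R_invariance = pair_invariance[where x = "U n m" and y = "\<lambda>i j. star (U n' m' i j)" for n m n' m',
    OF _ Delta_U _ Delta_star_U]

text \<open>Fix the row indices. Multiplying the second invariance relation from the left by a row
  of \<open>U n m\<close> and summing removes the starred factor by \<open>U_row\<close>. What
  remains says that the values of \<open>h\<close>, as a matrix in the column indices, form an
  intertwiner.\<close>

lemma L_Schur:
  assumes ij: "i \<le> n" "j \<le> n" "i' \<le> n'" "j' \<le> n'"
  shows "h (star (U n m i j) * U n' m' i' j')
    = (if n = n' \<and> m = m' \<and> j = j' then h (star (U n m i 0) * U n' m' i' 0) else 0)"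
proof -
  let ?X = "\<lambda>j j'. h (star (U n m i j) * U n' m' i' j')"
  have "?X j j' = (if n = n' \<and> m = m' \<and> j = j' then ?X 0 0 else 0)"
  proof (rule Schur[of n n' ?X m' m])
    fix r j'
    assume r: "r \<le> n" "j' \<le> n'"
    have "(\<Sum>j\<le>n. ?X j j' *\<^sub>C U n m r j)
        = (\<Sum>j\<le>n. U n m r j * (\<Sum>k\<le>n. \<Sum>k'\<le>n'. ?X k k' *\<^sub>C (star (U n m k j) * U n' m' k' j')))"
      using ij r by (intro sum.cong refl) (simp add: L_invariance(2) U_in_A mult_scaleC_right)
    also have "\<dots> = (\<Sum>k\<le>n. \<Sum>k'\<le>n'. ?X k k' *\<^sub>C ((\<Sum>j\<le>n. U n m r j * star (U n m k j)) * U n' m' k' j'))"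
      unfolding sum_distrib_left sum_distrib_right cvec.scale_sum_right
      by (subst sum_rotate) (simp add: mult_scaleC_right mult.assoc)
    also have "\<dots> = (\<Sum>k\<le>n. \<Sum>k'\<le>n'. if k = r then ?X r k' *\<^sub>C U n' m' k' j' else 0)"
      using r by (intro sum.cong refl) (auto simp: U_row)
    also have "\<dots> = (\<Sum>k'\<le>n'. ?X r k' *\<^sub>C U n' m' k' j')"
      using r by (subst sum.swap) simp
    finally show "(\<Sum>k\<le>n'. ?X r k *\<^sub>C U n' m' k j') = (\<Sum>k\<le>n. ?X k j' *\<^sub>C U n m r k)" by simp
  qed (use ij in auto)
  then show ?thesis by simp
qed

text \<open>The mirror image of \<open>L_Schur\<close>: the first invariance relation is multiplied
  from the right, \<open>U_col\<close> removes the starred factor, and the intertwiner is a matrix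
  in the row indices.\<close>

lemma R_Schur:
  assumes ij: "i \<le> n" "j \<le> n" "i' \<le> n'" "j' \<le> n'"
  shows "h (U n m i j * star (U n' m' i' j'))
    = (if n = n' \<and> m = m' \<and> i = i' then h (U n m 0 j * star (U n' m' 0 j')) else 0)"
proof -
  let ?X = "\<lambda>i i'. h (U n m i j * star (U n' m' i' j'))"
  have "?X i i' = (if n = n' \<and> m = m' \<and> i = i' then ?X 0 0 else 0)"
  proof (rule Schur[of n n' ?X m' m])
    fix i r
    assume r: "i \<le> n" "r \<le> n'"
    have "(\<Sum>i'\<le>n'. ?X i i' *\<^sub>C U n' m' i' r)
        = (\<Sum>i'\<le>n'. (\<Sum>k\<le>n. \<Sum>k'\<le>n'. ?X k k' *\<^sub>C (U n m i k * star (U n' m' i' k'))) * U n' m' i' r)"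
      using ij r by (intro sum.cong refl) (simp add: R_invariance(1) U_in_A mult_scaleC_left)
    also have "\<dots> = (\<Sum>k\<le>n. \<Sum>k'\<le>n'. ?X k k' *\<^sub>C (U n m i k * (\<Sum>i'\<le>n'. star (U n' m' i' k') * U n' m' i' r)))"
      unfolding sum_distrib_left sum_distrib_right cvec.scale_sum_right
      by (subst sum_rotate) (simp add: mult_scaleC_left mult.assoc)
    also have "\<dots> = (\<Sum>k\<le>n. \<Sum>k'\<le>n'. if k' = r then ?X k r *\<^sub>C U n m i k else 0)"
      using r by (intro sum.cong refl) (auto simp: U_col)
    also have "\<dots> = (\<Sum>k\<le>n. ?X k r *\<^sub>C U n m i k)"
      using r by simp
    finally show "(\<Sum>k\<le>n'. ?X i k *\<^sub>C U n' m' k r) = (\<Sum>k\<le>n. ?X k r *\<^sub>C U n m i k)" .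
  qed (use ij in auto)
  then show ?thesis by simp
qed

lemma hom_sum:
  assumes "linear_on UNIV \<xi>"
  shows "\<xi> (\<Sum>k\<le>n. \<Sum>k'\<le>n'. r k k' *\<^sub>C y k k') = (\<Sum>k\<le>n::nat. \<Sum>k'\<le>n'::nat. r k k' * (\<xi> (y k k') :: complex))"
  using linear_onD(2)[OF assms] by (simp add: linear_on_sum[OF assms csubspace_UNIV] scaleC_complex_def)

lemma cis_cancel: "cnj (cis x) * cis y * X = X \<longleftrightarrow> X * cis x = X * cis y"
proof -
  have "cis x * cnj (cis x) = 1" by (simp add: cis_cnj cis_mult)
  then have "cis x * (cnj (cis x) * cis y * X) = cis y * X" by (simp add: mult.assoc[symmetric])
  moreover have "cis x \<noteq> 0" by simp
  ultimately show ?thesis by (metis mult.commute mult_cancel_left)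
qed

text \<open>\<open>L_Schur\<close> says nothing about different rows. A character applied to the
  other invariance relation multiplies the value of \<open>h\<close> by the quotient of the weights
  of i' and i, which is not constantly 1.\<close>

lemma L_row:
  assumes ij: "i \<le> n" "j \<le> n" "i' \<le> n" "i \<noteq> i'"
  shows "h (star (U n m i j) * U n m i' j) = 0"
proof (rule ccontr)
  let ?X = "h (star (U n m i j) * U n m i' j)"
  assume nz: "?X \<noteq> 0"
  have "int n - 2 * int i = int n - 2 * int i' \<and> int i + m = int i' + m"
  proof (rule hom_weight[OF _ nz])
    fix \<xi> and \<theta> \<phi> :: real
    assume lin: "linear_on UNIV \<xi>" and one: "\<xi> 1 = (1 :: complex)"
      and mult: "\<And>x y. \<xi> (x * y) = \<xi> x * \<xi> y" and star: "\<And>x. \<xi> (star x) = cnj (\<xi> x)"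
      and \<xi>: "\<And>n m i j. i \<le> n \<Longrightarrow> j \<le> n \<Longrightarrow> \<xi> (U n m i j) =
        (if i = j then cis ((real n - 2 * real i) * \<theta> + (real i + of_int m) * \<phi>) else 0)"
    let ?c = "\<lambda>i. cis ((real n - 2 * real i) * \<theta> + (real i + of_int m) * \<phi>)"
    have "\<xi> (\<Sum>k\<le>n. \<Sum>k'\<le>n. h (star (U n m k j) * U n m k' j) *\<^sub>C (star (U n m i k) * U n m i' k')) = ?X"
      using ij linear_onD(2)[OF lin, of 1] by (subst L_invariance(1)) (simp_all add: U_in_A one scaleC_complex_def)
    moreover have "\<xi> (\<Sum>k\<le>n. \<Sum>k'\<le>n. h (star (U n m k j) * U n m k' j) *\<^sub>C (star (U n m i k) * U n m i' k'))
        = (\<Sum>k\<le>n. \<Sum>k'\<le>n. if k' = i' then if k = i then cnj (?c i) * ?c i' * ?X else 0 else 0)"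
      unfolding hom_sum[OF lin] using ij by (intro sum.cong refl) (auto simp: mult star \<xi>)
    moreover have "\<dots> = cnj (?c i) * ?c i' * ?X"
      using ij by simp
    ultimately have "cnj (?c i) * ?c i' * ?X = ?X" by (simp only:)
    then show "?X * ?c i = ?X * ?c i'" by (rule iffD1[OF cis_cancel])
  qed
  with ij show False by simp
qed

lemma R_column:
  assumes ij: "i \<le> n" "j \<le> n" "j' \<le> n" "j \<noteq> j'"
  shows "h (U n m i j * star (U n m i j')) = 0"
proof (rule ccontr)
  let ?X = "h (U n m i j * star (U n m i j'))"
  assume nz: "?X \<noteq> 0"
  have "int n - 2 * int j' = int n - 2 * int j \<and> int j' + m = int j + m"
  proof (rule hom_weight[OF _ nz])
    fix \<xi> and \<theta> \<phi> :: real
    assume lin: "linear_on UNIV \<xi>" and one: "\<xi> 1 = (1 :: complex)"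
      and mult: "\<And>x y. \<xi> (x * y) = \<xi> x * \<xi> y" and star: "\<And>x. \<xi> (star x) = cnj (\<xi> x)"
      and \<xi>: "\<And>n m i j. i \<le> n \<Longrightarrow> j \<le> n \<Longrightarrow> \<xi> (U n m i j) =
        (if i = j then cis ((real n - 2 * real i) * \<theta> + (real i + of_int m) * \<phi>) else 0)"
    let ?c = "\<lambda>i. cis ((real n - 2 * real i) * \<theta> + (real i + of_int m) * \<phi>)"
    have "\<xi> (\<Sum>k\<le>n. \<Sum>k'\<le>n. h (U n m i k * star (U n m i k')) *\<^sub>C (U n m k j * star (U n m k' j'))) = ?X"
      using ij linear_onD(2)[OF lin, of 1] by (subst R_invariance(2)) (simp_all add: U_in_A one scaleC_complex_def)
    moreover have "\<xi> (\<Sum>k\<le>n. \<Sum>k'\<le>n. h (U n m i k * star (U n m i k')) *\<^sub>C (U n m k j * star (U n m k' j')))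
        = (\<Sum>k\<le>n. \<Sum>k'\<le>n. if k' = j' then if k = j then cnj (?c j') * ?c j * ?X else 0 else 0)"
      unfolding hom_sum[OF lin] using ij by (intro sum.cong refl) (auto simp: mult star \<xi>)
    moreover have "\<dots> = cnj (?c j') * ?c j * ?X"
      using ij by simp
    ultimately have "cnj (?c j') * ?c j * ?X = ?X" by (simp only:)
    then show "?X * ?c j' = ?X * ?c j" by (rule iffD1[OF cis_cancel])
  qed
  with ij show False by simp
qed

text \<open>By \<open>star_g_g\<close> the entry (i, 0) has s ^ i times the squared norm of the
  entry (0, i), and by \<open>L_Schur\<close> the latter does not depend on the column. The squared
  norms in column 0 add up to 1 by \<open>U_col\<close>.\<close>

lemma L_norm:
  assumes ij: "i \<le> n" "j \<le> n"
  shows "h (star (U n m i j) * U n m i j) = s ^ i / (\<Sum>r\<le>n. s ^ r)"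
proof -
  let ?c = "\<lambda>i. h (star (U n m i 0) * U n m i 0)"
  have c: "?c i = s ^ i * ?c 0" if i: "i \<le> n" for i
  proof -
    have sq: "complex_of_real (sqrt (w n i)) * complex_of_real (sqrt (w n i)) = w n i"
      using w_pos[OF i] by (simp add: of_real_mult[symmetric] del: of_real_mult)
    have "star (U n m i 0) * U n m i 0 = w n i *\<^sub>C (upow D (- m) * (star (g n i) * g n i) * upow D m)"
      using i sq by (simp add: U_col_0 star_scaleC star_mult star_upow scaleC_simps mult.assoc)
    also have "\<dots> = s ^ i *\<^sub>C (w n i *\<^sub>C (upow D (- m) * (star (f n i) * f n i) * upow D m))"
      by (simp add: star_g_g scaleC_simps mult.commute)
    also have "w n i *\<^sub>C (upow D (- m) * (star (f n i) * f n i) * upow D m) = star (U n m 0 i) * U n m 0 i"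
      using i sq by (simp add: U_0 star_scaleC star_mult star_upow scaleC_simps mult.assoc)
    finally show ?thesis using L_Schur[of 0 n i 0 n i m m] i by (simp add: h_scale)
  qed
  have "1 = h (\<Sum>i\<le>n. star (U n m i 0) * U n m i 0)" by (simp add: U_col h_one)
  also have "\<dots> = (\<Sum>i\<le>n. s ^ i * ?c 0)" unfolding h_sum by (intro sum.cong refl c) simp
  also have "\<dots> = complex_of_real (\<Sum>r\<le>n. s ^ r) * ?c 0" by (simp add: sum_distrib_right)
  finally have "?c 0 = 1 / complex_of_real (\<Sum>r\<le>n. s ^ r)"
    by (metis eq_divide_imp mult.commute mult_zero_left zero_neq_one)
  then show ?thesis
    using L_Schur[of i n j i n j m m] ij c[OF ij(1)] by simp
qed

text \<open>Here \<open>R_Schur\<close> makes the squared norm independent of the row, so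
  \<open>g_star_g\<close> yields the factor s ^ j on the opposite side; hence the inverse powers.
  Row 0 adds up to 1 by \<open>U_row\<close>.\<close>

lemma R_norm:
  assumes ij: "i \<le> n" "j \<le> n"
  shows "h (U n m i j * star (U n m i j)) = (1 / s ^ j) / (\<Sum>r\<le>n. 1 / s ^ r)"
proof -
  let ?c = "\<lambda>j. h (U n m 0 j * star (U n m 0 j))"
  have c: "?c j = 1 / s ^ j * ?c 0" if i: "j \<le> n" for j
  proof -
    have sq: "complex_of_real (sqrt (w n j)) * complex_of_real (sqrt (w n j)) = w n j"
      using w_pos[OF i] by (simp add: of_real_mult[symmetric] del: of_real_mult)
    have "U n m j 0 * star (U n m j 0) = w n j *\<^sub>C (g n j * (upow D m * upow D (- m)) * star (g n j))"
      using i sq by (simp add: U_col_0 star_scaleC star_mult star_upow scaleC_simps mult.assoc)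
    also have "\<dots> = s ^ j *\<^sub>C (w n j *\<^sub>C (f n j * (upow D m * upow D (- m)) * star (f n j)))"
      by (simp add: g_star_g upow_inverse scaleC_simps mult.commute)
    also have "w n j *\<^sub>C (f n j * (upow D m * upow D (- m)) * star (f n j)) = U n m 0 j * star (U n m 0 j)"
      using i sq by (simp add: U_0 star_scaleC star_mult star_upow scaleC_simps mult.assoc)
    finally have "?c 0 = s ^ j * ?c j" using R_Schur[of j n 0 j n 0 m m] i by (simp add: h_scale)
    then show ?thesis using s_pos by simp
  qed
  have "1 = h (\<Sum>j\<le>n. U n m 0 j * star (U n m 0 j))" by (simp add: U_row h_one)
  also have "\<dots> = (\<Sum>j\<le>n. 1 / s ^ j * ?c 0)" unfolding h_sum by (intro sum.cong refl c) simp
  also have "\<dots> = complex_of_real (\<Sum>r\<le>n. 1 / s ^ r) * ?c 0" by (simp add: sum_distrib_right)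
  finally have "?c 0 = 1 / complex_of_real (\<Sum>r\<le>n. 1 / s ^ r)"
    by (metis eq_divide_imp mult.commute mult_zero_left zero_neq_one)
  then show ?thesis
    using R_Schur[of i n j i n j m m] ij c[OF ij(2)] by simp
qed

lemma L_orthogonal:
  assumes "i \<le> n" "j \<le> n" "i' \<le> n'" "j' \<le> n'"
  shows "h (star (U n m i j) * U n' m' i' j')
    = (if n = n' \<and> m = m' \<and> i = i' \<and> j = j' then s ^ i / (\<Sum>r\<le>n. s ^ r) else 0)"
proof (cases "n = n' \<and> m = m' \<and> j = j'")
  case True
  then show ?thesis
    using assms L_norm[of i n j m] L_row[of i n j i' m] by auto
next
  case False
  then show ?thesis using L_Schur[OF assms, of m m'] by auto
qed

lemma R_orthogonal:
  assumes "i \<le> n" "j \<le> n" "i' \<le> n'" "j' \<le> n'"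
  shows "h (U n m i j * star (U n' m' i' j'))
    = (if n = n' \<and> m = m' \<and> i = i' \<and> j = j' then (1 / s ^ j) / (\<Sum>r\<le>n. 1 / s ^ r) else 0)"
proof (cases "n = n' \<and> m = m' \<and> i = i'")
  case True
  then show ?thesis
    using assms R_norm[of i n j m] R_column[of i n j j' m] by auto
next
  case False
  then show ?thesis using R_Schur[OF assms, of m m'] by auto
qed

text \<open>The coordinate functional of \<open>U n m i j\<close>, obtained by dividing by the
  squared norm from \<open>L_norm\<close>. It is defined on the whole C*-algebra, so it can be
  applied to the legs of any tensor.\<close>

definition cf :: "nat \<Rightarrow> int \<Rightarrow> nat \<Rightarrow> nat \<Rightarrow> 'a \<Rightarrow> complex"
  where "cf n m i j x = h (star (U n m i j) * x) * ((\<Sum>r\<le>n. s ^ r) / s ^ i)"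

lemma cf_U:
  assumes "i \<le> n" "j \<le> n" "i' \<le> n'" "j' \<le> n'"
  shows "cf n m i j (U n' m' i' j') = (if n = n' \<and> m = m' \<and> i = i' \<and> j = j' then 1 else 0)"
proof -
  have "0 < (\<Sum>r\<le>n. s ^ r)" using s_pos by (intro sum_pos) auto
  then have "complex_of_real (s ^ i / (\<Sum>r\<le>n. s ^ r)) * complex_of_real ((\<Sum>r\<le>n. s ^ r) / s ^ i) = 1"
    using s_pos by (simp add: of_real_mult[symmetric] del: of_real_mult of_real_divide)
  then show ?thesis
    unfolding cf_def L_orthogonal[OF assms]
    by (cases "n = n' \<and> m = m' \<and> i = i' \<and> j = j'") (simp_all only: if_True if_False simp_thms of_real_0 mult_zero_left)
qed

lemma cf_linear: "linear_on UNIV (cf n m i j)"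
  using linear_onD(1)[OF h_linear]
  by (simp add: linear_on_def cf_def distrib_left distrib_right mult_scaleC_right h_scale scaleC_complex_def add_divide_distrib)

lemma cf_add: "cf n m i j (x + y) = cf n m i j x + cf n m i j y"
  using linear_onD(1)[OF cf_linear] by simp

lemma cf_scale: "cf n m i j (r *\<^sub>C x) = r * cf n m i j x"
  using linear_onD(2)[OF cf_linear] by (simp add: scaleC_complex_def)

lemma cf_sum: "cf n m i j (\<Sum>k\<in>I. x k) = (\<Sum>k\<in>I. cf n m i j (x k))"
  by (rule linear_on_sum[OF cf_linear]) simp_all

end

section \<open>Corepresentations\<close>

text \<open>The slice map id \<otimes> \<phi>.\<close>

definition slice :: "('b::complex_vector \<Rightarrow> complex) \<Rightarrow> ('a::complex_vector, 'b) tensor \<Rightarrow> 'a"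
  where "slice \<phi> = tensor_lift UNIV UNIV (\<lambda>u x. \<phi> x *\<^sub>C u)"

lemma balanced_slice: "linear_on UNIV \<phi> \<Longrightarrow> balanced UNIV UNIV (\<lambda>u x. (\<phi> x :: complex) *\<^sub>C u)"
  by (simp add: balanced_def linear_on_def scaleC_add_left scaleC_add_right scaleC_scaleC
      scaleC_complex_def mult.commute)

lemma slice_sum:
  "linear_on UNIV \<phi> \<Longrightarrow> finite I \<Longrightarrow> slice \<phi> (\<Sum>i\<in>I. x i \<otimes> y i) = (\<Sum>i\<in>I. \<phi> (y i) *\<^sub>C x i)"
  unfolding slice_def by (rule tensor_lift_sum[OF balanced_slice]) simp_all

lemma slice_elem: "linear_on UNIV \<phi> \<Longrightarrow> slice \<phi> (x \<otimes> y) = \<phi> y *\<^sub>C x"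
  using slice_sum[of \<phi> "{0::nat}" "\<lambda>_. x" "\<lambda>_. y"] by simp

lemma slice_add: "linear_on UNIV \<phi> \<Longrightarrow> slice \<phi> (s + t) = slice \<phi> s + slice \<phi> t"
  unfolding slice_def by (rule tensor_lift_add[OF balanced_slice tensor_sub_UNIV tensor_sub_UNIV])

lemma slice_scale: "linear_on UNIV \<phi> \<Longrightarrow> slice \<phi> (r *\<^sub>C t) = r *\<^sub>C slice \<phi> t"
  unfolding slice_def
  by (rule tensor_lift_scale[OF balanced_slice _ tensor_sub_UNIV]) (simp_all add: scaleC_scaleC mult.commute)

lemma slice_zero: "linear_on UNIV \<phi> \<Longrightarrow> slice \<phi> 0 = 0"
  using slice_add[of \<phi> 0 0] by simp

lemma slice_in:
  assumes "linear_on UNIV \<phi>" "csubspace W" "t \<in> tensor_sub W B"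
  shows "slice \<phi> t \<in> W"
proof -
  obtain n x y where t: "t = (\<Sum>i<n::nat. x i \<otimes> y i)" "\<And>i. i < n \<Longrightarrow> x i \<in> W"
    using tensor_subE[OF assms(3,2)] by metis
  then show ?thesis
    using assms(1,2) by (auto simp: slice_sum intro!: cvec.subspace_sum cvec.subspace_scale)
qed

lemma balanced_assoc_inner: "balanced UNIV UNIV (\<lambda>x y. x \<otimes> (y \<otimes> z))"
  by (simp add: balanced_def tensor_add_left tensor_add_right tensor_scale_left tensor_scale_right)

lemma balanced_assoc_outer:
  "balanced UNIV UNIV (\<lambda>t z. tensor_lift UNIV UNIV (\<lambda>x y. x \<otimes> (y \<otimes> z)) t)"
proof -
  have sum: "\<exists>n x y. t = (\<Sum>i<n::nat. x i \<otimes> y i)" for t :: "('a, 'b) tensor"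
    using tensor_subE[OF tensor_sub_UNIV[of t] csubspace_UNIV] by metis
  have 1: "tensor_lift UNIV UNIV (\<lambda>x y. x \<otimes> (y \<otimes> (z + z'))) t
      = tensor_lift UNIV UNIV (\<lambda>x y. x \<otimes> (y \<otimes> z)) t + tensor_lift UNIV UNIV (\<lambda>x y. x \<otimes> (y \<otimes> z')) t"
    for z z' :: 'c and t :: "('a, 'b) tensor"
  proof -
    obtain n x y where t: "t = (\<Sum>i<n::nat. x i \<otimes> y i)" using sum by blast
    show ?thesis
      unfolding t tensor_lift_sum[OF balanced_assoc_inner finite_lessThan UNIV_I UNIV_I]
      by (simp add: tensor_add_right sum.distrib)
  qed
  have 2: "tensor_lift UNIV UNIV (\<lambda>x y. x \<otimes> (y \<otimes> z)) (r *\<^sub>C t)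
      = tensor_lift UNIV UNIV (\<lambda>x y. x \<otimes> (y \<otimes> (r *\<^sub>C z))) t"
    for z :: 'c and t :: "('a, 'b) tensor" and r
  proof -
    obtain n x y where t: "t = (\<Sum>i<n::nat. x i \<otimes> y i)" using sum by blast
    have rt: "r *\<^sub>C t = (\<Sum>i<n. (r *\<^sub>C x i) \<otimes> y i)"
      by (simp add: t cvec.scale_sum_right tensor_scale_left)
    show ?thesis
      unfolding rt unfolding t tensor_lift_sum[OF balanced_assoc_inner finite_lessThan UNIV_I UNIV_I]
      by (simp add: tensor_scale_left tensor_scale_right)
  qed
  show ?thesis
    unfolding balanced_def
    using 1 2 tensor_lift_add[OF balanced_assoc_inner tensor_sub_UNIV tensor_sub_UNIV]
    by (auto simp: cvec.subspace_UNIV)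
qed

lemma tensor_assoc_elem: "tensor_assoc (t \<otimes> z) = tensor_lift UNIV UNIV (\<lambda>x y. x \<otimes> (y \<otimes> z)) t"
  unfolding tensor_assoc_def by (rule tensor_lift_elem[OF balanced_assoc_outer]) simp_all

lemma tensor_assoc_add: "tensor_assoc (s + t) = tensor_assoc s + tensor_assoc t"
  unfolding tensor_assoc_def by (rule tensor_lift_add[OF balanced_assoc_outer tensor_sub_UNIV tensor_sub_UNIV])

lemma tensor_assoc_sum: "finite I \<Longrightarrow> tensor_assoc (\<Sum>i\<in>I. F i) = (\<Sum>i\<in>I. tensor_assoc (F i))"
proof (induction I rule: finite_induct)
  case empty
  show ?case using tensor_assoc_add[of 0 0] by simp
qed (simp add: tensor_assoc_add)

lemma tensor_assoc_elem_sum: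
  "finite I \<Longrightarrow> tensor_assoc ((\<Sum>i\<in>I. x i \<otimes> y i) \<otimes> z) = (\<Sum>i\<in>I. x i \<otimes> (y i \<otimes> z))"
  unfolding tensor_assoc_elem by (rule tensor_lift_sum[OF balanced_assoc_inner]) simp_all

text \<open>The map id \<otimes> id \<otimes> \<phi> in the bracketing produced by
  \<open>tensor_assoc\<close>; it extracts single coefficients from the coassociativity law.\<close>

definition slice2 :: "('b::complex_vector \<Rightarrow> complex) \<Rightarrow>
    ('v::complex_vector, ('a::complex_vector, 'b) tensor) tensor \<Rightarrow> ('v, 'a) tensor"
  where "slice2 \<phi> = tensor_lift UNIV UNIV (\<lambda>v t. v \<otimes> slice \<phi> t)"

lemma balanced_slice2: "linear_on UNIV \<phi> \<Longrightarrow> balanced UNIV UNIV (\<lambda>v t. v \<otimes> slice \<phi> t)"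
  by (simp add: balanced_def slice_add slice_scale tensor_add_left tensor_add_right
      tensor_scale_left tensor_scale_right)

lemma slice2_sum:
  "linear_on UNIV \<phi> \<Longrightarrow> finite I \<Longrightarrow> slice2 \<phi> (\<Sum>i\<in>I. x i \<otimes> t i) = (\<Sum>i\<in>I. x i \<otimes> slice \<phi> (t i))"
  unfolding slice2_def by (rule tensor_lift_sum[OF balanced_slice2]) simp_all

lemma slice2_add: "linear_on UNIV \<phi> \<Longrightarrow> slice2 \<phi> (s + t) = slice2 \<phi> s + slice2 \<phi> t"
  unfolding slice2_def by (rule tensor_lift_add[OF balanced_slice2 tensor_sub_UNIV tensor_sub_UNIV])

lemma slice2_zero: "linear_on UNIV \<phi> \<Longrightarrow> slice2 \<phi> 0 = 0"
  using slice2_add[of \<phi> 0 0] by simp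

lemma tensor_assoc_zero: "tensor_assoc 0 = 0"
  using tensor_assoc_add[of 0 0] by simp

lemma slice2_assoc_sum:
  assumes "linear_on UNIV \<phi>" "finite I"
  shows "slice2 \<phi> (tensor_assoc (\<Sum>i\<in>I. t i \<otimes> z i)) = (\<Sum>i\<in>I. \<phi> (z i) *\<^sub>C t i)"
  using assms(2)
proof (induction I rule: finite_induct)
  case empty
  show ?case by (simp add: slice2_zero assms(1) tensor_assoc_zero)
next
  case (insert i I)
  obtain n x y where t: "t i = (\<Sum>k<n::nat. x k \<otimes> y k)"
    using tensor_subE[OF tensor_sub_UNIV[of "t i"] csubspace_UNIV] by metis
  have "slice2 \<phi> (tensor_assoc (t i \<otimes> z i)) = \<phi> (z i) *\<^sub>C t i"
    by (simp add: t tensor_assoc_elem_sum slice2_sum assms(1) slice_elem tensor_scale_right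
        cvec.scale_sum_right)
  with insert show ?case by (simp add: tensor_assoc_add slice2_add assms(1))
qed

section \<open>Linear extension from a finite independent family\<close>

definition independent_family :: "'i set \<Rightarrow> ('i \<Rightarrow> 'a::complex_vector) \<Rightarrow> bool"
  where "independent_family I e \<longleftrightarrow> finite I \<and> (\<forall>c. (\<Sum>i\<in>I. c i *\<^sub>C e i) = 0 \<longrightarrow> (\<forall>i\<in>I. c i = 0))"

lemma independent_familyD:
  assumes "independent_family I e" "(\<Sum>i\<in>I. c i *\<^sub>C e i) = (\<Sum>i\<in>I. d i *\<^sub>C e i)" "i \<in> I"
  shows "c i = d i"
proof -
  have "(\<Sum>i\<in>I. (c i - d i) *\<^sub>C e i) = 0"
    using assms(2) by (simp add: cvec.scale_left_diff_distrib sum_subtractf)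
  moreover have "(\<Sum>i\<in>I. r i *\<^sub>C e i) = 0 \<Longrightarrow> r i = 0" for r
    using assms(1,3) by (simp add: independent_family_def)
  from this[of "\<lambda>i. c i - d i"] calculation show ?thesis by simp
qed

lemma linear_extension_sum:
  assumes "independent_family I e"
  shows "linear_extension I e g (\<Sum>i\<in>I. c i *\<^sub>C e i) = (\<Sum>i\<in>I. c i *\<^sub>C g i)"
  unfolding linear_extension_def
proof (rule the_equality)
  fix y assume "\<exists>d. (\<Sum>i\<in>I. c i *\<^sub>C e i) = (\<Sum>i\<in>I. d i *\<^sub>C e i) \<and> y = (\<Sum>i\<in>I. d i *\<^sub>C g i)"
  then obtain d where "(\<Sum>i\<in>I. c i *\<^sub>C e i) = (\<Sum>i\<in>I. d i *\<^sub>C e i)" "y = (\<Sum>i\<in>I. d i *\<^sub>C g i)" by blast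
  then show "y = (\<Sum>i\<in>I. c i *\<^sub>C g i)"
    using independent_familyD[OF assms, of c d] by (auto intro!: sum.cong)
qed blast

lemma span_family: "finite I \<Longrightarrow> cspan (e ` I) = {\<Sum>i\<in>I. c i *\<^sub>C e i |c. True}"
proof
  assume I: "finite I"
  have mem: "x = (\<Sum>i\<in>I. c i *\<^sub>C e i) \<Longrightarrow> x \<in> {\<Sum>i\<in>I. c i *\<^sub>C e i |c. True}" for x c
    by auto
  show "cspan (e ` I) \<subseteq> {\<Sum>i\<in>I. c i *\<^sub>C e i |c. True}"
  proof (rule cvec.span_minimal)
    have "e i = (\<Sum>j\<in>I. (if j = i then 1 else 0) *\<^sub>C e j)" if "i \<in> I" for i
      using I that by (simp add: if_distrib[of "\<lambda>r. r *\<^sub>C _"] scaleC_one cong: if_cong)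
    then show "e ` I \<subseteq> {\<Sum>i\<in>I. c i *\<^sub>C e i |c. True}" by auto
    show "csubspace {\<Sum>i\<in>I. c i *\<^sub>C e i |c. True}"
      unfolding cvec.subspace_def
    proof (intro conjI ballI allI)
      have "0 = (\<Sum>i\<in>I. 0 *\<^sub>C e i)" by simp
      then show "0 \<in> {\<Sum>i\<in>I. c i *\<^sub>C e i |c. True}" by (rule mem)
    next
      fix x y assume "x \<in> {\<Sum>i\<in>I. c i *\<^sub>C e i |c. True}" "y \<in> {\<Sum>i\<in>I. c i *\<^sub>C e i |c. True}"
      then obtain c d where "x = (\<Sum>i\<in>I. c i *\<^sub>C e i)" "y = (\<Sum>i\<in>I. d i *\<^sub>C e i)" by blast
      then have "x + y = (\<Sum>i\<in>I. (c i + d i) *\<^sub>C e i)" by (simp add: scaleC_add_left sum.distrib)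
      then show "x + y \<in> {\<Sum>i\<in>I. c i *\<^sub>C e i |c. True}" by (rule mem)
    next
      fix r x assume "x \<in> {\<Sum>i\<in>I. c i *\<^sub>C e i |c. True}"
      then obtain c where "x = (\<Sum>i\<in>I. c i *\<^sub>C e i)" by blast
      then have "r *\<^sub>C x = (\<Sum>i\<in>I. (r * c i) *\<^sub>C e i)" by (simp add: cvec.scale_sum_right scaleC_scaleC)
      then show "r *\<^sub>C x \<in> {\<Sum>i\<in>I. c i *\<^sub>C e i |c. True}" by (rule mem)
    qed
  qed
next
  show "{\<Sum>i\<in>I. c i *\<^sub>C e i |c. True} \<subseteq> cspan (e ` I)"
    by (auto intro!: cvec.span_sum cvec.span_scale intro: cvec.span_base)
qed

lemma linear_on_linear_extension:
  assumes "independent_family I e"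
  shows "linear_on (cspan (e ` I)) (linear_extension I e g)"
proof -
  have I: "finite I" using assms by (simp add: independent_family_def)
  have "linear_extension I e g (x + y) = linear_extension I e g x + linear_extension I e g y"
    if xy: "x \<in> cspan (e ` I)" "y \<in> cspan (e ` I)" for x y
  proof -
    obtain c where x: "x = (\<Sum>i\<in>I. c i *\<^sub>C e i)" using xy(1) unfolding span_family[OF I] by blast
    obtain d where y: "y = (\<Sum>i\<in>I. d i *\<^sub>C e i)" using xy(2) unfolding span_family[OF I] by blast
    have "x + y = (\<Sum>i\<in>I. (c i + d i) *\<^sub>C e i)" by (simp add: x y scaleC_add_left sum.distrib)
    then show ?thesis
      unfolding x y by (simp only: linear_extension_sum[OF assms]) (simp add: scaleC_add_left sum.distrib)
  qed
  moreover have "linear_extension I e g (r *\<^sub>C x) = r *\<^sub>C linear_extension I e g x"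
    if x: "x \<in> cspan (e ` I)" for x r
  proof -
    obtain c where x: "x = (\<Sum>i\<in>I. c i *\<^sub>C e i)" using x unfolding span_family[OF I] by blast
    have "r *\<^sub>C x = (\<Sum>i\<in>I. (r * c i) *\<^sub>C e i)" by (simp add: x cvec.scale_sum_right scaleC_scaleC)
    then show ?thesis
      unfolding x by (simp only: linear_extension_sum[OF assms]) (simp add: cvec.scale_sum_right scaleC_scaleC)
  qed
  ultimately show ?thesis by (simp add: linear_on_def)
qed

section \<open>Half-integer indices and the corepresentations of the theorem\<close>

definition ix :: "nat \<Rightarrow> nat \<Rightarrow> real"
  where "ix n k = - (real n / 2) + real k"

lemma spin_range_half: "I\<^sub>s (real n / 2) = ix n ` {..n}"
  by (auto simp: spin_range_def ix_def)

lemma inj_ix: "inj_on (ix n) S"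
  by (simp add: inj_on_def ix_def)

lemma sum_spin: "(\<Sum>i\<in>I\<^sub>s (real n / 2). F i) = (\<Sum>k\<le>n. F (ix n k))"
  by (simp add: spin_range_half sum.reindex[OF inj_ix])

context uq2_haar
begin

abbreviation VV where "VV n m \<equiv> Uq2_V q a b D (real n / 2) m"

abbreviation TT where "TT n m \<equiv> Uq2_T q a b D \<Delta> (real n / 2) m"

abbreviation ff where "ff n m \<equiv> Uq2_fD q a b D (real n / 2) m"

lemma ff_ix: "k \<le> n \<Longrightarrow> ff n m (ix n k) = U n m 0 k"
proof -
  assume k: "k \<le> n"
  have 1: "nat \<lfloor>real n / 2 - ix n k\<rfloor> = n - k"
  proof -
    have "real n / 2 - ix n k = real (n - k)" using k by (simp add: of_nat_diff ix_def)
    then show ?thesis by (simp only: floor_of_nat nat_int)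
  qed
  have 2: "nat \<lfloor>real n / 2 + ix n k\<rfloor> = k" by (simp add: ix_def)
  have 3: "nat \<lfloor>2 * (real n / 2)\<rfloor> = n" by simp
  show ?thesis
    unfolding Uq2_fD_def Uq2_f_def 1 2 3 using k
    by (simp add: U_0 f_def w_def s_def mult_scaleC_left)
qed

lemma independent_U0: "independent_family {..n} (U n m 0)"
  unfolding independent_family_def
proof (intro conjI allI impI ballI)
  fix r k assume eq: "(\<Sum>i\<le>n. r i *\<^sub>C U n m 0 i) = 0" and k: "k \<in> {..n}"
  have "cf n m 0 k (\<Sum>i\<le>n. r i *\<^sub>C U n m 0 i) = (\<Sum>i\<le>n. if i = k then r k else 0)"
    unfolding cf_sum cf_scale using k by (intro sum.cong) (auto simp: cf_U)
  with eq show "r k = 0" using k cf_scale[of n m 0 k 0 0] by simp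
qed simp

lemma independent_ff: "independent_family (I\<^sub>s (real n / 2)) (ff n m)"
  unfolding independent_family_def
proof (intro conjI allI impI ballI)
  show "finite (I\<^sub>s (real n / 2))" by (simp add: spin_range_half)
  fix r i assume eq: "(\<Sum>i\<in>I\<^sub>s (real n / 2). r i *\<^sub>C ff n m i) = 0" and i: "i \<in> I\<^sub>s (real n / 2)"
  have "(\<Sum>k\<le>n. r (ix n k) *\<^sub>C U n m 0 k) = 0"
    using eq unfolding sum_spin by (simp add: ff_ix)
  then have "\<forall>k\<in>{..n}. r (ix n k) = 0"
    using independent_familyD[OF independent_U0[of n m], of "\<lambda>k. r (ix n k)" "\<lambda>_. 0"] by simp
  with i show "r i = 0" by (auto simp: spin_range_half)
qed

text \<open>The matrix coefficients are given by a choice. The inverse of \<open>ix\<close> provides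
  a witness, and the coordinate functionals of the first row show that any choice agrees with it.
  General e and T cover both \<open>Uq2_t\<close> and \<open>coeff_space\<close>.\<close>

lemma matrix_coeff_eq:
  assumes e: "\<And>k. k \<le> n \<Longrightarrow> e (ix n k) = U n m 0 k"
    and T: "\<And>k. k \<le> n \<Longrightarrow> T (U n m 0 k) = (\<Sum>r\<le>n. U n m 0 r \<otimes> U n m r k)"
    and ij: "i \<le> n" "j \<le> n"
  shows "matrix_coeff A (I\<^sub>s (real n / 2)) e T (ix n i) (ix n j) = U n m i j"
proof -
  let ?I = "I\<^sub>s (real n / 2)"
  let ?P = "\<lambda>t. \<forall>j\<in>?I. T (e j) = (\<Sum>i\<in>?I. e i \<otimes> t i j) \<and> (\<forall>i\<in>?I. t i j \<in> A)"
  define t where "t = matrix_coeff A ?I e T"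
  have "?P (\<lambda>x y. U n m (inv_into UNIV (ix n) x) (inv_into UNIV (ix n) y))"
    unfolding sum_spin by (auto simp: spin_range_half e T U_in_A inv_f_f[OF inj_ix])
  then have "?P t" unfolding t_def matrix_coeff_def by (rule someI[of ?P])
  then have "T (e (ix n j)) = (\<Sum>i\<in>?I. e i \<otimes> t i (ix n j))" using ij by (auto simp: spin_range_half)
  then have "(\<Sum>r\<le>n. U n m 0 r \<otimes> t (ix n r) (ix n j)) = (\<Sum>r\<le>n. U n m 0 r \<otimes> U n m r j)"
    unfolding sum_spin using ij by (simp add: e T)
  from tensor_coeff_right[OF _ _ cf_linear[of n m 0 i] _ this] ij
  show ?thesis by (simp add: cf_U t_def)
qed

lemma Uq2_t_eq:
  assumes "i \<le> n" "j \<le> n"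
  shows "Uq2_t q a b D \<Delta> (real n / 2) (ix n i) (ix n j) = U n 0 i j"
  unfolding Uq2_t_def
proof (rule matrix_coeff_eq[OF _ _ assms])
  fix k assume k: "k \<le> n"
  then show "Uq2_f q a b (real n / 2) (ix n k) = U n 0 0 k"
    using ff_ix[of k n 0] by (simp add: Uq2_fD_def upow_0)
  show "\<Delta> (U n 0 0 k) = (\<Sum>r\<le>n. U n 0 0 r \<otimes> U n 0 r k)" using k by (simp add: Delta_U)
qed

lemma U_upow: "U n 0 i j * upow D m = U n m i j"
  by (simp add: U_def mult_scaleC_left upow_0)

lemma TT_sum:
  "TT n m (\<Sum>k\<le>n. r k *\<^sub>C U n m 0 k) = (\<Sum>i\<le>n. U n m 0 i \<otimes> (\<Sum>k\<le>n. r k *\<^sub>C U n m i k))"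
proof -
  define r' where "r' x = r (inv_into UNIV (ix n) x)" for x
  have r': "r' (ix n k) = r k" for k by (simp add: r'_def inv_f_f[OF inj_ix])
  have "(\<Sum>k\<le>n. r k *\<^sub>C U n m 0 k) = (\<Sum>i\<in>I\<^sub>s (real n / 2). r' i *\<^sub>C ff n m i)"
    unfolding sum_spin by (intro sum.cong refl) (simp add: r' ff_ix)
  then have "TT n m (\<Sum>k\<le>n. r k *\<^sub>C U n m 0 k)
      = (\<Sum>k\<le>n. r k *\<^sub>C (\<Sum>i\<le>n. U n m 0 i \<otimes> U n m i k))"
    unfolding Uq2_T_def by (simp only: linear_extension_sum[OF independent_ff])
      (simp add: sum_spin r' ff_ix Uq2_tD_def Uq2_t_eq U_upow)
  also have "\<dots> = (\<Sum>i\<le>n. U n m 0 i \<otimes> (\<Sum>k\<le>n. r k *\<^sub>C U n m i k))"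
    unfolding cvec.scale_sum_right tensor_sum_right tensor_scale_right by (rule sum.swap)
  finally show ?thesis .
qed

lemma TT_U: "k \<le> n \<Longrightarrow> TT n m (U n m 0 k) = (\<Sum>r\<le>n. U n m 0 r \<otimes> U n m r k)"
proof -
  assume k: "k \<le> n"
  have *: "(\<Sum>j\<le>n. (if j = k then 1 else 0) *\<^sub>C U n m i j) = U n m i k" for i
    using k by (simp add: if_distrib[of "\<lambda>r. r *\<^sub>C _"] scaleC_one cong: if_cong)
  show ?thesis using TT_sum[of n m "\<lambda>j. if j = k then 1 else 0"] by (simp only: *)
qed

lemma VV_eq: "VV n m = cspan (U n m 0 ` {..n})"
proof -
  have "ff n m ` I\<^sub>s (real n / 2) = U n m 0 ` {..n}"
    unfolding spin_range_half image_image by (rule image_cong) (simp_all add: ff_ix)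
  then show ?thesis by (simp add: Uq2_V_def)
qed

lemma VV_E:
  assumes "v \<in> VV n m"
  obtains r where "v = (\<Sum>k\<le>n. r k *\<^sub>C U n m 0 k)"
  using assms unfolding VV_eq span_family[OF finite_atMost] by blast

lemma VV_I: "(\<Sum>k\<le>n. r k *\<^sub>C U n m 0 k) \<in> VV n m"
  unfolding VV_eq span_family[OF finite_atMost] by blast

lemma U_in_VV: "k \<le> n \<Longrightarrow> U n m 0 k \<in> VV n m"
  unfolding VV_eq by (rule cvec.span_base) simp

lemma VV_subspace: "csubspace (VV n m)"
  unfolding VV_eq by (rule cvec.subspace_span)

lemma TT_linear: "linear_on (VV n m) (TT n m)"
  unfolding Uq2_T_def Uq2_V_def by (rule linear_on_linear_extension[OF independent_ff])

lemma coeff_space_eq: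
  "coeff_space A (I\<^sub>s (real n / 2)) (ff n m) (TT n m) = cspan {U n m i j |i j. i \<le> n \<and> j \<le> n}"
proof -
  have "{matrix_coeff A (I\<^sub>s (real n / 2)) (ff n m) (TT n m) i j |i j. i \<in> I\<^sub>s (real n / 2) \<and> j \<in> I\<^sub>s (real n / 2)}
      = {matrix_coeff A (I\<^sub>s (real n / 2)) (ff n m) (TT n m) (ix n i) (ix n j) |i j. i \<le> n \<and> j \<le> n}"
    by (auto simp: spin_range_half)
  also have "\<dots> = {U n m i j |i j. i \<le> n \<and> j \<le> n}"
    by (rule Collect_cong) (metis matrix_coeff_eq[of n "ff n m" m "TT n m", OF ff_ix TT_U])
  finally show ?thesis by (simp add: coeff_space_def)
qed

text \<open>Both sides are linear in x and agree on the entries of \<open>U n m\<close>, by duality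
  of \<open>cf\<close>.\<close>

lemma block_expansion:
  assumes "x \<in> cspan {U n m i j |i j. i \<le> n \<and> j \<le> n}"
  shows "x = (\<Sum>i\<le>n. \<Sum>j\<le>n. cf n m i j x *\<^sub>C U n m i j)"
proof -
  define P where "P x = (\<Sum>i\<le>n. \<Sum>j\<le>n. cf n m i j x *\<^sub>C U n m i j)" for x
  have P: "P (x + y) = P x + P y" "P (r *\<^sub>C x) = r *\<^sub>C P x" for x y r
    by (simp_all add: P_def cf_add cf_scale scaleC_add_left sum.distrib cvec.scale_sum_right scaleC_scaleC)
  have "x = P x"
    using assms
  proof (induction rule: cvec.span_induct)
    case base
    have "P 0 = 0" using P(2)[of 0 0] by simp
    then show ?case using P unfolding cvec.subspace_def by simp
  next
    case (step x)
    then obtain i j where x: "x = U n m i j" "i \<le> n" "j \<le> n" by blast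
    have "P x = (\<Sum>i'\<le>n. \<Sum>j'\<le>n. if j' = j then if i' = i then x else 0 else 0)"
      unfolding P_def using x by (intro sum.cong refl) (auto simp: cf_U scaleC_one)
    then show ?case using x by simp
  qed
  then show ?thesis by (simp only: P_def)
qed

lemma cf_block_zero:
  assumes "x \<in> cspan {U n m i j |i j. i \<le> n \<and> j \<le> n}" "(n, m) \<noteq> (n', m')" "i' \<le> n'" "j' \<le> n'"
  shows "cf n' m' i' j' x = 0"
  using assms(1)
proof (induction rule: cvec.span_induct)
  case base
  have "cf n' m' i' j' 0 = 0" using cf_scale[of n' m' i' j' 0 0] by simp
  then show ?case by (auto simp: cvec.subspace_def cf_add cf_scale)
next
  case (step x)
  then show ?case using assms(2-) by (auto simp: cf_U)
qed

lemma direct_sum_coeff_spaces: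
  "direct_sum A (half_nats \<times> UNIV)
    (\<lambda>(l, m). coeff_space A (I\<^sub>s l) (Uq2_fD q a b D l m) (Uq2_T q a b D \<Delta> l m))"
  unfolding direct_sum_def
proof (intro conjI ballI allI impI)
  let ?W = "\<lambda>(l, m). coeff_space A (I\<^sub>s l) (Uq2_fD q a b D l m) (Uq2_T q a b D \<Delta> l m)"
  have half: "\<exists>n m. p = (real n / 2, m)" if "p \<in> half_nats \<times> UNIV" for p :: "real \<times> int"
    using that by (auto simp: half_nats_def)
  show "csubspace (?W p)" for p
    by (cases p) (simp add: coeff_space_def)
  show "A = cspan (\<Union>p\<in>half_nats \<times> UNIV. ?W p)"
  proof
    have "{U n m i j |n m i j. i \<le> n \<and> j \<le> n} \<subseteq> (\<Union>p\<in>half_nats \<times> UNIV. ?W p)"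
    proof
      fix x assume "x \<in> {U n m i j |n m i j. i \<le> n \<and> j \<le> n}"
      then obtain n m i j where x: "x = U n m i j" "i \<le> n" "j \<le> n" by blast
      then have "x \<in> ?W (real n / 2, m)"
        using cvec.span_base[of x "{U n m i j |i j. i \<le> n \<and> j \<le> n}"] by (auto simp: coeff_space_eq)
      moreover have "(real n / 2, m) \<in> half_nats \<times> UNIV" by (auto simp: half_nats_def)
      ultimately show "x \<in> (\<Union>p\<in>half_nats \<times> UNIV. ?W p)" by blast
    qed
    then show "A \<subseteq> cspan (\<Union>p\<in>half_nats \<times> UNIV. ?W p)"
      unfolding span_U[symmetric] by (rule cvec.span_mono)
    have "?W p \<subseteq> A" if p: "p \<in> half_nats \<times> UNIV" for p
    proof -
      obtain n m where p: "p = (real n / 2, m)" using half[OF p] by blast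
      have "cspan {U n m i j |i j. i \<le> n \<and> j \<le> n} \<subseteq> A"
        by (rule cvec.span_minimal) (auto simp: U_in_A)
      then show ?thesis by (simp add: p coeff_space_eq)
    qed
    then show "cspan (\<Union>p\<in>half_nats \<times> UNIV. ?W p) \<subseteq> A"
      by (intro cvec.span_minimal A_subspace) blast
  qed
  fix F and x :: "real \<times> int \<Rightarrow> 'a" and p
  assume F: "finite F \<and> F \<subseteq> half_nats \<times> UNIV \<and> (\<forall>p\<in>F. x p \<in> ?W p) \<and> (\<Sum>p\<in>F. x p) = 0" and p: "p \<in> F"
  obtain n m where nm: "p = (real n / 2, m)" using half F p by blast
  have xp: "x p \<in> cspan {U n m i j |i j. i \<le> n \<and> j \<le> n}"
    using F p by (auto simp: nm coeff_space_eq)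
  \<comment> \<open>A coordinate functional of the block of p annihilates all other blocks, so on
    the vanishing sum it sees only x p.\<close>
  have "cf n m i j (x p) = 0" if ij: "i \<le> n" "j \<le> n" for i j
  proof -
    have "cf n m i j (x p') = 0" if p': "p' \<in> F" "p' \<noteq> p" for p'
    proof -
      obtain n' m' where nm': "p' = (real n' / 2, m')" using half F p' by blast
      have "x p' \<in> cspan {U n' m' i j |i j. i \<le> n' \<and> j \<le> n'}"
        using F p' by (auto simp: nm' coeff_space_eq)
      then show ?thesis by (rule cf_block_zero) (use p' ij nm nm' in auto)
    qed
    then have "cf n m i j (\<Sum>p\<in>F. x p) = cf n m i j (x p)"
      unfolding cf_sum using F p by (subst sum.mono_neutral_right[of F "{p}"]) auto
    then show ?thesis using F cf_scale[of n m i j 0 0] by simp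
  qed
  then show "x p = 0" using block_expansion[OF xp] by simp
qed

end

section \<open>Irreducibility and inequivalence\<close>

locale uq2_corep = uq2_haar +
  fixes \<epsilon> :: "'a \<Rightarrow> complex"
  assumes counit: "Uq2_counit a b D \<epsilon>"
begin

lemma eps_linear: "linear_on A \<epsilon>"
  using counit by (simp add: Uq2_counit_def Let_def)

lemma eps_U: "i \<le> n \<Longrightarrow> j \<le> n \<Longrightarrow> \<epsilon> (U n m i j) = (if i = j then 1 else 0)"
  using hom_U[of \<epsilon> 0 0 i n j m] counit by (auto simp: Uq2_counit_def Let_def)

lemma balanced_counit: "csubspace V \<Longrightarrow> balanced V A (\<lambda>w x. \<epsilon> x *\<^sub>C w)"
  using eps_linear by (simp add: balanced_def linear_on_def scaleC_add_left scaleC_add_right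
      scaleC_scaleC scaleC_complex_def mult.commute)

lemma balanced_map: "csubspace V \<Longrightarrow> linear_on V F \<Longrightarrow> balanced V A (\<lambda>w x. F w \<otimes> x)"
  by (simp add: balanced_def linear_on_def tensor_add_left tensor_add_right tensor_scale_left tensor_scale_right)

lemma balanced_Delta: "csubspace V \<Longrightarrow> balanced V A (\<lambda>w x. w \<otimes> \<Delta> x)"
  using Delta_linear
  by (simp add: balanced_def linear_on_def tensor_add_left tensor_add_right tensor_scale_left tensor_scale_right)

lemma corep_TT: "corep A \<Delta> \<epsilon> (VV n m) (TT n m)"
  unfolding corep_def
proof (intro conjI ballI VV_subspace TT_linear)
  fix v assume v: "v \<in> VV n m"
  then obtain r where r: "v = (\<Sum>k\<le>n. r k *\<^sub>C U n m 0 k)" by (rule VV_E)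
  define y where "y i = (\<Sum>k\<le>n. r k *\<^sub>C U n m i k)" for i
  have T: "TT n m v = (\<Sum>i\<le>n. U n m 0 i \<otimes> y i)" unfolding r y_def by (rule TT_sum)
  have yA: "y i \<in> A" for i unfolding y_def by (auto simp: U_in_A)
  show "TT n m v \<in> tensor_sub (VV n m) A"
    unfolding T by (rule tensor_sum_in_sub) (auto simp: U_in_VV yA)
  have "tensor_lift (VV n m) A (\<lambda>w x. TT n m w \<otimes> x) (TT n m v) = (\<Sum>i\<le>n. TT n m (U n m 0 i) \<otimes> y i)"
    unfolding T by (rule tensor_lift_sum[OF balanced_map[OF VV_subspace TT_linear]]) (auto simp: U_in_VV yA)
  then have "tensor_assoc (tensor_lift (VV n m) A (\<lambda>w x. TT n m w \<otimes> x) (TT n m v))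
      = (\<Sum>i\<le>n. \<Sum>j\<le>n. U n m 0 j \<otimes> (U n m j i \<otimes> y i))"
    by (simp add: TT_U tensor_assoc_sum tensor_assoc_elem_sum)
  also have "\<dots> = (\<Sum>j\<le>n. U n m 0 j \<otimes> (\<Sum>i\<le>n. U n m j i \<otimes> y i))"
    unfolding tensor_sum_right by (rule sum.swap)
  also have "\<dots> = (\<Sum>j\<le>n. U n m 0 j \<otimes> \<Delta> (y j))"
  proof (intro sum.cong refl arg_cong[of _ _ "\<lambda>z. _ \<otimes> z"])
    fix j assume j: "j \<in> {..n}"
    have "\<Delta> (y j) = (\<Sum>k\<le>n. r k *\<^sub>C \<Delta> (U n m j k))"
      unfolding y_def by (subst linear_on_sum[OF Delta_linear A_subspace])
        (auto simp: U_in_A linear_onD(2)[OF Delta_linear])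
    also have "\<dots> = (\<Sum>k\<le>n. \<Sum>i\<le>n. U n m j i \<otimes> (r k *\<^sub>C U n m i k))"
      using j by (intro sum.cong refl) (simp add: Delta_U cvec.scale_sum_right tensor_scale_right)
    also have "\<dots> = (\<Sum>i\<le>n. U n m j i \<otimes> y i)"
      unfolding y_def tensor_sum_right by (rule sum.swap)
    finally show "(\<Sum>i\<le>n. U n m j i \<otimes> y i) = \<Delta> (y j)" ..
  qed
  also have "\<dots> = tensor_lift (VV n m) A (\<lambda>w x. w \<otimes> \<Delta> x) (TT n m v)"
    unfolding T by (rule tensor_lift_sum[OF balanced_Delta[OF VV_subspace], symmetric]) (auto simp: U_in_VV yA)
  finally show "tensor_assoc (tensor_lift (VV n m) A (\<lambda>w x. TT n m w \<otimes> x) (TT n m v))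
      = tensor_lift (VV n m) A (\<lambda>w x. w \<otimes> \<Delta> x) (TT n m v)" .
  have "tensor_lift (VV n m) A (\<lambda>w x. \<epsilon> x *\<^sub>C w) (TT n m v) = (\<Sum>i\<le>n. \<epsilon> (y i) *\<^sub>C U n m 0 i)"
    unfolding T by (rule tensor_lift_sum[OF balanced_counit[OF VV_subspace]]) (auto simp: U_in_VV yA)
  also have "\<dots> = (\<Sum>i\<le>n. r i *\<^sub>C U n m 0 i)"
  proof (intro sum.cong refl)
    fix i assume i: "i \<in> {..n}"
    have "\<epsilon> (y i) = (\<Sum>k\<le>n. r k * \<epsilon> (U n m i k))"
      unfolding y_def by (subst linear_on_sum[OF eps_linear A_subspace])
        (auto simp: U_in_A linear_onD(2)[OF eps_linear] scaleC_complex_def)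
    also have "\<dots> = (\<Sum>k\<le>n. if k = i then r i else 0)"
      using i by (intro sum.cong) (auto simp: eps_U)
    finally show "\<epsilon> (y i) *\<^sub>C U n m 0 i = r i *\<^sub>C U n m 0 i" using i by simp
  qed
  finally show "tensor_lift (VV n m) A (\<lambda>w x. \<epsilon> x *\<^sub>C w) (TT n m v) = v" using r by simp
qed

text \<open>An invariant subspace is stable under slices. If the coordinate k of v is nonzero,
  slicing the image of v with \<open>cf n m i k\<close> returns a nonzero multiple of the basis
  vector i; hence W contains the whole basis.\<close>

lemma irreducible_TT: "irreducible_corep A \<Delta> \<epsilon> (VV n m) (TT n m)"
  unfolding irreducible_corep_def
proof (intro conjI allI impI corep_TT)
  show "VV n m \<noteq> {0}" using U_in_VV[of 0 n m] U_0_nz[of 0 n m] by auto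
  fix W assume W: "csubspace W \<and> W \<subseteq> VV n m \<and> (\<forall>w\<in>W. TT n m w \<in> tensor_sub W A)"
  show "W = {0} \<or> W = VV n m"
  proof (cases "W = {0}")
    case False
    then obtain v where v: "v \<in> W" "v \<noteq> 0" using W cvec.subspace_0 by blast
    then obtain r where r: "v = (\<Sum>k\<le>n. r k *\<^sub>C U n m 0 k)" using W VV_E by blast
    obtain k where k: "k \<le> n" "r k \<noteq> 0"
      using v(2) unfolding r by (metis (no_types, lifting) atMost_iff cvec.scale_zero_left sum.neutral)
    have "U n m 0 i \<in> W" if i: "i \<le> n" for i
    proof -
      have "slice (cf n m i k) (TT n m v) \<in> W" using W v by (intro slice_in[OF cf_linear]) auto
      also have "slice (cf n m i k) (TT n m v) = (\<Sum>j\<le>n. if j = i then r k *\<^sub>C U n m 0 i else 0)"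
        unfolding r TT_sum
      proof (subst slice_sum[OF cf_linear], simp, intro sum.cong refl)
        fix j assume j: "j \<in> {..n}"
        have "cf n m i k (\<Sum>k'\<le>n. r k' *\<^sub>C U n m j k') = (\<Sum>k'\<le>n. if k' = k then if j = i then r k else 0 else 0)"
          unfolding cf_sum cf_scale using i j k by (intro sum.cong) (auto simp: cf_U)
        then show "cf n m i k (\<Sum>k'\<le>n. r k' *\<^sub>C U n m j k') *\<^sub>C U n m 0 j = (if j = i then r k *\<^sub>C U n m 0 i else 0)"
          using k by simp
      qed
      finally have "r k *\<^sub>C U n m 0 i \<in> W" using i by simp
      from cvec.subspace_scale[OF conjunct1[OF W] this, of "1 / r k"]
      show ?thesis using k by (simp add: scaleC_scaleC scaleC_one)
    qed
    then have "VV n m \<subseteq> W" unfolding VV_eq using W by (intro cvec.span_minimal) auto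
    with W show ?thesis by blast
  qed simp
qed

text \<open>The image of F u, for the basis vector u = \<open>U n m 0 0\<close>, is sliced with
  \<open>cf n m 0 0\<close>. Through the intertwining property this is F u, while in the other block
  the functional vanishes; so F u = 0, against injectivity.\<close>

lemma inequivalent_TT:
  assumes "(n, m) \<noteq> (n', m')"
  shows "\<not> equivalent_corep A (VV n m) (TT n m) (VV n' m') (TT n' m')"
proof
  assume "equivalent_corep A (VV n m) (TT n m) (VV n' m') (TT n' m')"
  then obtain F where F: "linear_on (VV n m) F" "bij_betw F (VV n m) (VV n' m')"
    "\<And>v. v \<in> VV n m \<Longrightarrow> TT n' m' (F v) = tensor_lift (VV n m) A (\<lambda>w x. F w \<otimes> x) (TT n m v)"
    unfolding equivalent_corep_def by blast
  have "F (U n m 0 0) \<in> VV n' m'" using F(2) U_in_VV[of 0 n m] by (auto simp: bij_betw_def)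
  then obtain r where r: "F (U n m 0 0) = (\<Sum>k\<le>n'. r k *\<^sub>C U n' m' 0 k)" by (rule VV_E)
  have "TT n' m' (F (U n m 0 0)) = (\<Sum>j\<le>n. F (U n m 0 j) \<otimes> U n m j 0)"
    unfolding F(3)[OF U_in_VV[OF le0]] TT_U[OF le0]
    by (rule tensor_lift_sum[OF balanced_map[OF VV_subspace F(1)]]) (auto simp: U_in_VV U_in_A)
  then have "slice (cf n m 0 0) (TT n' m' (F (U n m 0 0))) = (\<Sum>j\<le>n. if j = 0 then F (U n m 0 0) else 0)"
    by (simp only: slice_sum[OF cf_linear finite_atMost]) (intro sum.cong, auto simp: cf_U scaleC_one)
  moreover have "slice (cf n m 0 0) (TT n' m' (F (U n m 0 0))) = 0"
    unfolding r TT_sum slice_sum[OF cf_linear finite_atMost] cf_sum cf_scale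
    using assms by (intro sum.neutral ballI) (auto simp: cf_U intro!: sum.neutral)
  ultimately have "F (U n m 0 0) = 0" by simp
  moreover have "F 0 = 0" using linear_on_zero[OF F(1) cvec.subspace_0[OF VV_subspace]] .
  ultimately have "U n m 0 0 = 0"
    using F(2) U_in_VV[of 0 n m] cvec.subspace_0[OF VV_subspace, of n m] by (auto simp: bij_betw_def inj_on_def)
  with U_0_nz[of 0 n m] show False by simp
qed

end

context uq2_haar
begin

section \<open>Finite expansions of algebra elements and of tensors\<close>

definition Idx :: "(nat \<times> int \<times> nat \<times> nat) set"
  where "Idx = {(n, m, i, j). i \<le> n \<and> j \<le> n}"

definition Uq :: "nat \<times> int \<times> nat \<times> nat \<Rightarrow> 'a"
  where "Uq = (\<lambda>(n, m, i, j). U n m i j)"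

definition cfq :: "nat \<times> int \<times> nat \<times> nat \<Rightarrow> 'a \<Rightarrow> complex"
  where "cfq = (\<lambda>(n, m, i, j). cf n m i j)"

lemma cfq_Uq: "p \<in> Idx \<Longrightarrow> p' \<in> Idx \<Longrightarrow> cfq p (Uq p') = (if p = p' then 1 else 0)"
  by (cases p; cases p') (simp add: Idx_def Uq_def cfq_def cf_U)

lemma cfq_linear: "linear_on UNIV (cfq p)"
  by (cases p) (simp add: cfq_def cf_linear)

lemma Uq_in_A: "p \<in> Idx \<Longrightarrow> Uq p \<in> A"
  by (auto simp: Idx_def Uq_def U_in_A)

text \<open>The expansion is asserted over every finite index set containing F, so that several
  elements can be expanded over a common set.\<close>

lemma expansion:
  assumes "x \<in> A"
  shows "\<exists>F. finite F \<and> F \<subseteq> Idx \<and> (\<forall>G. finite G \<longrightarrow> F \<subseteq> G \<longrightarrow> G \<subseteq> Idx \<longrightarrow> x = (\<Sum>p\<in>G. cfq p x *\<^sub>C Uq p))"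
proof -
  define P where "P G x = (\<Sum>p\<in>G. cfq p x *\<^sub>C Uq p)" for G x
  have P: "P G (x + y) = P G x + P G y" "P G (r *\<^sub>C x) = r *\<^sub>C P G x" for G x y r
    using linear_onD[OF cfq_linear]
    by (simp_all add: P_def scaleC_add_left sum.distrib cvec.scale_sum_right scaleC_scaleC scaleC_complex_def)
  have "x \<in> cspan {U n m i j |n m i j. i \<le> n \<and> j \<le> n}" using assms by (simp add: span_U)
  then have "\<exists>F. finite F \<and> F \<subseteq> Idx \<and> (\<forall>G. finite G \<longrightarrow> F \<subseteq> G \<longrightarrow> G \<subseteq> Idx \<longrightarrow> x = P G x)"
  proof (induction rule: cvec.span_induct)
    case base
    show ?case
      unfolding cvec.subspace_def mem_Collect_eq
    proof (intro conjI allI ballI impI)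
      have "P G 0 = 0" for G using P(2)[of G 0 0] by simp
      then show "\<exists>F. finite F \<and> F \<subseteq> Idx \<and> (\<forall>G. finite G \<longrightarrow> F \<subseteq> G \<longrightarrow> G \<subseteq> Idx \<longrightarrow> 0 = P G 0)"
        by (intro exI[of _ "{}"]) simp
    next
      fix x y
      assume "x \<in> {x. \<exists>F. finite F \<and> F \<subseteq> Idx \<and> (\<forall>G. finite G \<longrightarrow> F \<subseteq> G \<longrightarrow> G \<subseteq> Idx \<longrightarrow> x = P G x)}"
        "y \<in> {x. \<exists>F. finite F \<and> F \<subseteq> Idx \<and> (\<forall>G. finite G \<longrightarrow> F \<subseteq> G \<longrightarrow> G \<subseteq> Idx \<longrightarrow> x = P G x)}"
      then obtain F F' where
        "finite F" "F \<subseteq> Idx" "\<And>G. finite G \<Longrightarrow> F \<subseteq> G \<Longrightarrow> G \<subseteq> Idx \<Longrightarrow> x = P G x"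
        "finite F'" "F' \<subseteq> Idx" "\<And>G. finite G \<Longrightarrow> F' \<subseteq> G \<Longrightarrow> G \<subseteq> Idx \<Longrightarrow> y = P G y"
        by auto
      then show "\<exists>F. finite F \<and> F \<subseteq> Idx \<and> (\<forall>G. finite G \<longrightarrow> F \<subseteq> G \<longrightarrow> G \<subseteq> Idx \<longrightarrow> x + y = P G (x + y))"
        by (intro exI[of _ "F \<union> F'"]) (simp add: P(1))
    next
      fix r x
      assume "x \<in> {x. \<exists>F. finite F \<and> F \<subseteq> Idx \<and> (\<forall>G. finite G \<longrightarrow> F \<subseteq> G \<longrightarrow> G \<subseteq> Idx \<longrightarrow> x = P G x)}"
      then obtain F where
        F: "finite F" "F \<subseteq> Idx" "\<And>G. finite G \<Longrightarrow> F \<subseteq> G \<Longrightarrow> G \<subseteq> Idx \<Longrightarrow> x = P G x"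
        by auto
      then show "\<exists>F. finite F \<and> F \<subseteq> Idx \<and> (\<forall>G. finite G \<longrightarrow> F \<subseteq> G \<longrightarrow> G \<subseteq> Idx \<longrightarrow> r *\<^sub>C x = P G (r *\<^sub>C x))"
        unfolding P(2) by (intro exI[of _ F] conjI allI impI arg_cong[of _ _ "\<lambda>z. r *\<^sub>C z"]) auto
    qed
  next
    case (step x)
    then obtain p where p: "p \<in> Idx" "x = Uq p" by (auto simp: Idx_def Uq_def)
    have "x = P G x" if "finite G" "{p} \<subseteq> G" "G \<subseteq> Idx" for G
    proof -
      have "P G x = (\<Sum>p'\<in>G. if p' = p then x else 0)"
        unfolding P_def using that p by (intro sum.cong refl) (auto simp: cfq_Uq scaleC_one)
      then show ?thesis using that by simp
    qed
    then show ?case using p by (intro exI[of _ "{p}"]) auto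
  qed
  then show ?thesis by (simp only: P_def)
qed

lemma tensor_expansion:
  fixes t :: "('v::complex_vector, 'a) tensor"
  assumes "t \<in> tensor_sub V A" "csubspace V"
  shows "\<exists>F. finite F \<and> F \<subseteq> Idx \<and>
    (\<forall>G. finite G \<longrightarrow> F \<subseteq> G \<longrightarrow> G \<subseteq> Idx \<longrightarrow> t = (\<Sum>p\<in>G. slice (cfq p) t \<otimes> Uq p))"
proof -
  obtain N x y where t: "t = (\<Sum>k<N::nat. x k \<otimes> y k)" "\<And>k. k < N \<Longrightarrow> y k \<in> A"
    using tensor_subE[OF assms] by metis
  have "\<forall>k\<in>{..<N}. \<exists>F. finite F \<and> F \<subseteq> Idx \<and> (\<forall>G. finite G \<longrightarrow> F \<subseteq> G \<longrightarrow> G \<subseteq> Idx \<longrightarrow> y k = (\<Sum>p\<in>G. cfq p (y k) *\<^sub>C Uq p))"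
    using expansion t(2) by blast
  from bchoice[OF this] obtain F where
    "\<forall>k\<in>{..<N}. finite (F k) \<and> F k \<subseteq> Idx \<and> (\<forall>G. finite G \<longrightarrow> F k \<subseteq> G \<longrightarrow> G \<subseteq> Idx \<longrightarrow> y k = (\<Sum>p\<in>G. cfq p (y k) *\<^sub>C Uq p))" ..
  then have F: "finite (F k)" "F k \<subseteq> Idx"
    "finite G \<Longrightarrow> F k \<subseteq> G \<Longrightarrow> G \<subseteq> Idx \<Longrightarrow> y k = (\<Sum>p\<in>G. cfq p (y k) *\<^sub>C Uq p)" if "k < N" for k G
    using that by simp_all
  have "t = (\<Sum>p\<in>G. slice (cfq p) t \<otimes> Uq p)" if G: "finite G" "(\<Union>k<N. F k) \<subseteq> G" "G \<subseteq> Idx" for G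
  proof -
    have "t = (\<Sum>k<N. x k \<otimes> (\<Sum>p\<in>G. cfq p (y k) *\<^sub>C Uq p))"
      unfolding t(1)
    proof (intro sum.cong refl arg_cong[of _ _ "\<lambda>z. _ \<otimes> z"])
      fix k assume "k \<in> {..<N}"
      then show "y k = (\<Sum>p\<in>G. cfq p (y k) *\<^sub>C Uq p)" using G by (intro F(3)) auto
    qed
    also have "\<dots> = (\<Sum>p\<in>G. (\<Sum>k<N. cfq p (y k) *\<^sub>C x k) \<otimes> Uq p)"
      unfolding tensor_sum_left tensor_sum_right tensor_scale_left tensor_scale_right by (rule sum.swap)
    also have "\<dots> = (\<Sum>p\<in>G. slice (cfq p) t \<otimes> Uq p)"
      unfolding t(1) slice_sum[OF cfq_linear finite_lessThan] ..
    finally show ?thesis .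
  qed
  moreover have "finite (\<Union>k<N. F k)" "(\<Union>k<N. F k) \<subseteq> Idx" using F by auto
  ultimately show ?thesis by blast
qed

end

context uq2_corep
begin

text \<open>
  The components \<open>w i\<close> of \<open>T v\<close> along the column \<open>U n m i j\<close>, \<open>i \<le> n\<close>, transform like the basis of
  \<open>VV n m\<close>. By the counit property some diagonal component of a nonzero vector \<open>v\<close> does not vanish.
\<close>

lemma corep_column:
  fixes T :: "'v::complex_vector \<Rightarrow> ('v, 'a) tensor"
  assumes T: "corep A \<Delta> \<epsilon> V T" and v: "v \<in> V" "v \<noteq> 0"
  obtains n m j w where "j \<le> n" "w j \<noteq> 0" "\<And>i. w i \<in> V"
    "\<And>k. k \<le> n \<Longrightarrow> T (w k) = (\<Sum>i\<le>n. w i \<otimes> U n m i k)"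
proof -
  have V: "csubspace V" and lin: "linear_on V T" and Tv: "T v \<in> tensor_sub V A"
    and coassoc: "tensor_assoc (tensor_lift V A (\<lambda>w x. T w \<otimes> x) (T v)) = tensor_lift V A (\<lambda>w x. w \<otimes> \<Delta> x) (T v)"
    and counit_v: "tensor_lift V A (\<lambda>w x. \<epsilon> x *\<^sub>C w) (T v) = v"
    using T v(1) by (auto simp: corep_def)
  obtain F where F: "finite F" "F \<subseteq> Idx"
    "\<And>G. finite G \<Longrightarrow> F \<subseteq> G \<Longrightarrow> G \<subseteq> Idx \<Longrightarrow> T v = (\<Sum>p\<in>G. slice (cfq p) (T v) \<otimes> Uq p)"
    using tensor_expansion[OF Tv V] by blast
  define c where "c p = slice (cfq p) (T v)" for p
  have cV: "c p \<in> V" for p unfolding c_def by (rule slice_in[OF cfq_linear V Tv])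
  have "tensor_lift V A (\<lambda>w x. \<epsilon> x *\<^sub>C w) (\<Sum>p\<in>F. c p \<otimes> Uq p) = (\<Sum>p\<in>F. \<epsilon> (Uq p) *\<^sub>C c p)"
    using F(2) by (intro tensor_lift_sum[OF balanced_counit[OF V] F(1)] cV Uq_in_A) auto
  then have "(\<Sum>p\<in>F. \<epsilon> (Uq p) *\<^sub>C c p) = v"
    using counit_v F(3)[OF F(1) subset_refl F(2)] by (simp only: c_def)
  then obtain p where p: "p \<in> F" "\<epsilon> (Uq p) *\<^sub>C c p \<noteq> 0"
    using v(2) by (metis (no_types, lifting) sum.neutral)
  obtain n m i j where nm: "p = (n, m, i, j)" by (cases p)
  have ij: "i \<le> n" "j \<le> n" using p F(2) by (auto simp: nm Idx_def)
  have "i = j" using p(2) ij by (auto simp: nm Uq_def eps_U split: if_splits)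
  define w where "w i = c (n, m, i, j)" for i
  \<comment> \<open>F is enlarged by the whole column j, because the sum over i \<le> n needs all of
    its indices.\<close>
  define G where "G = F \<union> (\<lambda>i. (n, m, i, j)) ` {..n}"
  have G: "finite G" "F \<subseteq> G" "G \<subseteq> Idx" using F ij by (auto simp: G_def Idx_def)
  have Tv_eq: "T v = (\<Sum>p\<in>G. c p \<otimes> Uq p)" using F(3)[OF G] by (simp only: c_def)
  have main: "T (w k) = (\<Sum>i\<le>n. w i \<otimes> U n m i k)" if k: "k \<le> n" for k
  proof -
    \<comment> \<open>Evaluating the last leg of the coassociativity law at this coordinate leaves T
      (w k) on one side. On the other side only the coefficients of column j in block (n, m)
      contribute.\<close>
    let ?\<gamma> = "(n, m, k, j)"
    have "tensor_lift V A (\<lambda>w x. T w \<otimes> x) (T v) = (\<Sum>p\<in>G. T (c p) \<otimes> Uq p)"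
      unfolding Tv_eq using G(3) by (intro tensor_lift_sum[OF balanced_map[OF V lin] G(1)] cV Uq_in_A) auto
    then have "slice2 (cfq ?\<gamma>) (tensor_assoc (tensor_lift V A (\<lambda>w x. T w \<otimes> x) (T v)))
        = (\<Sum>p\<in>G. cfq ?\<gamma> (Uq p) *\<^sub>C T (c p))"
      by (simp only: slice2_assoc_sum[OF cfq_linear G(1)])
    also have "\<dots> = (\<Sum>p\<in>G. if p = ?\<gamma> then T (c ?\<gamma>) else 0)"
    proof (intro sum.cong refl)
      fix p assume "p \<in> G"
      then have "p \<in> Idx" using G(3) by blast
      moreover have "?\<gamma> \<in> Idx" using k ij by (simp add: Idx_def)
      ultimately show "cfq ?\<gamma> (Uq p) *\<^sub>C T (c p) = (if p = ?\<gamma> then T (c ?\<gamma>) else 0)"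
        by (cases "p = ?\<gamma>") (simp_all add: cfq_Uq scaleC_one)
    qed
    also have "\<dots> = T (w k)" using G(1) k by (simp add: w_def G_def)
    finally have 1: "slice2 (cfq ?\<gamma>) (tensor_assoc (tensor_lift V A (\<lambda>w x. T w \<otimes> x) (T v))) = T (w k)" .
    have "tensor_lift V A (\<lambda>w x. w \<otimes> \<Delta> x) (T v) = (\<Sum>p\<in>G. c p \<otimes> \<Delta> (Uq p))"
      unfolding Tv_eq using G(3) by (intro tensor_lift_sum[OF balanced_Delta[OF V] G(1)] cV Uq_in_A) auto
    then have 2: "slice2 (cfq ?\<gamma>) (tensor_lift V A (\<lambda>w x. w \<otimes> \<Delta> x) (T v))
        = (\<Sum>p\<in>G. c p \<otimes> slice (cfq ?\<gamma>) (\<Delta> (Uq p)))"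
      by (simp only: slice2_sum[OF cfq_linear G(1)])
    have sl: "slice (cfq ?\<gamma>) (\<Delta> (Uq (n', m', i', j'))) = (if n' = n \<and> m' = m \<and> j' = j then U n m i' k else 0)"
      if "(n', m', i', j') \<in> Idx" for n' m' i' j'
    proof -
      have ij': "i' \<le> n'" "j' \<le> n'" using that by (auto simp: Idx_def)
      have "slice (cfq ?\<gamma>) (\<Delta> (Uq (n', m', i', j'))) = (\<Sum>r\<le>n'. cf n m k j (U n' m' r j') *\<^sub>C U n' m' i' r)"
        using ij' by (simp add: Uq_def Delta_U slice_sum cfq_linear) (simp add: cfq_def)
      also have "\<dots> = (\<Sum>r\<le>n'. if r = k then (if n' = n \<and> m' = m \<and> j' = j then U n m i' k else 0) else 0)"
        using ij' ij k by (intro sum.cong refl) (auto simp: cf_U scaleC_one)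
      also have "\<dots> = (if n' = n \<and> m' = m \<and> j' = j then U n m i' k else 0)"
        using k by auto
      finally show ?thesis .
    qed
    have "(\<Sum>p\<in>G. c p \<otimes> slice (cfq ?\<gamma>) (\<Delta> (Uq p)))
        = (\<Sum>p\<in>(\<lambda>i. (n, m, i, j)) ` {..n}. c p \<otimes> slice (cfq ?\<gamma>) (\<Delta> (Uq p)))"
    proof (rule sum.mono_neutral_right[OF G(1)])
      show "(\<lambda>i. (n, m, i, j)) ` {..n} \<subseteq> G" by (simp add: G_def)
      show "\<forall>p\<in>G - (\<lambda>i. (n, m, i, j)) ` {..n}. c p \<otimes> slice (cfq ?\<gamma>) (\<Delta> (Uq p)) = 0"
      proof
        fix p assume p: "p \<in> G - (\<lambda>i. (n, m, i, j)) ` {..n}"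
        obtain n' m' i' j' where p': "p = (n', m', i', j')" by (cases p)
        have "(n', m', i', j') \<in> Idx" using p G(3) by (auto simp: p')
        moreover have "\<not> (n' = n \<and> m' = m \<and> j' = j)"
          using p \<open>(n', m', i', j') \<in> Idx\<close> by (auto simp: p' Idx_def)
        ultimately have "slice (cfq ?\<gamma>) (\<Delta> (Uq p)) = 0" by (simp only: p' sl if_False)
        then show "c p \<otimes> slice (cfq ?\<gamma>) (\<Delta> (Uq p)) = 0" by (simp add: tensor_zero_right)
      qed
    qed
    also have "\<dots> = (\<Sum>i\<le>n. c (n, m, i, j) \<otimes> slice (cfq ?\<gamma>) (\<Delta> (Uq (n, m, i, j))))"
      by (subst sum.reindex) (auto simp: inj_on_def)
    also have "\<dots> = (\<Sum>i\<le>n. w i \<otimes> U n m i k)"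
      using ij by (intro sum.cong refl) (simp add: sl Idx_def w_def)
    finally show ?thesis using 1 2 coassoc by simp
  qed
  show thesis
  proof (rule that[of j n w m])
    show "w j \<noteq> 0" using p(2) \<open>i = j\<close> by (auto simp: nm w_def)
  qed (use ij main cV in \<open>auto simp: w_def\<close>)
qed

text \<open>The vectors of \<open>corep_column\<close> span a nonzero invariant subspace, hence all
  of V, which is therefore finite-dimensional. They transform by the matrix \<open>U n m\<close>, so
  sending w i to \<open>U n m 0 i\<close> gives the equivalence.\<close>

lemma irreducible_classification:
  fixes T :: "'v::complex_vector \<Rightarrow> ('v, 'a) tensor"
  assumes irr: "irreducible_corep A \<Delta> \<epsilon> V T"
  shows "\<exists>n m. equivalent_corep A V T (VV n m) (TT n m)"
proof -
  have T: "corep A \<Delta> \<epsilon> V T" and nz: "V \<noteq> {0}"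
    and irred: "\<And>W. csubspace W \<Longrightarrow> W \<subseteq> V \<Longrightarrow> (\<And>w. w \<in> W \<Longrightarrow> T w \<in> tensor_sub W A) \<Longrightarrow> W = {0} \<or> W = V"
    using irr by (auto simp: irreducible_corep_def)
  have V: "csubspace V" and lin: "linear_on V T" using T by (auto simp: corep_def)
  obtain v where v: "v \<in> V" "v \<noteq> 0" using nz cvec.subspace_0[OF V] by blast
  obtain n m j w where w: "j \<le> n" "w j \<noteq> 0" "\<And>i. w i \<in> V"
    "\<And>k. k \<le> n \<Longrightarrow> T (w k) = (\<Sum>i\<le>n. w i \<otimes> U n m i k)"
    by (rule corep_column[OF T v]) (rule that)
  have T_sum: "T (\<Sum>k\<le>n. r k *\<^sub>C w k) = (\<Sum>i\<le>n. w i \<otimes> (\<Sum>k\<le>n. r k *\<^sub>C U n m i k))" for r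
  proof -
    have "T (\<Sum>k\<le>n. r k *\<^sub>C w k) = (\<Sum>k\<le>n. r k *\<^sub>C (\<Sum>i\<le>n. w i \<otimes> U n m i k))"
      using w V by (subst linear_on_sum[OF lin V]) (auto simp: linear_onD(2)[OF lin] cvec.subspace_scale)
    also have "\<dots> = (\<Sum>i\<le>n. w i \<otimes> (\<Sum>k\<le>n. r k *\<^sub>C U n m i k))"
      unfolding cvec.scale_sum_right tensor_sum_right tensor_scale_right by (rule sum.swap)
    finally show ?thesis .
  qed
  have T0: "T 0 = 0" by (rule linear_on_zero[OF lin cvec.subspace_0[OF V]])
  \<comment> \<open>Applying T to a linear relation and slicing with \<open>cf n m j k\<close>
    isolates the coefficient r k in front of the nonzero vector w j.\<close>
  have indep: "independent_family {..n} w"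
    unfolding independent_family_def
  proof (intro conjI allI impI ballI)
    fix r k assume eq: "(\<Sum>i\<le>n. r i *\<^sub>C w i) = 0" and k: "k \<in> {..n}"
    have "slice (cf n m j k) (T (\<Sum>i\<le>n. r i *\<^sub>C w i)) = (\<Sum>i\<le>n. if i = j then r k *\<^sub>C w j else 0)"
      unfolding T_sum slice_sum[OF cf_linear finite_atMost]
    proof (intro sum.cong refl)
      fix i assume i: "i \<in> {..n}"
      have "cf n m j k (\<Sum>k'\<le>n. r k' *\<^sub>C U n m i k') = (\<Sum>k'\<le>n. if k' = k then if i = j then r k else 0 else 0)"
        unfolding cf_sum cf_scale using i k w(1) by (intro sum.cong) (auto simp: cf_U)
      then show "cf n m j k (\<Sum>k'\<le>n. r k' *\<^sub>C U n m i k') *\<^sub>C w i = (if i = j then r k *\<^sub>C w j else 0)"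
        using k by simp
    qed
    then have "r k *\<^sub>C w j = 0" using w(1) by (simp add: eq T0 slice_zero cf_linear)
    then show "r k = 0" using w(2) by simp
  qed simp
  have span: "cspan (w ` {..n}) = V"
  proof -
    have "cspan (w ` {..n}) = {0} \<or> cspan (w ` {..n}) = V"
    proof (rule irred)
      show "cspan (w ` {..n}) \<subseteq> V" using w(3) V by (intro cvec.span_minimal) auto
      fix x assume "x \<in> cspan (w ` {..n})"
      then obtain r where r: "x = (\<Sum>k\<le>n. r k *\<^sub>C w k)" unfolding span_family[OF finite_atMost] by blast
      show "T x \<in> tensor_sub (cspan (w ` {..n})) A"
        unfolding r T_sum by (rule tensor_sum_in_sub) (auto intro: cvec.span_base simp: U_in_A)
    qed simp
    moreover have "w j \<in> cspan (w ` {..n})" using w(1) by (intro cvec.span_base) auto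
    ultimately show ?thesis using w(2) by auto
  qed
  define F where "F = linear_extension {..n} w (U n m 0)"
  have F_sum: "F (\<Sum>k\<le>n. r k *\<^sub>C w k) = (\<Sum>k\<le>n. r k *\<^sub>C U n m 0 k)" for r
    unfolding F_def by (rule linear_extension_sum[OF indep])
  have F_lin: "linear_on V F"
    using linear_on_linear_extension[OF indep, of "U n m 0"] by (simp add: F_def span)
  have V_E: "\<exists>r. x = (\<Sum>k\<le>n. r k *\<^sub>C w k)" if "x \<in> V" for x
    using that unfolding span[symmetric] span_family[OF finite_atMost] by blast
  have V_I: "(\<Sum>k\<le>n. r k *\<^sub>C w k) \<in> V" for r
    unfolding span[symmetric] span_family[OF finite_atMost] by blast
  have Fw: "F (w i) = U n m 0 i" if "i \<le> n" for i
  proof -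
    have "(\<Sum>k\<le>n. (if k = i then 1 else 0) *\<^sub>C w k) = w i"
      "(\<Sum>k\<le>n. (if k = i then 1 else 0) *\<^sub>C U n m 0 k) = U n m 0 i"
      using that by (simp_all add: if_distrib[of "\<lambda>r. r *\<^sub>C _"] scaleC_one cong: if_cong)
    then show ?thesis using F_sum[of "\<lambda>k. if k = i then 1 else 0"] by (simp only:)
  qed
  have "bij_betw F V (VV n m)"
    unfolding bij_betw_def
  proof
    show "inj_on F V"
    proof (rule inj_onI)
      fix x y assume "x \<in> V" "y \<in> V" and eq: "F x = F y"
      then obtain r t where x: "x = (\<Sum>k\<le>n. r k *\<^sub>C w k)" and y: "y = (\<Sum>k\<le>n. t k *\<^sub>C w k)"
        using V_E by meson
      have "r k = t k" if "k \<in> {..n}" for k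
        using independent_familyD[OF independent_U0 _ that] eq unfolding x y F_sum by blast
      then show "x = y" unfolding x y by (intro sum.cong) auto
    qed
    show "F ` V = VV n m"
    proof
      show "F ` V \<subseteq> VV n m"
      proof
        fix y assume "y \<in> F ` V"
        then obtain x where "x \<in> V" "y = F x" by blast
        then obtain r where "y = F (\<Sum>k\<le>n. r k *\<^sub>C w k)" using V_E by metis
        then show "y \<in> VV n m" by (simp add: F_sum VV_I)
      qed
      show "VV n m \<subseteq> F ` V"
      proof
        fix y assume "y \<in> VV n m"
        then obtain r where "y = (\<Sum>k\<le>n. r k *\<^sub>C U n m 0 k)" by (rule VV_E)
        then have "y = F (\<Sum>k\<le>n. r k *\<^sub>C w k)" by (simp add: F_sum)
        then show "y \<in> F ` V" using V_I by blast
      qed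
    qed
  qed
  moreover have "TT n m (F x) = tensor_lift V A (\<lambda>w x. F w \<otimes> x) (T x)" if x: "x \<in> V" for x
  proof -
    obtain r where r: "x = (\<Sum>k\<le>n. r k *\<^sub>C w k)" using V_E[OF x] by blast
    have "tensor_lift V A (\<lambda>w x. F w \<otimes> x) (T x) = (\<Sum>i\<le>n. F (w i) \<otimes> (\<Sum>k\<le>n. r k *\<^sub>C U n m i k))"
      unfolding r T_sum
      by (rule tensor_lift_sum[OF balanced_map[OF V F_lin]]) (auto simp: w(3) U_in_A)
    then show ?thesis unfolding r F_sum TT_sum by (simp add: Fw)
  qed
  ultimately show ?thesis unfolding equivalent_corep_def using F_lin by blast
qed

end

text \<open>The two forms match the denominators of \<open>L_norm\<close> and \<open>R_norm\<close>;
  the first arises by reversing the order of summation.\<close>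

lemma q_number_eq:
  assumes "0 < r"
  shows "q_number r n = (\<Sum>k\<le>n. (r\<^sup>2) ^ k) / r ^ n" "q_number r n = r ^ n * (\<Sum>k\<le>n. 1 / (r\<^sup>2) ^ k)"
proof -
  have nz: "r \<noteq> 0" using assms by simp
  have 1: "r powi (int n - 2 * int k) = r ^ n * (1 / (r\<^sup>2) ^ k)" for k
  proof -
    have "int n - 2 * int k = int n - int (2 * k)" by simp
    then show ?thesis
      using nz by (simp only: power_int_diff power_int_of_nat power_mult simp_thms) simp
  qed
  show "q_number r n = r ^ n * (\<Sum>k\<le>n. 1 / (r\<^sup>2) ^ k)"
    by (simp only: q_number_def 1 sum_distrib_left)
  have 2: "r powi (int n - 2 * int (n - k)) = (r\<^sup>2) ^ k / r ^ n" if "k \<le> n" for k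
  proof -
    have "int n - 2 * int (n - k) = int (2 * k) - int n" using that by (simp add: of_nat_diff)
    then show ?thesis
      using nz by (simp only: power_int_diff power_int_of_nat power_mult simp_thms)
  qed
  have "q_number r n = (\<Sum>k\<le>n. r powi (int n - 2 * int (n - k)))"
    unfolding q_number_def by (rule sum.reindex_bij_witness[of _ "\<lambda>k. n - k" "\<lambda>k. n - k"]) auto
  also have "\<dots> = (\<Sum>k\<le>n. (r\<^sup>2) ^ k / r ^ n)" by (rule sum.cong[OF refl]) (rule 2, simp)
  finally show "q_number r n = (\<Sum>k\<le>n. (r\<^sup>2) ^ k) / r ^ n" by (simp add: sum_divide_distrib)
qed

lemma powr_ix:
  assumes "0 < r"
  shows "r powr (2 * ix n k) = (r\<^sup>2) ^ k / r ^ n" "r powr (- 2 * ix n k) = r ^ n / (r\<^sup>2) ^ k"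
proof -
  have e: "2 * ix n k = real (2 * k) - real n" "- 2 * ix n k = real n - real (2 * k)"
    by (simp_all add: ix_def)
  show "r powr (2 * ix n k) = (r\<^sup>2) ^ k / r ^ n" "r powr (- 2 * ix n k) = r ^ n / (r\<^sup>2) ^ k"
    unfolding e powr_diff powr_realpow[OF assms] power_mult by simp_all
qed

context uq2_haar
begin

lemma inner_R_U:
  assumes "i \<le> n" "j \<le> n" "i' \<le> n'" "j' \<le> n'"
  shows "inner_R h (U n m i j) (U n' m' i' j') = (if n = n' \<and> m = m' \<and> i = i' \<and> j = j'
    then complex_of_real (cmod q powr (- 2 * ix n j) / q_number (cmod q) n) else 0)"
proof -
  have "(1 / s ^ j) / (\<Sum>r\<le>n. 1 / s ^ r) = cmod q powr (- 2 * ix n j) / q_number (cmod q) n"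
    unfolding powr_ix[OF q_pos] q_number_eq(2)[OF q_pos] s_def using q_pos by simp
  then show ?thesis
    unfolding inner_R_def R_orthogonal[OF assms]
    by (cases "n = n' \<and> m = m' \<and> i = i' \<and> j = j'")
       (simp_all only: if_True if_False simp_thms complex_cnj_complex_of_real of_real_0 complex_cnj_zero)
qed

lemma inner_L_U:
  assumes "i \<le> n" "j \<le> n" "i' \<le> n'" "j' \<le> n'"
  shows "inner_L h (U n m i j) (U n' m' i' j') = (if n = n' \<and> m = m' \<and> i = i' \<and> j = j'
    then complex_of_real (cmod q powr (2 * ix n i) / q_number (cmod q) n) else 0)"
proof -
  have "s ^ i / (\<Sum>r\<le>n. s ^ r) = cmod q powr (2 * ix n i) / q_number (cmod q) n"
    unfolding powr_ix[OF q_pos] q_number_eq(1)[OF q_pos] s_def using q_pos by simp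
  then show ?thesis
    unfolding inner_L_def L_orthogonal[OF assms]
    by (cases "n = n' \<and> m = m' \<and> i = i' \<and> j = j'") (simp_all only: if_True if_False simp_thms of_real_0)
qed

lemma q_number_pos: "0 < q_number (cmod q) n"
  unfolding q_number_def using q_pos by (intro sum_pos) auto

lemma orthonormal_basis_GNS:
  fixes \<Lambda> :: "'a \<Rightarrow> 'h::complex_hilbert"
  assumes \<Lambda>: "gns_space A h \<Lambda>"
  shows "orthonormal_basis {\<Lambda> (complex_of_real (cmod q powr (- ix n i) * sqrt (q_number (cmod q) n)) *\<^sub>C U n m i j)
    |n i j m. i \<le> n \<and> j \<le> n}" (is "orthonormal_basis ?S")
proof -
  define N where "N n i = cmod q powr (- ix n i) * sqrt (q_number (cmod q) n)" for n i
  have N: "N n i * N n i * (cmod q powr (2 * ix n i) / q_number (cmod q) n) = 1" for n i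
  proof -
    have "cmod q powr (- ix n i) * cmod q powr (- ix n i) * cmod q powr (2 * ix n i) = 1"
      using q_pos by (simp add: powr_add[symmetric])
    then show ?thesis using q_number_pos[of n] by (simp add: N_def mult_ac)
  qed
  have Nnz: "N n i \<noteq> 0" for n i using q_pos q_number_pos[of n] by (simp add: N_def)
  have lin: "linear_on A \<Lambda>" and inner: "\<And>x y. x \<in> A \<Longrightarrow> y \<in> A \<Longrightarrow> cinner (\<Lambda> x) (\<Lambda> y) = inner_L h x y"
    and dense: "closure (\<Lambda> ` A) = UNIV"
    using \<Lambda> by (auto simp: gns_space_def)
  let ?e = "\<lambda>n m i j. \<Lambda> (complex_of_real (N n i) *\<^sub>C U n m i j)"
  have orth: "cinner (?e n m i j) (?e n' m' i' j') = (if n = n' \<and> m = m' \<and> i = i' \<and> j = j' then 1 else 0)"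
    if "i \<le> n" "j \<le> n" "i' \<le> n'" "j' \<le> n'" for n m i j n' m' i' j'
  proof -
    have "cinner (?e n m i j) (?e n' m' i' j') = complex_of_real (N n i * N n' i') * inner_L h (U n m i j) (U n' m' i' j')"
      using that by (simp add: inner U_in_A inner_L_def star_scaleC scaleC_simps h_scale mult.commute)
    also have "\<dots> = (if n = n' \<and> m = m' \<and> i = i' \<and> j = j' then 1 else 0)"
    proof (cases "n = n' \<and> m = m' \<and> i = i' \<and> j = j'")
      case True
      then show ?thesis using that N[of n i]
        by (simp only: inner_L_U if_True simp_thms of_real_mult[symmetric] of_real_1)
    qed (use that in \<open>auto simp: inner_L_U\<close>)
    finally show ?thesis .
  qed
  have S: "?S = {?e n m i j |n i j m. i \<le> n \<and> j \<le> n}" by (simp only: N_def)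
  show ?thesis
    unfolding orthonormal_basis_def
  proof (intro conjI ballI)
    fix x y assume "x \<in> ?S" "y \<in> ?S"
    then obtain n i j m n' i' j' m' where
      x: "x = ?e n m i j" "i \<le> n" "j \<le> n" and y: "y = ?e n' m' i' j'" "i' \<le> n'" "j' \<le> n'"
      unfolding S by blast
    show "cinner x y = (if x = y then 1 else 0)"
    proof (cases "n = n' \<and> m = m' \<and> i = i' \<and> j = j'")
      case True
      then show ?thesis using orth[OF x(2,3) y(2,3), of m m'] by (simp add: x y)
    next
      case False
      \<comment> \<open>\<open>orthonormal_basis\<close> compares vectors and not indices, so
        different indices must give different vectors; this follows from inner products 0 against
        1.\<close>
      have "x \<noteq> y"
      proof
        assume "x = y"
        then have "cinner x y = cinner x x" by simp
        then show False
          using False orth[OF x(2,3) y(2,3), of m m'] orth[OF x(2,3) x(2,3), of m m] by (simp add: x y)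
      qed
      then show ?thesis using False orth[OF x(2,3) y(2,3), of m m'] by (auto simp: x y)
    qed
  next
    have "\<Lambda> x \<in> cspan ?S" if "x \<in> A" for x
    proof -
      have "x \<in> cspan {U n m i j |n m i j. i \<le> n \<and> j \<le> n}" using that by (simp add: span_U)
      then have "x \<in> A \<and> \<Lambda> x \<in> cspan ?S"
      proof (induction rule: cvec.span_induct)
        case base
        have "\<Lambda> 0 = 0" using linear_on_zero[OF lin] by simp
        then show ?case
          by (auto simp: cvec.subspace_def linear_onD[OF lin] cvec.span_zero intro: cvec.span_add cvec.span_scale)
      next
        case (step x)
        then obtain n m i j where x: "x = U n m i j" "i \<le> n" "j \<le> n" by blast
        have "\<Lambda> x = (1 / N n i) *\<^sub>C ?e n m i j"
          using x Nnz[of n i] by (simp add: linear_onD(2)[OF lin] U_in_A scaleC_scaleC scaleC_one)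
        moreover have "?e n m i j \<in> cspan ?S" unfolding S using x by (intro cvec.span_base) blast
        ultimately show ?case using x by (simp add: U_in_A cvec.span_scale)
      qed
      then show ?thesis by simp
    qed
    then have "closure (\<Lambda> ` A) \<subseteq> closure (cspan ?S)" by (intro closure_mono) blast
    then show "closure (cspan ?S) = UNIV" using dense by blast
  qed
qed

end

section \<open>The theorem in half-integer notation\<close>

lemma half_nats_iff: "l \<in> half_nats \<longleftrightarrow> (\<exists>n. l = real n / 2)"
  by (auto simp: half_nats_def)

theorem theorem4p17:
  fixes q :: complex and a b D :: "'a::cstar_algebra"
    and \<Delta> :: "'a \<Rightarrow> ('a, 'a) tensor" and \<epsilon> h :: "'a \<Rightarrow> complex"
    and \<Lambda> :: "'a \<Rightarrow> 'h::complex_hilbert"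
  assumes "0 < cmod q" and "cmod q < 1"
    and "Uq2_cstar q a b D"
    and "Uq2_comult q a b D \<Delta>"
    and "Uq2_counit a b D \<epsilon>"
    and "haar_state (Uq2_alg a b D) \<Delta> h"
    and "gns_space (Uq2_alg a b D) h \<Lambda>"
  shows
    "direct_sum (Uq2_alg a b D) (half_nats \<times> UNIV)
        (\<lambda>(l, m). coeff_space (Uq2_alg a b D) (I\<^sub>s l) (Uq2_fD q a b D l m) (Uq2_T q a b D \<Delta> l m))
     \<and>
     (\<forall>l\<in>half_nats. \<forall>l'\<in>half_nats. \<forall>i\<in>I\<^sub>s l. \<forall>j\<in>I\<^sub>s l. \<forall>i'\<in>I\<^sub>s l'. \<forall>j'\<in>I\<^sub>s l'. \<forall>m m'.
        inner_R h (Uq2_t q a b D \<Delta> l i j * upow D m) (Uq2_t q a b D \<Delta> l' i' j' * upow D m') =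
          (if l = l' \<and> i = i' \<and> j = j' \<and> m = m'
           then complex_of_real (cmod q powr (- 2 * j) / q_number (cmod q) (nat \<lfloor>2 * l\<rfloor>)) else 0) \<and>
        inner_L h (Uq2_t q a b D \<Delta> l i j * upow D m) (Uq2_t q a b D \<Delta> l' i' j' * upow D m') =
          (if l = l' \<and> i = i' \<and> j = j' \<and> m = m'
           then complex_of_real (cmod q powr (2 * i) / q_number (cmod q) (nat \<lfloor>2 * l\<rfloor>)) else 0))
     \<and>
     ((\<forall>l\<in>half_nats. \<forall>m.
         irreducible_corep (Uq2_alg a b D) \<Delta> \<epsilon> (Uq2_V q a b D l m) (Uq2_T q a b D \<Delta> l m)) \<and>
      (\<forall>l\<in>half_nats. \<forall>l'\<in>half_nats. \<forall>m m'. (l, m) \<noteq> (l', m') \<longrightarrow>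
         \<not> equivalent_corep (Uq2_alg a b D)
             (Uq2_V q a b D l m) (Uq2_T q a b D \<Delta> l m) (Uq2_V q a b D l' m') (Uq2_T q a b D \<Delta> l' m')) \<and>
      (\<forall>(V :: 'v::complex_vector set) T. irreducible_corep (Uq2_alg a b D) \<Delta> \<epsilon> V T \<longrightarrow>
         (\<exists>l\<in>half_nats. \<exists>m. equivalent_corep (Uq2_alg a b D)
             V T (Uq2_V q a b D l m) (Uq2_T q a b D \<Delta> l m))))
     \<and>
     orthonormal_basis {\<Lambda> (complex_of_real (cmod q powr (- i) * sqrt (q_number (cmod q) (nat \<lfloor>2 * l\<rfloor>))) *\<^sub>C
         (Uq2_t q a b D \<Delta> l i j * upow D m)) |l i j m. l \<in> half_nats \<and> i \<in> I\<^sub>s l \<and> j \<in> I\<^sub>s l}"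
proof -
  interpret uq2_corep q a b D \<Delta> h \<epsilon>
    using assms by unfold_locales
  have fl: "nat \<lfloor>2 * (real n / 2)\<rfloor> = n" for n by simp
  have t: "Uq2_t q a b D \<Delta> (real n / 2) (ix n i) (ix n j) * upow D m = U n m i j" if "i \<le> n" "j \<le> n" for n m i j
    using that by (simp add: Uq2_t_eq U_upow)
  have ix_eq: "ix n i = ix n i' \<longleftrightarrow> i = i'" for n i i'
    by (simp add: ix_def)
  have half: "(\<forall>l\<in>half_nats. P l) \<longleftrightarrow> (\<forall>n. P (real n / 2))" for P
    by (metis half_nats_iff)
  have spin: "(\<forall>i\<in>I\<^sub>s (real n / 2). P i) \<longleftrightarrow> (\<forall>i\<le>n. P (ix n i))" for n P
    by (auto simp: spin_range_half)
  have ii: "\<forall>n n'. \<forall>i\<le>n. \<forall>j\<le>n. \<forall>i'\<le>n'. \<forall>j'\<le>n'. \<forall>m m'.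
      inner_R h (U n m i j) (U n' m' i' j') =
          (if real n / 2 = real n' / 2 \<and> ix n i = ix n' i' \<and> ix n j = ix n' j' \<and> m = m'
           then complex_of_real (cmod q powr (- 2 * ix n j) / q_number (cmod q) n) else 0) \<and>
      inner_L h (U n m i j) (U n' m' i' j') =
          (if real n / 2 = real n' / 2 \<and> ix n i = ix n' i' \<and> ix n j = ix n' j' \<and> m = m'
           then complex_of_real (cmod q powr (2 * ix n i) / q_number (cmod q) n) else 0)"
    by (auto simp: inner_R_U inner_L_U ix_eq)
  have neq: "(real n / 2, m) \<noteq> (real n' / 2, m') \<longleftrightarrow> (n, m) \<noteq> (n', m')" for n n' and m m' :: int
    by simp
  define E where "E l i j m = \<Lambda> (complex_of_real (cmod q powr (- i) * sqrt (q_number (cmod q) (nat \<lfloor>2 * l\<rfloor>))) *\<^sub>C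
      (Uq2_t q a b D \<Delta> l i j * upow D m))" for l i j m
  have E: "E (real n / 2) (ix n i) (ix n j) m
      = \<Lambda> (complex_of_real (cmod q powr (- ix n i) * sqrt (q_number (cmod q) n)) *\<^sub>C U n m i j)"
    if "i \<le> n" "j \<le> n" for n i j m
    unfolding E_def fl t[OF that] ..
  have "{E l i j m |l i j m. l \<in> half_nats \<and> i \<in> I\<^sub>s l \<and> j \<in> I\<^sub>s l}
      = {E (real n / 2) (ix n i) (ix n j) m |n i j m. i \<le> n \<and> j \<le> n}"
    unfolding half_nats_def
  proof (intro set_eqI iffI; elim CollectE exE conjE)
    fix x l i j m n assume x: "x = E l i j m" "i \<in> I\<^sub>s l" "j \<in> I\<^sub>s l" "l = real n / 2"
    then obtain i' j' where "i = ix n i'" "j = ix n j'" "i' \<le> n" "j' \<le> n"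
      by (auto simp: spin_range_half)
    with x show "x \<in> {E (real n / 2) (ix n i) (ix n j) m |n i j m. i \<le> n \<and> j \<le> n}" by blast
  next
    fix x n i j m assume x: "x = E (real n / 2) (ix n i) (ix n j) m" "i \<le> n" "j \<le> n"
    then have "ix n i \<in> I\<^sub>s (real n / 2)" "ix n j \<in> I\<^sub>s (real n / 2)" by (auto simp: spin_range_half)
    with x show "x \<in> {E l i j m |l i j m. l \<in> {real n / 2 |n. True} \<and> i \<in> I\<^sub>s l \<and> j \<in> I\<^sub>s l}" by blast
  qed
  also have "\<dots> = {\<Lambda> (complex_of_real (cmod q powr (- ix n i) * sqrt (q_number (cmod q) n)) *\<^sub>C U n m i j) |n i j m. i \<le> n \<and> j \<le> n}"
    by (rule Collect_cong) (metis E)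
  finally have iv: "orthonormal_basis {E l i j m |l i j m. l \<in> half_nats \<and> i \<in> I\<^sub>s l \<and> j \<in> I\<^sub>s l}"
    using orthonormal_basis_GNS[OF assms(7)] by (simp only:)
  show ?thesis
  proof (intro conjI, goal_cases)
    case 1
    show ?case by (rule direct_sum_coeff_spaces)
  next
    case 2
    show ?case unfolding half spin fl using ii by (simp only: t simp_thms cong: imp_cong)
  next
    case 3
    show ?case unfolding half using irreducible_TT by blast
  next
    case 4
    show ?case unfolding half neq using inequivalent_TT by blast
  next
    case 5
    show ?case
    proof (intro allI impI)
      fix V :: "'v set" and T
      assume "irreducible_corep A \<Delta> \<epsilon> V T"
      then obtain n m where "equivalent_corep A V T (VV n m) (TT n m)"
        using irreducible_classification by blast
      then show "\<exists>l\<in>half_nats. \<exists>m. equivalent_corep A V T (Uq2_V q a b D l m) (Uq2_T q a b D \<Delta> l m)"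
        by (intro bexI[of _ "real n / 2"] exI[of _ m]) (auto simp: half_nats_iff)
    qed
  next
    case 6
    show ?case using iv unfolding E_def .
  qed
qed

end
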